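(* Let $q\in\mathbb{C}^{N^2}$ and let $\mathcal{D}$ be the differential complex whose $p$-cochains are the $p$-forms on $\mathcal{B}_q(1)$ with values in $\mathcal{B}'_q$, restricted to closed chains, with differential $$dz(a_{(0)}\otimes a_{(1)}\otimes\cdots\otimes a_{(p)})=\pi(a_{(0)})\,z(a_{(1)}\otimes\cdots\otimes a_{(p)}).$$ Then: (i) $H^0(\mathcal{D})=\mathbb{C}$, and the cohomology of $\mathcal{D}$ is nontrivial (some $H^p(\mathcal{D})$ with $p\ge1$ is nonzero) if $\mathcal{B}_q$ admits irreducible constants of order higher than $2$. (ii) If $C=\sum_{\underline i}C^{i_1\ldots i_k}\xi_{i_1}\cdots\xi_{i_k}$ is a constant in $\mathcal{B}_q$, then $\sum_{\underline i}C^{i_1\ldots i_k}\partial_{i_1}\cdots\partial_{i_k}=0$. (iii) For $p\ge1$, a $p$-cochain $z$ of $\mathcal{D}$ is exact if and only if it is strongly closed.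
   Context: Let $\mathcal{B}=\bigoplus_{n\ge0}\mathcal{B}(n)$ be the unital associative $\mathbb{C}$-algebra freely generated by $\xi_1,\dots,\xi_N$, graded by degree. Given $q=(q_{ij})\in\mathbb{C}^{N^2}$, $\mathcal{B}_q$ is $\mathcal{B}$ equipped with the linear operators $\partial_i$ determined by $\partial_i1=0$, $\partial_i(\xi_jx)=\delta_{ij}x+q_{ij}\xi_j\partial_ix$. A constant is a nonzero $C\in\bigoplus_{n\ge1}\mathcal{B}(n)$ with $\partial_iC=0$ for all $i$; it is homogeneous if it is homogeneous in each generator. A homogeneous constant is irreducible if it does not belong to the two-sided ideal generated by the constants of lower polynomial order. $\mathcal{I}_q$ is the two-sided ideal generated by all constants and $\mathcal{B}'_q=\mathcal{B}_q/\mathcal{I}_q$, with induced grading and operators $\partial_i$; note $\mathcal{B}'_q(1)=\mathcal{B}_q(1)$. $\mathcal{B}'_q$ acts on $\mathcal{B}'_q$ by $\pi(\xi_{i_1}\cdots\xi_{i_k})=\partial_{i_1}\cdots\partial_{i_k}$. On chains $a_1\otimes\cdots\otimes a_p$ with all $a_i\in\mathcal{B}'_q(+)=\bigoplus_{n\ge1}\mathcal{B}'_q(n)$, the boundary is $\partial(a_1\otimes\cdots\otimes a_p)=\sum_{i=1}^{p-1}(-1)^{i+1}a_1\otimes\cdots\otimes a_ia_{i+1}\otimes\cdots\otimes a_p$ (products taken in $\mathcal{B}'_q$; $\partial a_1=0$). A chain $a$ is closed if $\partial a=0$. A chain is written $a=a_{(1)}\otimes\cdots\otimes a_{(p)}$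 with a suppressed summation over decomposable tensors. A $p$-form $z$ on $\mathcal{B}_q(1)$ with values in $\mathcal{B}'_q$ is a linear map from $\mathcal{B}_q(1)^{\otimes p}$ to $\mathcal{B}'_q$; as a cochain of $\mathcal{D}$ it is considered only through its restriction to the closed chains in $\mathcal{B}_q(1)^{\otimes p}$. For $p=0$ the cochains are the elements of $\mathcal{B}'_q$, with $dx(\xi_i)=\partial_ix$. For $p\ge1$, $z$ is exact if there is a $(p-1)$-form $y$ such that $z(a)=\pi(a_{(1)})y(a_{(2)}\otimes\cdots\otimes a_{(p)})$ for all $a=a_{(1)}\otimes\cdots\otimes a_{(p)}\in\mathcal{B}_q(1)^{\otimes p}$ with $\partial a=0$. It is strongly closed if $\pi(a_{(0)})z(a_{(1)}\otimes\cdots\otimes a_{(p)})=0$ for all chains $a=a_{(0)}\otimes a_{(1)}\otimes\cdots\otimes a_{(p)}$ with $\partial a=0$, $a_{(1)},\dots,a_{(p)}\in\mathcal{B}_q(1)$ and $a_{(0)}\in\mathcal{B}'_q(+)$. (When $p=1$, this says that $\sum_{\underline i}C^{i_1\ldots i_k}\partial_{i_1}\cdots\partial_{i_{k-1}}z(\xi_{i_k})=0$ for every constant $C=\sum C^{i_1\ldots i_k}\xi_{i_1}\cdots\xi_{i_k}$ in $\mathcal{B}_q$.) *)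

theory Defs
  imports
    "HOL-Library.Poly_Mapping"
    "HOL-Library.FuncSet"
    "HOL-Algebra.QuotRing"
    "HOL-Algebra.Algebraic_Closure_Type"
begin

text \<open>
  The monoid of words, written additively because the convolution product of
  \<^theory>\<open>HOL-Library.Poly_Mapping\<close> expects an additive monoid of exponents. The (noncommutative)
  ring \<open>'n list \<Rightarrow>\<^sub>0 complex\<close> is then the free unital associative algebra on
  the finite set of generators \<open>'n\<close>, with the word \<open>[i\<^sub>1, \<dots>, i\<^sub>k]\<close>
  standing for the monomial \<open>\<xi>\<^bsub>i\<^sub>1\<^esub> \<cdots> \<xi>\<^bsub>i\<^sub>k\<^esub>\<close>.
\<close>

instantiation list :: (type) monoid_add
begin

definition zero_list :: "'a list" where "zero_list = []"
definition plus_list :: "'a list \<Rightarrow> 'a list \<Rightarrow> 'a list" where "plus_list = (@)"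

instance by standard (simp_all add: zero_list_def plus_list_def)

end

type_synonym 'n falg = "'n list \<Rightarrow>\<^sub>0 complex"

text \<open>Elements of the quotient are cosets. Chains are formal linear combinations of tuples of
  cosets, a tuple standing for a decomposable tensor; the identifications between them that hold in
  the tensor power are imposed by \<open>null_chains\<close> below.\<close>

type_synonym 'n qalg = "'n falg set"
type_synonym 'n chain = "'n qalg list \<Rightarrow>\<^sub>0 complex"
type_synonym 'n cochain = "'n chain \<Rightarrow> 'n qalg"

definition scal :: "complex \<Rightarrow> ('k \<Rightarrow>\<^sub>0 complex) \<Rightarrow> 'k \<Rightarrow>\<^sub>0 complex" where
  "scal c x = Poly_Mapping.map ((*) c) x"

definition lin_ext :: "('k \<Rightarrow> 'l \<Rightarrow>\<^sub>0 complex) \<Rightarrow> ('k \<Rightarrow>\<^sub>0 complex) \<Rightarrow> 'l \<Rightarrow>\<^sub>0 complex" where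
  "lin_ext f x = (\<Sum>w\<in>Poly_Mapping.keys x. scal (Poly_Mapping.lookup x w) (f w))"


lemma lookup_scal [simp]: "Poly_Mapping.lookup (scal c x) k = c * Poly_Mapping.lookup x k"
  by (simp add: scal_def Poly_Mapping.map.rep_eq when_def)

lemma lookup_lin_ext:
  assumes "finite S" "Poly_Mapping.keys x \<subseteq> S"
  shows "Poly_Mapping.lookup (lin_ext f x) k =
    (\<Sum>w\<in>S. Poly_Mapping.lookup x w * Poly_Mapping.lookup (f w) k)"
  unfolding lin_ext_def lookup_sum lookup_scal
  using assms by (intro sum.mono_neutral_left) (auto simp: in_keys_iff)

lemma lin_ext_add: "lin_ext f (x + y) = lin_ext f x + lin_ext f y"
proof (rule poly_mapping_eqI)
  fix k
  let ?S = "Poly_Mapping.keys x \<union> Poly_Mapping.keys y"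
  have "Poly_Mapping.keys (x + y) \<subseteq> ?S" by (rule keys_add)
  then show "Poly_Mapping.lookup (lin_ext f (x + y)) k =
      Poly_Mapping.lookup (lin_ext f x + lin_ext f y) k"
    by (simp add: lookup_add lookup_lin_ext[of ?S] sum.distrib distrib_right)
qed

lemma lin_ext_scal: "lin_ext f (scal c x) = scal c (lin_ext f x)"
proof (rule poly_mapping_eqI)
  fix k
  have "Poly_Mapping.keys (scal c x) \<subseteq> Poly_Mapping.keys x"
    by (auto simp: in_keys_iff)
  then show "Poly_Mapping.lookup (lin_ext f (scal c x)) k =
      Poly_Mapping.lookup (scal c (lin_ext f x)) k"
    by (simp add: lookup_lin_ext[of "Poly_Mapping.keys x"] sum_distrib_left mult.assoc)
qed

lemma lin_ext_single: "lin_ext f (Poly_Mapping.single w c) = scal c (f w)"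
  by (rule poly_mapping_eqI) (simp add: lookup_lin_ext[of "{w}"])


subsection \<open>The algebra with its twisted derivations\<close>

definition gen :: "'n \<Rightarrow> 'n falg" where
  "gen i = Poly_Mapping.single [i] 1"

fun pd_word :: "('n \<Rightarrow> 'n \<Rightarrow> complex) \<Rightarrow> 'n \<Rightarrow> 'n list \<Rightarrow> 'n falg" where
  "pd_word q i [] = 0"
| "pd_word q i (j # w) =
     (if i = j then Poly_Mapping.single w 1 else 0) + scal (q i j) (gen j * pd_word q i w)"

definition pd :: "('n \<Rightarrow> 'n \<Rightarrow> complex) \<Rightarrow> 'n \<Rightarrow> 'n falg \<Rightarrow> 'n falg" where
  "pd q i = lin_ext (pd_word q i)"

text \<open>These are the linear operators determined by \<open>\<partial>\<^sub>i 1 = 0\<close> and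
  \<open>\<partial>\<^sub>i (\<xi>\<^sub>j x) = \<delta>\<^bsub>ij\<^esub> x + q\<^bsub>ij\<^esub> \<xi>\<^sub>j \<partial>\<^sub>i x\<close>.\<close>

lemma pd_add: "pd q i (x + y) = pd q i x + pd q i y"
  by (simp add: pd_def lin_ext_add)

lemma pd_scal: "pd q i (scal c x) = scal c (pd q i x)"
  by (simp add: pd_def lin_ext_scal)

lemma pd_one: "pd q i 1 = 0"
  by (rule poly_mapping_eqI) (simp add: pd_def lin_ext_single zero_list_def flip: single_one)

lemma pd_gen_mult:
  "pd q i (gen j * x) = (if i = j then x else 0) + scal (q i j) (gen j * pd q i x)"
proof (induction x rule: update_induct)
  case const
  show ?case
    by (rule poly_mapping_eqI) (simp add: pd_def lin_ext_def)
next
  case (update f w c)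
  have scal_add: "scal d (y + z) = scal d y + scal d z" for d and y z :: "'a falg"
    by (rule poly_mapping_eqI) (simp add: lookup_add distrib_left)
  have scal_mult: "scal d y = Poly_Mapping.single 0 d * y" for d and y :: "'a falg"
    by (simp add: scal_def mult_map_scale_conv_mult)
  have "pd q i (gen j * Poly_Mapping.single w c) =
      (if i = j then Poly_Mapping.single w c else 0) +
      scal (q i j) (gen j * pd q i (Poly_Mapping.single w c))"
    by (simp add: pd_def gen_def mult_single plus_list_def lin_ext_single scal_mult distrib_left
        zero_list_def mult.commute flip: mult.assoc)
  moreover have "Poly_Mapping.update w c f = f + Poly_Mapping.single w c"
    using update(1)
    by (intro poly_mapping_eqI) (auto simp: lookup_update lookup_add lookup_single in_keys_iff)
  ultimately show ?case
    using update by (simp add: distrib_left pd_add scal_add)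
qed

definition pd_op :: "('n \<Rightarrow> 'n \<Rightarrow> complex) \<Rightarrow> 'n falg \<Rightarrow> 'n falg \<Rightarrow> 'n falg" where
  "pd_op q a x = lin_ext (\<lambda>w. foldr (pd q) w x) a"

definition is_constant :: "('n \<Rightarrow> 'n \<Rightarrow> complex) \<Rightarrow> 'n falg \<Rightarrow> bool" where
  "is_constant q C \<longleftrightarrow> C \<noteq> 0 \<and> Poly_Mapping.lookup C [] = 0 \<and> (\<forall>i. pd q i C = 0)"

definition multihomogeneous :: "'n falg \<Rightarrow> bool" where
  "multihomogeneous x \<longleftrightarrow>
     (\<exists>d :: 'n \<Rightarrow> nat. \<forall>w\<in>Poly_Mapping.keys x. \<forall>i. count_list w i = d i)"

text \<open>Polynomial order, i.e. the total degree; only meaningful for nonzero arguments.\<close>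

definition poly_order :: "'n falg \<Rightarrow> nat" where
  "poly_order x = Max (length ` Poly_Mapping.keys x)"

text \<open>\<^const>\<open>genideal\<close> generates two-sided ideals.\<close>

definition irreducible_constant :: "('n \<Rightarrow> 'n \<Rightarrow> complex) \<Rightarrow> 'n falg \<Rightarrow> bool" where
  "irreducible_constant q C \<longleftrightarrow> is_constant q C \<and> multihomogeneous C \<and>
     C \<notin> genideal ring_of_type_algebra {C'. is_constant q C' \<and> poly_order C' < poly_order C}"


subsection \<open>The quotient by the ideal of constants\<close>

definition const_ideal :: "('n \<Rightarrow> 'n \<Rightarrow> complex) \<Rightarrow> 'n falg set" where
  "const_ideal q = genideal ring_of_type_algebra {C. is_constant q C}"

definition quot :: "('n \<Rightarrow> 'n \<Rightarrow> complex) \<Rightarrow> 'n qalg ring" where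
  "quot q = ring_of_type_algebra Quot const_ideal q"

definition cls :: "('n \<Rightarrow> 'n \<Rightarrow> complex) \<Rightarrow> 'n falg \<Rightarrow> 'n qalg" where
  "cls q x = const_ideal q +>\<^bsub>ring_of_type_algebra\<^esub> x"

definition quot_plus :: "('n \<Rightarrow> 'n \<Rightarrow> complex) \<Rightarrow> 'n qalg set" where
  "quot_plus q = cls q ` {x. Poly_Mapping.lookup x [] = 0}"

text \<open>The degree one part; it is identified with the degree one part of the free algebra, since
  there are no constants of degree one.\<close>

definition quot_one :: "('n \<Rightarrow> 'n \<Rightarrow> complex) \<Rightarrow> 'n qalg set" where
  "quot_one q = cls q ` {x. \<forall>w\<in>Poly_Mapping.keys x. length w = 1}"

definition qscal :: "('n \<Rightarrow> 'n \<Rightarrow> complex) \<Rightarrow> complex \<Rightarrow> 'n qalg \<Rightarrow> 'n qalg" where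
  "qscal q c Y = cls q (Poly_Mapping.single [] c) \<otimes>\<^bsub>quot q\<^esub> Y"

definition qlin_ext ::
  "('n \<Rightarrow> 'n \<Rightarrow> complex) \<Rightarrow> ('k \<Rightarrow> 'n qalg) \<Rightarrow> ('k \<Rightarrow>\<^sub>0 complex) \<Rightarrow> 'n qalg" where
  "qlin_ext q f x =
     (\<Oplus>\<^bsub>quot q\<^esub> w \<in> Poly_Mapping.keys x. qscal q (Poly_Mapping.lookup x w) (f w))"

text \<open>The induced derivations and the action, defined on representatives in the style of
  \<^const>\<open>rcoset_mult\<close>: all the cosets in such a union coincide.\<close>

definition qpd :: "('n \<Rightarrow> 'n \<Rightarrow> complex) \<Rightarrow> 'n \<Rightarrow> 'n qalg \<Rightarrow> 'n qalg" where
  "qpd q i Y = (\<Union>x\<in>Y. cls q (pd q i x))"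

definition qpd_op :: "('n \<Rightarrow> 'n \<Rightarrow> complex) \<Rightarrow> 'n falg \<Rightarrow> 'n qalg \<Rightarrow> 'n qalg" where
  "qpd_op q a Y = qlin_ext q (\<lambda>w. foldr (qpd q) w Y) a"

definition act :: "('n \<Rightarrow> 'n \<Rightarrow> complex) \<Rightarrow> 'n qalg \<Rightarrow> 'n qalg \<Rightarrow> 'n qalg" where
  "act q A Y = (\<Union>a\<in>A. qpd_op q a Y)"


subsection \<open>Chains\<close>

definition tensor_relations :: "('n \<Rightarrow> 'n \<Rightarrow> complex) \<Rightarrow> 'n chain set" where
  "tensor_relations q =
     {Poly_Mapping.single (us @ [v \<oplus>\<^bsub>quot q\<^esub> w] @ vs) 1
        - Poly_Mapping.single (us @ [v] @ vs) 1 - Poly_Mapping.single (us @ [w] @ vs) 1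
      | us vs v w. set us \<subseteq> quot_plus q \<and> set vs \<subseteq> quot_plus q \<and>
          v \<in> quot_plus q \<and> w \<in> quot_plus q} \<union>
     {Poly_Mapping.single (us @ [qscal q c v] @ vs) 1 - Poly_Mapping.single (us @ [v] @ vs) c
      | us vs c v. set us \<subseteq> quot_plus q \<and> set vs \<subseteq> quot_plus q \<and> v \<in> quot_plus q}"

text \<open>The formal combinations that vanish in the tensor powers of \<^const>\<open>quot_plus\<close>.\<close>

definition null_chains :: "('n \<Rightarrow> 'n \<Rightarrow> complex) \<Rightarrow> 'n chain set" where
  "null_chains q = module.span scal (tensor_relations q)"

text \<open>Positions are counted from 0, so the sign is \<open>(-1)\<^sup>i\<close>.\<close>

definition bd_tuple :: "('n \<Rightarrow> 'n \<Rightarrow> complex) \<Rightarrow> 'n qalg list \<Rightarrow> 'n chain" where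
  "bd_tuple q as =
     (\<Sum>i<length as - 1. Poly_Mapping.single
        (take i as @ [as ! i \<otimes>\<^bsub>quot q\<^esub> as ! Suc i] @ drop (i + 2) as) ((-1) ^ i))"

definition closed_chain :: "('n \<Rightarrow> 'n \<Rightarrow> complex) \<Rightarrow> 'n chain \<Rightarrow> bool" where
  "closed_chain q a \<longleftrightarrow> lin_ext (bd_tuple q) a \<in> null_chains q"

text \<open>Closed chains in the \<open>p\<close>-th tensor power of the degree one part, respectively with
  one additional leading factor of arbitrary positive degree.\<close>

definition closed_chains :: "('n \<Rightarrow> 'n \<Rightarrow> complex) \<Rightarrow> nat \<Rightarrow> 'n chain set" where
  "closed_chains q p = {a. closed_chain q a \<and>
     (\<forall>as\<in>Poly_Mapping.keys a. length as = p \<and> set as \<subseteq> quot_one q)}"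

definition ext_closed_chains :: "('n \<Rightarrow> 'n \<Rightarrow> complex) \<Rightarrow> nat \<Rightarrow> 'n chain set" where
  "ext_closed_chains q p = {a. closed_chain q a \<and>
     (\<forall>as\<in>Poly_Mapping.keys a.
        length as = Suc p \<and> hd as \<in> quot_plus q \<and> set (tl as) \<subseteq> quot_one q)}"


subsection \<open>Forms and the differential complex\<close>

text \<open>A \<open>p\<close>-form is a linear map on the \<open>p\<close>-th tensor power, i.e. a multilinear
  map on \<open>p\<close>-tuples; a 0-form is the element of the quotient assigned to the empty tuple.\<close>

definition is_form ::
  "('n \<Rightarrow> 'n \<Rightarrow> complex) \<Rightarrow> nat \<Rightarrow> ('n qalg list \<Rightarrow> 'n qalg) \<Rightarrow> bool" where
  "is_form q p z \<longleftrightarrow>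
     (\<forall>as. length as = p \<longrightarrow> set as \<subseteq> quot_one q \<longrightarrow> z as \<in> carrier (quot q)) \<and>
     (\<forall>us vs v w. length us + 1 + length vs = p \<longrightarrow> set us \<subseteq> quot_one q \<longrightarrow>
        set vs \<subseteq> quot_one q \<longrightarrow> v \<in> quot_one q \<longrightarrow> w \<in> quot_one q \<longrightarrow>
        z (us @ [v \<oplus>\<^bsub>quot q\<^esub> w] @ vs) = z (us @ [v] @ vs) \<oplus>\<^bsub>quot q\<^esub> z (us @ [w] @ vs)) \<and>
     (\<forall>us vs c v. length us + 1 + length vs = p \<longrightarrow> set us \<subseteq> quot_one q \<longrightarrow>
        set vs \<subseteq> quot_one q \<longrightarrow> v \<in> quot_one q \<longrightarrow>
        z (us @ [qscal q c v] @ vs) = qscal q c (z (us @ [v] @ vs)))"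

definition form_diff ::
  "('n \<Rightarrow> 'n \<Rightarrow> complex) \<Rightarrow> ('n qalg list \<Rightarrow> 'n qalg) \<Rightarrow> 'n qalg list \<Rightarrow> 'n qalg" where
  "form_diff q z as = act q (hd as) (z (tl as))"

definition cochain_of ::
  "('n \<Rightarrow> 'n \<Rightarrow> complex) \<Rightarrow> nat \<Rightarrow> ('n qalg list \<Rightarrow> 'n qalg) \<Rightarrow> 'n cochain" where
  "cochain_of q p z = restrict (qlin_ext q z) (closed_chains q p)"

definition cochains :: "('n \<Rightarrow> 'n \<Rightarrow> complex) \<Rightarrow> nat \<Rightarrow> 'n cochain monoid" where
  "cochains q p =
     \<lparr>carrier = {cochain_of q p z | z. is_form q p z},
      monoid.mult = \<lambda>f g. restrict (\<lambda>a. f a \<oplus>\<^bsub>quot q\<^esub> g a) (closed_chains q p),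
      one = restrict (\<lambda>a. \<zero>\<^bsub>quot q\<^esub>) (closed_chains q p)\<rparr>"

text \<open>The differential of a cochain is computed from any form that restricts to it. The choice is
  immaterial: a closed chain in the \<open>(p + 1)\<close>-st tensor power of the degree one part is a
  combination of tensors of a generator with a closed chain in the \<open>p\<close>-th one.\<close>

definition differential :: "('n \<Rightarrow> 'n \<Rightarrow> complex) \<Rightarrow> nat \<Rightarrow> 'n cochain \<Rightarrow> 'n cochain" where
  "differential q p f =
     cochain_of q (Suc p) (form_diff q (SOME z. is_form q p z \<and> cochain_of q p z = f))"

definition cocycles :: "('n \<Rightarrow> 'n \<Rightarrow> complex) \<Rightarrow> nat \<Rightarrow> 'n cochain set" where
  "cocycles q p = kernel (cochains q p) (cochains q (Suc p)) (differential q p)"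

definition coboundaries :: "('n \<Rightarrow> 'n \<Rightarrow> complex) \<Rightarrow> nat \<Rightarrow> 'n cochain set" where
  "coboundaries q p =
     (case p of 0 \<Rightarrow> {\<one>\<^bsub>cochains q 0\<^esub>} | Suc r \<Rightarrow> differential q r ` carrier (cochains q r))"

definition cohomology :: "('n \<Rightarrow> 'n \<Rightarrow> complex) \<Rightarrow> nat \<Rightarrow> 'n cochain set monoid" where
  "cohomology q p = (cochains q p)\<lparr>carrier := cocycles q p\<rparr> Mod coboundaries q p"

text \<open>The class in \<open>H\<^sup>0\<close> of the multiple \<open>c\<close> of the unit.\<close>

definition unit_class :: "('n \<Rightarrow> 'n \<Rightarrow> complex) \<Rightarrow> complex \<Rightarrow> 'n cochain set" where
  "unit_class q c = coboundaries q 0 #>\<^bsub>cochains q 0\<^esub>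
     cochain_of q 0 (\<lambda>_. qscal q c \<one>\<^bsub>quot q\<^esub>)"

definition exact_form ::
  "('n \<Rightarrow> 'n \<Rightarrow> complex) \<Rightarrow> nat \<Rightarrow> ('n qalg list \<Rightarrow> 'n qalg) \<Rightarrow> bool" where
  "exact_form q p z \<longleftrightarrow>
     (\<exists>y. is_form q (p - 1) y \<and>
        (\<forall>a\<in>closed_chains q p. qlin_ext q z a = qlin_ext q (form_diff q y) a))"

definition strongly_closed ::
  "('n \<Rightarrow> 'n \<Rightarrow> complex) \<Rightarrow> nat \<Rightarrow> ('n qalg list \<Rightarrow> 'n qalg) \<Rightarrow> bool" where
  "strongly_closed q p z \<longleftrightarrow>
     (\<forall>a\<in>ext_closed_chains q p. qlin_ext q (form_diff q z) a = \<zero>\<^bsub>quot q\<^esub>)"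

end

theory Submission
  imports Defs
begin

text \<open>
  Write \<open>\<pi>(u)\<close> for the operator \<open>pd_op q u\<close> on the free algebra and
  \<open>\<langle>u, x\<rangle>\<close> for the constant term of \<open>\<pi>(u) x\<close>. Everything rests on
  the commutation rule
  \<open>\<pi>(u)(x \<xi>\<^sub>j) = (\<pi>(u) x) \<xi>\<^sub>j + \<tau>\<^sub>j \<pi>(\<partial>\<^sub>j u) x\<close>
  (\<open>pd_op_mult_gen\<close>), in which \<open>\<tau>\<^sub>j\<close> rescales the generators. It has two
  consequences.

  First, if \<open>u\<close> is a constant, then \<open>\<pi>(u)\<close> commutes with right multiplications and kills 1,
  so \<open>\<pi>(u) = 0\<close>. This is part (ii).

  Second, \<open>\<langle>u, x \<xi>\<^sub>j\<rangle> = \<langle>\<partial>\<^sub>j u, x\<rangle>\<close>, while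
  \<open>\<langle>u \<xi>\<^sub>j, x\<rangle> = \<langle>u, \<partial>\<^sub>j x\<rangle>\<close> by definition, so the form is
  symmetric (\<open>pair_commute\<close>). The kernel of \<open>\<pi>\<close> is a two-sided ideal containing the constants,
  and it lies in the radical. Conversely the radical lies in the left ideal generated by the
  constants (\<open>rad_subset_left_ideal\<close>): with a dual basis \<open>e\<^sub>s\<close> of words \<open>s\<close> of length
  \<open>k\<close>, subtracting \<open>\<Sum> s \<cdot> \<pi>(e\<^sub>s) x\<close> from \<open>x\<close> removes the derivatives of order
  \<open>k\<close> of \<open>x\<close> when all derivatives of higher order vanish, because the coefficients
  \<open>\<pi>(e\<^sub>s) x\<close> are then constants. Hence the ideal of constants, the kernel of \<open>\<pi>\<close> and the
  radical coincide (\<open>const_ideal_eq_rad\<close>), and the form is nondegenerate on the quotient. In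
  particular the quotient has no constants, which gives \<open>H\<^sup>0\<close>.

  Nondegeneracy identifies the quotient with the graded dual of its regular module, so it is
  injective as a graded module over itself under \<open>\<pi>\<close>. Strong closedness of \<open>z\<close> says that the
  module map sending \<open>e \<otimes> a\<close> to \<open>\<pi>(e) z(a)\<close> vanishes on the kernel of
  \<open>e \<otimes> a \<mapsto> e a\<^sub>(\<^sub>1\<^sub>) \<otimes> a\<^sub>(\<^sub>2\<^sub>)\<close>, where \<open>a\<close> runs through the closed chains;
  exactness says that it extends through the target of that map. This is part (iii); in
  concrete terms, a functional on a subspace is extended and then represented by the form.
  The converse direction is the computation that a boundary is annihilated.

  For the nonvanishing of cohomology, let \<open>C\<close> be irreducible of order \<open>k > 2\<close>. A functional that
  vanishes on the ideal generated by the constants of lower order but not at \<open>C\<close> is, in degree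
  \<open>k\<close>, of the form \<open>u \<xi>\<^sub>j \<mapsto> \<langle>u, z(\<xi>\<^sub>j)\<rangle>\<close> for a 1-form \<open>z\<close>. The
  form \<open>z\<close> is closed since the functional kills the quadratic constants, and it is not exact since
  exactness would force the functional to vanish at \<open>C\<close>.

  The remaining work passes between formal chains of tuples of cosets and families of coefficients
  indexed by words. A tuple is tested against a list of words by multiplying the values of the form
  slot by slot, and these tests detect all null chains (\<open>null_chains_complete\<close>).
\<close>


abbreviation lookup where "lookup \<equiv> Poly_Mapping.lookup"
abbreviation keys where "keys \<equiv> Poly_Mapping.keys"
abbreviation single where "single \<equiv> Poly_Mapping.single"

section \<open>Linear algebra of formal combinations\<close>

interpretation pm: vector_space "scal :: complex \<Rightarrow> ('k \<Rightarrow>\<^sub>0 complex) \<Rightarrow> 'k \<Rightarrow>\<^sub>0 complex"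
  by unfold_locales (auto intro!: poly_mapping_eqI simp: lookup_add algebra_simps)

interpretation pmc: vector_space_pair "scal :: complex \<Rightarrow> ('k \<Rightarrow>\<^sub>0 complex) \<Rightarrow> 'k \<Rightarrow>\<^sub>0 complex"
  "(*) :: complex \<Rightarrow> complex \<Rightarrow> complex"
  by unfold_locales (auto simp: algebra_simps)

\<comment> \<open>Here this is associativity of multiplication, oriented against \<open>mult.assoc\<close>.\<close>
declare pmc.vs2.scale_scale [simp del]

interpretation pmp: vector_space_pair "scal :: complex \<Rightarrow> ('k \<Rightarrow>\<^sub>0 complex) \<Rightarrow> 'k \<Rightarrow>\<^sub>0 complex"
  "scal :: complex \<Rightarrow> ('l \<Rightarrow>\<^sub>0 complex) \<Rightarrow> 'l \<Rightarrow>\<^sub>0 complex"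
  by unfold_locales

abbreviation lin_map :: "(('k \<Rightarrow>\<^sub>0 complex) \<Rightarrow> 'l \<Rightarrow>\<^sub>0 complex) \<Rightarrow> bool" where
  "lin_map \<equiv> Vector_Spaces.linear scal scal"

abbreviation lin_form :: "(('k \<Rightarrow>\<^sub>0 complex) \<Rightarrow> complex) \<Rightarrow> bool" where
  "lin_form \<equiv> Vector_Spaces.linear scal (*)"

lemma lin_mapI:
  assumes "\<And>x y. f (x + y) = f x + f y" "\<And>c x. f (scal c x) = scal c (f x)"
  shows "lin_map f"
  using assms by (simp add: Vector_Spaces.linear_iff pm.vector_space_axioms pmc.vs2.vector_space_axioms)

lemma lin_formI:
  assumes "\<And>x y. f (x + y) = f x + f y" "\<And>c x. f (scal c x) = c * f x"
  shows "lin_form f"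
  using assms by (simp add: Vector_Spaces.linear_iff pm.vector_space_axioms pmc.vs2.vector_space_axioms)

lemma pm_expand: "x = (\<Sum>k\<in>keys x. scal (lookup x k) (single k 1))"
proof (rule poly_mapping_eqI)
  fix k
  have "(\<Sum>j\<in>keys x. lookup x j * lookup (single j 1) k) = (\<Sum>j\<in>keys x. if j = k then lookup x k else 0)"
    by (intro sum.cong) (auto simp: lookup_single when_def)
  then show "lookup x k = lookup (\<Sum>k\<in>keys x. scal (lookup x k) (single k 1)) k"
    by (simp add: lookup_sum in_keys_iff)
qed

lemma pm_induct [case_names single add scal]:
  assumes s: "\<And>k. P (single k 1)"
    and a: "\<And>x y. P x \<Longrightarrow> P y \<Longrightarrow> P (x + y)"
    and m: "\<And>c x. P x \<Longrightarrow> P (scal c x)"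
  shows "P x"
proof -
  have "P (scal 0 (single undefined 1))" by (intro m s)
  then have z: "P 0" by simp
  have "P (\<Sum>k\<in>A. scal (f k) (single k 1))" if "finite A" for A f
    using that by induction (auto intro: z a m s)
  then show ?thesis
    by (subst pm_expand[of x]) auto
qed

lemma lin_form_eqI:
  assumes "lin_form f" "lin_form g" "\<And>k. f (single k 1) = g (single k 1)"
  shows "f x = g x"
  by (induction x rule: pm_induct)
    (use assms in \<open>auto simp: pmc.linear_add pmc.linear_scale\<close>)

lemma lin_map_lin_ext: "lin_map (lin_ext f)"
  by (intro lin_mapI lin_ext_add lin_ext_scal)

lemma lin_ext_single_one [simp]: "lin_ext f (single k 1) = f k"
  by (simp add: lin_ext_single)

definition form_ext :: "('k \<Rightarrow> complex) \<Rightarrow> ('k \<Rightarrow>\<^sub>0 complex) \<Rightarrow> complex" where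
  "form_ext f x = (\<Sum>k\<in>keys x. lookup x k * f k)"

lemma form_ext_superset:
  assumes "finite S" "keys x \<subseteq> S"
  shows "form_ext f x = (\<Sum>k\<in>S. lookup x k * f k)"
  unfolding form_ext_def
  using assms by (intro sum.mono_neutral_left) (auto simp: in_keys_iff)

lemma lin_form_form_ext: "lin_form (form_ext f)"
proof (rule lin_formI)
  fix x y :: "'a \<Rightarrow>\<^sub>0 complex"
  let ?S = "keys x \<union> keys y"
  have "keys (x + y) \<subseteq> ?S" by (rule keys_add)
  then show "form_ext f (x + y) = form_ext f x + form_ext f y"
    by (simp add: form_ext_superset[of ?S] lookup_add distrib_right sum.distrib)
next
  fix c and x :: "'a \<Rightarrow>\<^sub>0 complex"
  have "keys (scal c x) \<subseteq> keys x" by (auto simp: in_keys_iff)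
  then show "form_ext f (scal c x) = c * form_ext f x"
    by (subst (1 2) form_ext_superset[of "keys x"]) (auto simp: sum_distrib_left mult.assoc)
qed

lemma form_ext_single [simp]: "form_ext f (single k c) = c * f k"
  by (simp add: form_ext_superset[of "{k}"])

lemmas form_ext_add = pmc.linear_add[OF lin_form_form_ext]
  and form_ext_scal = pmc.linear_scale[OF lin_form_form_ext]
  and form_ext_sum = pmc.linear_sum[OF lin_form_form_ext]
  and form_ext_diff = pmc.linear_diff[OF lin_form_form_ext]
  and form_ext_0 = pmc.linear_0[OF lin_form_form_ext]

lemma lin_form_comp: "lin_form f \<Longrightarrow> lin_map g \<Longrightarrow> lin_form (\<lambda>x. f (g x))"
  by (simp add: Vector_Spaces.linear_iff)

text \<open>Every extension of functionals below is an instance of this: a right inverse of \<open>T\<close> on its image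
  turns a functional on the source that respects the kernel into one on the whole target.\<close>

lemma lin_form_factor:
  assumes T: "lin_map T" and f: "lin_form f" and V: "pm.subspace V"
    and ker: "\<And>x. x \<in> V \<Longrightarrow> T x = 0 \<Longrightarrow> f x = 0"
  obtains g where "lin_form g" "\<And>x. x \<in> V \<Longrightarrow> g (T x) = f x"
proof -
  obtain h where h: "range h \<subseteq> V" "lin_map h" "\<And>y. y \<in> T ` V \<Longrightarrow> T (h y) = y"
    using pmp.linear_exists_right_inverse_on[OF T V] by blast
  show ?thesis
  proof (rule that)
    show "lin_form (\<lambda>y. f (h y))" by (rule lin_form_comp[OF f h(2)])
    fix x assume x: "x \<in> V"
    have "T (h (T x) - x) = 0"
      using h(3) x by (simp add: pmp.linear_diff[OF T])
    moreover have "h (T x) - x \<in> V"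
      using h(1) x by (intro pm.subspace_diff[OF V]) auto
    ultimately have "f (h (T x) - x) = 0" by (intro ker)
    then show "f (h (T x)) = f x" by (simp add: pmc.linear_diff[OF f])
  qed
qed

section \<open>The free algebra\<close>

lemma single_Nil_one: "single [] 1 = (1 :: 'n falg)"
  by (simp add: zero_list_def flip: single_one)

lemma single_word_mult: "single u c * single v d = (single (u @ v) (c * d) :: 'n falg)"
  by (simp add: mult_single plus_list_def)

lemma scal_conv_mult: "scal c x = single [] c * (x :: 'n falg)"
  by (simp add: scal_def mult_map_scale_conv_mult zero_list_def)

lemma scal_mult_left: "scal c x * y = scal c (x * y :: 'n falg)"
  by (simp add: scal_conv_mult mult.assoc)

lemma scal_mult_right: "x * scal c y = scal c (x * y :: 'n falg)"
proof -
  have "x * single [] c = single [] c * x"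
    by (induction x rule: pm_induct)
      (auto simp: single_word_mult distrib_left distrib_right scal_mult_left
        simp flip: scal_conv_mult)
  then show ?thesis by (simp add: scal_conv_mult flip: mult.assoc)
qed

lemma lin_map_mult_right: "lin_map (\<lambda>x. x * (a :: 'n falg))"
  by (rule lin_mapI) (simp_all add: distrib_right scal_mult_left)

lemma gen_mult_word: "gen j * single w c = single (j # w) c"
  by (simp add: gen_def single_word_mult)

lemma word_mult_gen: "single w c * gen j = single (w @ [j]) c"
  by (simp add: gen_def single_word_mult)

lemma falg_left_induct [case_names one gen add scal]:
  fixes x :: "'n falg"
  assumes "P 1" "\<And>j x. P x \<Longrightarrow> P (gen j * x)"
    "\<And>x y. P x \<Longrightarrow> P y \<Longrightarrow> P (x + y)" "\<And>c x. P x \<Longrightarrow> P (scal c x)"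
  shows "P x"
proof (induction x rule: pm_induct)
  case (single w)
  show ?case
    by (induction w) (use assms(1,2) in \<open>auto simp: single_Nil_one simp flip: gen_mult_word\<close>)
qed (use assms in auto)

lemma falg_right_induct [case_names one gen add scal]:
  fixes x :: "'n falg"
  assumes "P 1" "\<And>j x. P x \<Longrightarrow> P (x * gen j)"
    "\<And>x y. P x \<Longrightarrow> P y \<Longrightarrow> P (x + y)" "\<And>c x. P x \<Longrightarrow> P (scal c x)"
  shows "P x"
proof (induction x rule: pm_induct)
  case (single w)
  show ?case
    by (induction w rule: rev_induct)
      (use assms(1,2) in \<open>auto simp: single_Nil_one simp flip: word_mult_gen\<close>)
qed (use assms in auto)

abbreviation eps :: "'n falg \<Rightarrow> complex" where
  "eps x \<equiv> lookup x []"

lemma eps_gen_mult [simp]: "eps (gen j * x) = 0"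
  by (induction x rule: pm_induct) (auto simp: gen_mult_word lookup_single distrib_left lookup_add scal_mult_right)

lemma eps_mult_gen [simp]: "eps (x * gen j) = 0"
  by (induction x rule: pm_induct) (auto simp: word_mult_gen lookup_single distrib_right lookup_add scal_mult_left)

lemma eps_one [simp]: "eps (1 :: 'n falg) = 1"
  by (simp flip: single_Nil_one)

subsection \<open>Homogeneous elements\<close>

definition homog :: "nat \<Rightarrow> 'n falg \<Rightarrow> bool" where
  "homog n x \<longleftrightarrow> (\<forall>w\<in>keys x. length w = n)"

definition hcomp :: "nat \<Rightarrow> 'n falg \<Rightarrow> 'n falg" where
  "hcomp n = lin_ext (\<lambda>w. if length w = n then single w 1 else 0)"

lemma lin_map_hcomp: "lin_map (hcomp n)"
  unfolding hcomp_def by (rule lin_map_lin_ext)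

lemma homog_lookup: "homog n x \<longleftrightarrow> (\<forall>w. length w \<noteq> n \<longrightarrow> lookup x w = 0)"
  by (auto simp: homog_def in_keys_iff)

lemma lookup_hcomp: "lookup (hcomp n x) w = (if length w = n then lookup x w else 0)"
  unfolding hcomp_def
  by (induction x rule: pm_induct)
    (auto simp: lin_ext_add lin_ext_scal lookup_add lookup_single when_def)

lemma homog_hcomp [simp]: "homog n (hcomp n x)"
  by (simp add: homog_lookup lookup_hcomp)

lemma hcomp_homog: "homog m x \<Longrightarrow> hcomp n x = (if m = n then x else 0)"
  by (rule poly_mapping_eqI) (auto simp: homog_lookup lookup_hcomp)

lemma homog_0 [simp]: "homog n 0"
  and homog_add: "homog n x \<Longrightarrow> homog n y \<Longrightarrow> homog n (x + y)"
  and homog_scal: "homog n x \<Longrightarrow> homog n (scal c x)"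
  by (auto simp: homog_lookup lookup_add)

lemma homog_sum: "(\<And>i. i \<in> A \<Longrightarrow> homog n (f i)) \<Longrightarrow> homog n (sum f A)"
  by (auto simp: homog_lookup lookup_sum)

lemma homog_single [simp]: "c \<noteq> 0 \<Longrightarrow> homog n (single w c) \<longleftrightarrow> length w = n"
  by (auto simp: homog_lookup lookup_single when_def)

lemma homog_singleI: "length w = n \<Longrightarrow> homog n (single w c)"
  by (auto simp: homog_lookup lookup_single when_def)

lemma homog_induct [consumes 1, case_names single add scal zero]:
  assumes "homog n x"
    and s: "\<And>w. length w = n \<Longrightarrow> P (single w 1)"
    and a: "\<And>x y. P x \<Longrightarrow> P y \<Longrightarrow> P (x + y)"
    and m: "\<And>c x. P x \<Longrightarrow> P (scal c x)"
    and z: "P 0"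
  shows "P x"
proof -
  have "P (\<Sum>k\<in>A. scal (f k) (single k 1))" if "finite A" "\<And>w. w \<in> A \<Longrightarrow> length w = n" for A f
    using that by induction (auto intro: z a m s)
  then show ?thesis
    using assms(1) by (subst pm_expand[of x]) (auto simp: homog_def)
qed

lemma homog_mult:
  assumes "homog m x" "homog n y"
  shows "homog (m + n) (x * y)"
  using assms(1)
proof (induction rule: homog_induct)
  case (single w)
  show ?case
    using assms(2)
    by (induction rule: homog_induct)
      (auto simp: single_word_mult single distrib_left scal_mult_right intro: homog_add homog_scal)
qed (auto simp: distrib_right scal_mult_left intro: homog_add homog_scal)

lemma homog_gen [simp]: "homog (Suc 0) (gen i)"
  by (simp add: gen_def)

lemma homog_zero_const: "homog 0 x \<Longrightarrow> x = scal (eps x) 1"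
  by (rule poly_mapping_eqI)
    (auto simp: homog_lookup lookup_single when_def simp flip: single_Nil_one)

lemma sum_hcomp:
  assumes "\<And>w. w \<in> keys x \<Longrightarrow> length w \<le> n"
  shows "x = (\<Sum>k\<le>n. hcomp k x)"
proof (rule poly_mapping_eqI)
  fix w
  have "(\<Sum>k\<le>n. lookup (hcomp k x) w) = (\<Sum>k\<le>n. if k = length w then lookup x w else 0)"
    by (intro sum.cong) (auto simp: lookup_hcomp)
  then show "lookup x w = lookup (\<Sum>k\<le>n. hcomp k x) w"
    using assms by (auto simp: lookup_sum in_keys_iff)
qed

lemma finite_words: "finite {w :: 'n::finite list. length w = n}"
  using finite_lists_length_eq[of "UNIV :: 'n set"] by simp

lemma finite_words_le: "finite {w :: 'n::finite list. length w \<le> n}"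
  using finite_lists_length_le[of "UNIV :: 'n set"] by simp

lemma sum_lists_Suc:
  fixes f :: "'a list \<Rightarrow> 'b :: comm_monoid_add"
  shows "(\<Sum>w | set w \<subseteq> F \<and> length w = Suc n. f w) = (\<Sum>i\<in>F. \<Sum>w | set w \<subseteq> F \<and> length w = n. f (i # w))"
proof -
  have "bij_betw (\<lambda>(i, w). i # w) (F \<times> {w. set w \<subseteq> F \<and> length w = n}) {w. set w \<subseteq> F \<and> length w = Suc n}"
    by (rule bij_betwI[where g = "\<lambda>w. (hd w, tl w)"]) (auto simp: length_Suc_conv)
  from sum.reindex_bij_betw[OF this, of f] show ?thesis
    by (simp add: sum.cartesian_product case_prod_unfold)
qed

lemma sum_words_Suc:
  fixes f :: "'n::finite list \<Rightarrow> 'a :: comm_monoid_add"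
  shows "(\<Sum>w | length w = Suc n. f w) = (\<Sum>i\<in>UNIV. \<Sum>w | length w = n. f (i # w))"
  using sum_lists_Suc[where F = UNIV and f = f] by simp

section \<open>The operators and the bilinear form\<close>

lemma lin_map_pd: "lin_map (pd q i)"
  by (intro lin_mapI pd_add pd_scal)

lemmas pd_zero [simp] = pmp.linear_0[OF lin_map_pd]

text \<open>The twist in the rule for \<open>\<partial>\<^sub>j\<close> on a product \<open>x \<xi>\<^sub>j\<close>: an operator \<open>\<partial>\<^sub>j\<close> that
  reaches the last letter has passed every letter of \<open>x\<close> and collected its factor.\<close>

definition tw :: "('n \<Rightarrow> 'n \<Rightarrow> complex) \<Rightarrow> 'n \<Rightarrow> 'n falg \<Rightarrow> 'n falg" where
  "tw q j = lin_ext (\<lambda>w. single w (prod_list (map (q j) w)))"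

lemma tw_add: "tw q j (x + y) = tw q j x + tw q j y"
  and tw_scal: "tw q j (scal c x) = scal c (tw q j x)"
  by (simp_all add: tw_def lin_ext_add lin_ext_scal)

lemma tw_zero [simp]: "tw q j 0 = 0"
  by (simp add: tw_def lin_ext_def)

lemma tw_one [simp]: "tw q j 1 = 1"
  by (simp add: tw_def flip: single_Nil_one)

lemma scal_single: "scal c (single w d) = single w (c * d)"
  by (rule poly_mapping_eqI) (simp add: lookup_single when_def)

lemma tw_gen_mult: "tw q j (gen a * x) = scal (q j a) (gen a * tw q j x)"
  by (induction x rule: pm_induct)
    (auto simp: tw_def gen_mult_word scal_single distrib_left lin_ext_add scal_mult_right lin_ext_scal
      pm.scale_right_distrib mult.commute)

lemma eps_tw [simp]: "eps (tw q j x) = eps x"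
  by (induction x rule: pm_induct)
    (auto simp: tw_def lookup_single lin_ext_add lookup_add lin_ext_scal when_def)

lemma pd_tw: "pd q a (tw q j x) = scal (q j a) (tw q j (pd q a x))"
proof (induction x rule: falg_left_induct)
  case (gen b x)
  then show ?case
    by (auto simp: tw_gen_mult pd_gen_mult pd_scal tw_add tw_scal pm.scale_right_distrib
        scal_mult_right mult.commute)
qed (auto simp: pd_one tw_add tw_scal pd_add pd_scal pm.scale_right_distrib mult.commute)

lemma pd_mult_gen:
  "pd q i (x * gen j) = pd q i x * gen j + (if i = j then tw q i x else 0)"
proof (induction x rule: falg_left_induct)
  case one
  then show ?case using pd_gen_mult[of q i j 1] by (simp add: pd_one)
next
  case (gen b x)
  then show ?case
    by (auto simp: mult.assoc pd_gen_mult distrib_left distrib_right tw_gen_mult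
        pm.scale_right_distrib scal_mult_left)
qed (auto simp: pd_add pd_scal tw_add tw_scal distrib_left distrib_right scal_mult_left 
      pm.scale_right_distrib)

text \<open>No twist appears for a constant right factor, since it would multiply a derivative of that factor.\<close>

lemma pd_mult_constant:
  assumes "\<And>i. pd q i c = 0"
  shows "pd q i (b * c) = pd q i b * c"
  by (induction b rule: falg_left_induct)
    (auto simp: assms pd_one mult.assoc pd_gen_mult distrib_left distrib_right scal_mult_left
      pd_add pd_scal)

lemma homog_pd:
  assumes "homog n x"
  shows "homog (n - 1) (pd q i x)"
  using assms
proof (induction rule: homog_induct)
  case (single w)
  then show ?case
  proof (induction w arbitrary: n)
    case Nil
    then show ?case by (simp add: single_Nil_one pd_one)
  next
    case (Cons j w)
    have "homog (n - 1) (gen j * pd q i (single w 1))"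
    proof (cases w)
      case Nil
      then show ?thesis by (simp add: single_Nil_one pd_one)
    next
      case (Cons k w')
      then show ?thesis
        using Cons.prems Cons.IH[of "length w"] homog_mult[OF homog_gen] by fastforce
    qed
    then show ?case
      using Cons.prems by (auto simp flip: gen_mult_word simp: pd_gen_mult intro!: homog_add homog_scal)
  qed
qed (auto simp: pd_add pd_scal intro: homog_add homog_scal)

subsection \<open>The action of the free algebra\<close>

lemma foldr_pd_add: "foldr (pd q) w (x + y) = foldr (pd q) w x + foldr (pd q) w y"
  by (induction w) (auto simp: pd_add)

lemma foldr_pd_scal: "foldr (pd q) w (scal c x) = scal c (foldr (pd q) w x)"
  by (induction w) (auto simp: pd_scal)

lemma lin_map_pd_op_left: "lin_map (\<lambda>a. pd_op q a x)"
  unfolding pd_op_def by (rule lin_map_lin_ext)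

lemma pd_op_word [simp]: "pd_op q (single w 1) x = foldr (pd q) w x"
  by (simp add: pd_op_def)

lemmas pd_op_add_left = pmp.linear_add[OF lin_map_pd_op_left]
  and pd_op_scal_left = pmp.linear_scale[OF lin_map_pd_op_left]
  and pd_op_sum_left = pmp.linear_sum[OF lin_map_pd_op_left]
  and pd_op_diff_left = pmp.linear_diff[OF lin_map_pd_op_left]
  and pd_op_0_left [simp] = pmp.linear_0[OF lin_map_pd_op_left]

lemma lin_map_pd_op_right: "lin_map (pd_op q a)"
proof (rule lin_mapI)
  show "pd_op q a (x + y) = pd_op q a x + pd_op q a y" for x y
    by (induction a rule: pm_induct)
      (auto simp: foldr_pd_add pd_op_add_left pd_op_scal_left pm.scale_right_distrib)
  show "pd_op q a (scal c x) = scal c (pd_op q a x)" for c x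
    by (induction a rule: pm_induct)
      (auto simp: foldr_pd_scal pd_op_add_left pd_op_scal_left pm.scale_right_distrib mult.commute)
qed

lemmas pd_op_add_right = pmp.linear_add[OF lin_map_pd_op_right]
  and pd_op_scal_right = pmp.linear_scale[OF lin_map_pd_op_right]
  and pd_op_sum_right = pmp.linear_sum[OF lin_map_pd_op_right]
  and pd_op_diff_right = pmp.linear_diff[OF lin_map_pd_op_right]
  and pd_op_0_right [simp] = pmp.linear_0[OF lin_map_pd_op_right]

lemma pd_op_one [simp]: "pd_op q 1 x = x"
  by (simp flip: single_Nil_one)

lemma pd_op_mult: "pd_op q (a * b) x = pd_op q a (pd_op q b x)"
proof (induction a rule: pm_induct)
  case (single u)
  show ?case
    by (induction b rule: pm_induct)
      (auto simp: single_word_mult distrib_left scal_mult_right pd_op_add_left pd_op_scal_left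
        foldr_pd_add foldr_pd_scal)
qed (auto simp: distrib_right scal_mult_left pd_op_add_left pd_op_scal_left)

lemma pd_op_gen [simp]: "pd_op q (gen i) x = pd q i x"
  by (simp add: gen_def)

lemma homog_pd_op:
  assumes "homog m a" "homog n x" "m \<le> n"
  shows "homog (n - m) (pd_op q a x)"
  using assms(1)
proof (induction rule: homog_induct)
  case (single w)
  have "homog (n - length w) (foldr (pd q) w x)"
  proof (induction w)
    case Nil
    then show ?case using assms(2) by simp
  next
    case (Cons i w)
    from homog_pd[OF this, of q i] show ?case by simp
  qed
  then show ?case using single by simp
qed (auto simp: pd_op_add_left pd_op_scal_left intro: homog_add homog_scal)

text \<open>The letter \<open>\<xi>\<^sub>j\<close> is removed by one of the operators in \<open>u\<close>, and commuting the resulting twist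
  to the left past the operators in front of it produces exactly the coefficients of
  \<open>\<partial>\<^sub>j u\<close>. So the algebra of operators sees the derivatives of \<open>u\<close> itself.\<close>

lemma pd_op_mult_gen:
  "pd_op q u (x * gen j) = pd_op q u x * gen j + tw q j (pd_op q (pd q j u) x)"
proof (induction u rule: falg_left_induct)
  case one
  then show ?case by (simp add: pd_one)
next
  case (gen a u)
  then show ?case
    by (auto simp: pd_op_mult pd_add pd_mult_gen pd_gen_mult pd_op_add_left pd_tw tw_add
        pd_op_scal_left tw_scal)
qed (auto simp: pd_op_add_left pd_add pd_scal tw_add tw_scal distrib_left distrib_right 
      pd_op_scal_left scal_mult_left pm.scale_right_distrib)

text \<open>Both terms of \<open>pd_op_mult_gen\<close> vanish by induction: the second because
  \<open>\<partial>\<^sub>j C = 0\<close>, the first by the induction hypothesis, starting from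
  \<open>\<pi>(C) 1\<close>, the constant term of \<open>C\<close>.\<close>

lemma pd_op_constant:
  assumes "\<And>i. pd q i C = 0" "eps C = 0"
  shows "pd_op q C x = 0"
proof (induction x rule: falg_right_induct)
  case one
  have "pd_op q u 1 = scal (eps u) 1" for u
    by (induction u rule: falg_left_induct)
      (auto simp: pd_op_mult pd_scal pd_one pd_op_add_left pd_op_scal_left lookup_add
        pm.scale_left_distrib)
  then show ?case using assms(2) by simp
next
  case (gen j x)
  then show ?case by (simp add: pd_op_mult_gen assms(1))
qed (auto simp: pd_op_add_right pd_op_scal_right)

subsection \<open>The bilinear form\<close>

definition pair :: "('n \<Rightarrow> 'n \<Rightarrow> complex) \<Rightarrow> 'n falg \<Rightarrow> 'n falg \<Rightarrow> complex" where
  "pair q u x = eps (pd_op q u x)"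

lemma lin_form_pair_left: "lin_form (\<lambda>u. pair q u x)"
  and lin_form_pair_right: "lin_form (pair q u)"
  by (auto intro!: lin_formI
      simp: pair_def pd_op_add_left pd_op_scal_left pd_op_add_right pd_op_scal_right lookup_add)

lemmas pair_add_left = pmc.linear_add[OF lin_form_pair_left]
  and pair_scal_left = pmc.linear_scale[OF lin_form_pair_left]
  and pair_sum_left = pmc.linear_sum[OF lin_form_pair_left]
  and pair_0_left [simp] = pmc.linear_0[OF lin_form_pair_left]
  and pair_add_right = pmc.linear_add[OF lin_form_pair_right]
  and pair_scal_right = pmc.linear_scale[OF lin_form_pair_right]
  and pair_sum_right = pmc.linear_sum[OF lin_form_pair_right]
  and pair_diff_right = pmc.linear_diff[OF lin_form_pair_right]
  and pair_0_right [simp] = pmc.linear_0[OF lin_form_pair_right]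

lemma pair_one_left [simp]: "pair q 1 x = eps x"
  by (simp add: pair_def)

lemma pair_mult_left: "pair q (u * v) x = pair q u (pd_op q v x)"
  by (simp add: pair_def pd_op_mult)

lemma pair_mult_gen_right: "pair q u (x * gen j) = pair q (pd q j u) x"
  by (simp add: pair_def pd_op_mult_gen lookup_add)

text \<open>On either side, a last letter \<open>\<xi>\<^sub>j\<close> can be traded for \<open>\<partial>\<^sub>j\<close> on the other side.\<close>

lemma pair_commute: "pair q u x = pair q x u"
proof (induction u arbitrary: x rule: falg_right_induct)
  case one
  show ?case
    by (induction x rule: falg_right_induct)
      (auto simp: pair_mult_left pd_one pair_add_left pair_scal_left lookup_add)
next
  case (gen j u)
  then show ?case by (simp add: pair_mult_left pair_mult_gen_right)
qed (auto simp: pair_add_left pair_add_right pair_scal_left pair_scal_right)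

lemma pair_homog:
  assumes "homog m u" "homog n x" "m \<noteq> n"
  shows "pair q u x = 0"
proof -
  have *: "pair q u x = 0" if "homog m u" "homog n x" "m < n" for m n u x
    using homog_pd_op[of m u n x q] that by (auto simp: pair_def homog_lookup)
  show ?thesis
    using *[of m u n x] *[of n x m u] assms pair_commute[of q u x] by (cases "m < n") auto
qed



lemma pair_gen_gen: "pair q (single [i] 1) (gen j) = (if i = j then 1 else 0)"
  using pd_gen_mult[of q i j 1] by (simp add: pair_def pd_one)

lemma pair_word_eq_0:
  assumes "\<And>s. s \<in> keys x \<Longrightarrow> length s \<noteq> length u"
  shows "pair q (single u 1) x = 0"
proof -
  have "pair q (single u 1) x = (\<Sum>s\<in>keys x. lookup x s * pair q (single u 1) (single s 1))"
    by (subst pm_expand[of x]) (simp add: pair_sum_right pair_scal_right)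
  also have "pair q (single u 1) (single s 1) = 0" if "s \<in> keys x" for s
    using assms[OF that] pair_homog[of "length u" "single u 1" "length s" "single s 1" q] by auto
  then have "(\<Sum>s\<in>keys x. lookup x s * pair q (single u 1) (single s 1)) = 0" by simp
  finally show ?thesis .
qed

section \<open>The radical of the form\<close>

definition rad :: "('n \<Rightarrow> 'n \<Rightarrow> complex) \<Rightarrow> 'n falg set" where
  "rad q = {x. \<forall>u. pair q u x = 0}"

lemma rad_words: "x \<in> rad q \<longleftrightarrow> (\<forall>w. pair q (single w 1) x = 0)"
proof -
  have "pair q u x = 0" if "\<forall>w. pair q (single w 1) x = 0" for u
    by (induction u rule: pm_induct) (use that in \<open>auto simp: pair_add_left pair_scal_left\<close>)
  then show ?thesis by (auto simp: rad_def)
qed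

lemma subspace_rad: "pm.subspace (rad q)"
  by (rule pm.subspaceI) (auto simp: rad_def pair_add_right pair_scal_right)

lemmas rad_0 [simp] = pm.subspace_0[OF subspace_rad]
  and rad_add = pm.subspace_add[OF subspace_rad]
  and rad_diff = pm.subspace_diff[OF subspace_rad]
  and rad_scal = pm.subspace_scale[OF subspace_rad]
  and rad_sum = pm.subspace_sum[OF subspace_rad]

lemma pair_rad_right: "x \<in> rad q \<Longrightarrow> pair q u x = 0"
  and pair_rad_left: "x \<in> rad q \<Longrightarrow> pair q x u = 0"
  by (simp_all add: rad_def pair_commute[of q x u])

lemma rad_eps: "x \<in> rad q \<Longrightarrow> eps x = 0"
  using pair_rad_right[of x q 1] by simp

lemma rad_pd_op: "x \<in> rad q \<Longrightarrow> pd_op q a x \<in> rad q"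
  by (simp add: rad_def flip: pair_mult_left)

lemma rad_pd: "x \<in> rad q \<Longrightarrow> pd q i x \<in> rad q"
  using rad_pd_op[of x q "gen i"] by simp

lemma pair_word_hcomp:
  "pair q (single w 1) (hcomp n x) = (if length w = n then pair q (single w 1) x else 0)"
proof (induction x rule: pm_induct)
  case (single v)
  then show ?case
    using pair_homog[of "length w" "single w 1" "length v" "single v 1" q]
    by (auto simp: hcomp_def)
qed (auto simp: pmp.linear_add[OF lin_map_hcomp] pmp.linear_scale[OF lin_map_hcomp]
      pair_add_right pair_scal_right)

lemma rad_hcomp: "x \<in> rad q \<Longrightarrow> hcomp n x \<in> rad q"
  by (simp add: rad_words pair_word_hcomp)

text \<open>The absence of constants in the quotient by the radical.\<close>

lemma rad_if_pd_rad:
  assumes "\<And>i. pd q i x \<in> rad q"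
  shows "x - scal (eps x) 1 \<in> rad q"
  unfolding rad_words
proof
  fix w
  show "pair q (single w 1) (x - scal (eps x) 1) = 0"
  proof (cases w rule: rev_exhaust)
    case Nil
    then show ?thesis by (simp add: single_Nil_one lookup_minus)
  next
    case (snoc v i)
    then show ?thesis
      using pair_rad_right[OF assms[of i]]
      by (simp add: pair_diff_right pair_scal_right pair_mult_left pd_one flip: word_mult_gen)
  qed
qed

text \<open>The form as a linear map from the free algebra to its graded dual, the dual being written in the
  basis of words. The sum is finite because words of different lengths are orthogonal.\<close>

definition gram :: "('n \<Rightarrow> 'n \<Rightarrow> complex) \<Rightarrow> 'n::finite falg \<Rightarrow> 'n falg" where
  "gram q = lin_ext (\<lambda>u. \<Sum>s | length s = length u. single s (pair q (single s 1) (single u 1)))"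

lemma lin_map_gram: "lin_map (gram q)"
  unfolding gram_def by (rule lin_map_lin_ext)

lemma lookup_gram: "lookup (gram q x) s = pair q (single s 1) x"
proof (induction x rule: pm_induct)
  case (single u)
  have "(\<Sum>t | length t = length u. lookup (single t (pair q (single t 1) (single u 1))) s)
      = (\<Sum>t | length t = length u. if t = s then pair q (single s 1) (single u 1) else 0)"
    by (intro sum.cong) (auto simp: lookup_single)
  then show ?case
    using pair_homog[of "length s" "single s 1" "length u" "single u 1" q]
    by (auto simp: gram_def lookup_sum finite_words)
qed (auto simp: gram_def lin_ext_add lin_ext_scal lookup_add pair_add_right pair_scal_right)

lemma gram_eq_0_iff: "gram q x = 0 \<longleftrightarrow> x \<in> rad q"
  by (auto simp: poly_mapping_eq_iff fun_eq_iff lookup_gram rad_words)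

text \<open>The elements \<open>H (single s 1)\<close>, for words \<open>s\<close>, play the part of a dual basis:
  \<open>x \<equiv> \<Sum> \<langle>s, x\<rangle> H (single s 1)\<close> modulo the radical.\<close>

lemma gram_section:
  obtains H where "lin_map H" "\<And>x. x - H (gram q x) \<in> rad q"
proof -
  obtain H where H: "lin_map H" "\<And>y. y \<in> range (gram q) \<Longrightarrow> gram q (H y) = y"
    using pmp.linear_exists_right_inverse_on[OF lin_map_gram[of q] pm.subspace_UNIV] by blast
  have "gram q (x - H (gram q x)) = 0" for x
    by (simp add: pmp.linear_diff[OF lin_map_gram] H(2))
  then show ?thesis using that H(1) gram_eq_0_iff by blast
qed

lemma pair_truncated:
  assumes "lin_form g" "length u \<le> N"
  shows "pair q (single u 1) (\<Sum>s | length s \<le> N. single s (g (single s 1))) = g (gram q (single u 1))"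
proof -
  have "g (gram q (single u 1)) = 
      (\<Sum>s | length s = length u. pair q (single s 1) (single u 1) * g (single s 1))"
    by (simp add: gram_def pmc.linear_sum[OF assms(1)] pmc.linear_scale[OF assms(1), symmetric] scal_single)
  also have "\<dots> = (\<Sum>s | length s \<le> N. pair q (single s 1) (single u 1) * g (single s 1))"
    using assms(2) pair_homog[of _ "single _ 1" "length u" "single u 1" q]
    by (intro sum.mono_neutral_left) (auto simp: finite_words_le)
  also have "\<dots> = pair q (single u 1) (\<Sum>s | length s \<le> N. single s (g (single s 1)))"
  proof -
    have "pair q (single u 1) (single s c) = pair q (single s 1) (single u 1) * c" for s c
      using pair_scal_right[of q "single u 1" c "single s 1"] pair_commute[of q "single u 1" "single s 1"]
      by (simp add: scal_single)
    then show ?thesis by (simp add: pair_sum_right)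
  qed
  finally show ?thesis by simp
qed

text \<open>The quotient by the radical is its own graded dual.\<close>

lemma form_represented:
  fixes f :: "'n::finite falg \<Rightarrow> complex"
  assumes f: "lin_form f" and rad: "\<And>u. u \<in> rad q \<Longrightarrow> f u = 0"
    and bounded: "\<And>w. length w > N \<Longrightarrow> f (single w 1) = 0"
  obtains y where "\<And>u. pair q u y = f u"
proof -
  obtain g where g: "lin_form g" "\<And>x. g (gram q x) = f x"
    using lin_form_factor[OF lin_map_gram f pm.subspace_UNIV] rad gram_eq_0_iff by (metis UNIV_I)
  define y where "y = (\<Sum>s | length s \<le> N. single s (g (single s 1)))"
  have "pair q (single u 1) y = f (single u 1)" for u
  proof (cases "length u \<le> N")
    case True
    then show ?thesis unfolding y_def by (simp add: pair_truncated[OF g(1)] g(2))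
  next
    case False
    have "pair q (single u 1) (single s c) = 0" if "length s \<le> N" for s c
      by (rule pair_homog[of "length u" _ "length s"]) (use that False in \<open>auto intro: homog_singleI\<close>)
    then show ?thesis using False bounded by (simp add: y_def pair_sum_right)
  qed
  then have "pair q u y = f u" for u
    by (rule lin_form_eqI[OF lin_form_pair_left f])
  then show ?thesis using that by blast
qed

subsection \<open>The radical is generated by constants\<close>

lemma foldr_pd_mult_constant:
  assumes "\<And>i. pd q i c = 0"
  shows "foldr (pd q) w (b * c) = foldr (pd q) w b * c"
  by (induction w) (simp_all add: pd_mult_constant[OF assms])

lemma pd_op_homog_eq_0:
  assumes "homog k u" "\<And>w. length w = k \<Longrightarrow> foldr (pd q) w x = 0"
  shows "pd_op q u x = 0"
  using assms(1)
  by (induction rule: homog_induct) (auto simp: assms(2) pd_op_add_left pd_op_scal_left)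

lemma foldr_pd_homog_word: "length w = n \<Longrightarrow> homog n x \<Longrightarrow> foldr (pd q) w x = scal (pair q (single w 1) x) 1"
  using homog_pd_op[of n "single w 1" n x q] homog_zero_const[of "foldr (pd q) w x"]
  by (simp add: pair_def)

lemma pd_op_constant': "is_constant q C \<Longrightarrow> pd_op q C x = 0"
  by (rule pd_op_constant) (auto simp: is_constant_def)

text \<open>By symmetry of the form the radical may be tested with \<open>u\<close> acting.\<close>

lemma kernel_subset_rad: "(\<And>x. pd_op q u x = 0) \<Longrightarrow> u \<in> rad q"
  by (simp add: rad_def pair_commute[of q _ u]) (simp add: pair_def)

lemma poly_order_homog:
  assumes "homog n x" "x \<noteq> 0"
  shows "poly_order x = n"
proof -
  have "length ` keys x = {n}"
    using assms keys_eq_empty[of x] by (fastforce simp: homog_def)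
  then show ?thesis by (simp add: poly_order_def)
qed

text \<open>The inner induction runs over the order \<open>k\<close> beyond which the derivatives of the element vanish.
  The outer induction is over the degree: applied to the left ideal of elements acting by zero, it
  shows that elements of the radical of degree \<open>k < n\<close> act by zero, so that in a sum over words of
  length \<open>k\<close> a word may be replaced by its expansion in the dual basis. The conclusion is stated
  for an arbitrary left ideal containing the constants of order at most \<open>n\<close>, because the bound on
  the order matters for irreducible constants.\<close>

lemma rad_subset_left_ideal:
  fixes q :: "'n::finite \<Rightarrow> 'n \<Rightarrow> complex"
  assumes "x \<in> rad q" "homog n x"
    and "0 \<in> L" "\<And>a b. a \<in> L \<Longrightarrow> b \<in> L \<Longrightarrow> a + b \<in> L" "\<And>a b. b \<in> L \<Longrightarrow> a * b \<in> L"
    and "\<And>C. is_constant q C \<Longrightarrow> poly_order C \<le> n \<Longrightarrow> C \<in> L"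
  shows "x \<in> L"
  using assms
proof (induction n arbitrary: x L rule: less_induct)
  case (less n)
  note L = less.prems(3-6)
  obtain H where H: "lin_map H" "\<And>x. x - H (gram q x) \<in> rad q"
    using gram_section[of q] by blast
  have kernel: "pd_op q u y = 0" if "u \<in> rad q" "homog k u" "k < n" for u k y
  proof -
    have "u \<in> {u. \<forall>y. pd_op q u y = 0}"
      by (rule less.IH[OF that(3,1,2)])
        (auto simp: pd_op_add_left pd_op_mult pd_op_constant')
    then show ?thesis by blast
  qed
  have L_sum: "sum f A \<in> L" if "\<And>i. i \<in> A \<Longrightarrow> f i \<in> L" for f :: "'n list \<Rightarrow> _" and A
    using that by (induction A rule: infinite_finite_induct) (auto intro: L)
  have main: "y \<in> L" if "k \<le> n" "y \<in> rad q" "homog n y" "\<And>w. length w = k \<Longrightarrow> foldr (pd q) w y = 0"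
    for k y
    using that
  proof (induction k arbitrary: y)
    case 0
    then show ?case using L(1) by simp
  next
    case (Suc k)
    \<comment> \<open>The section need not respect degrees, hence the projection.\<close>
    define P where "P s = hcomp k (H (single s 1))" for s
    define c where "c s = pd_op q (P s) y" for s
    have c_const: "pd q i (c s) = 0" for i s
    proof -
      have "pd q i (c s) = pd_op q (gen i * P s) y" by (simp add: c_def pd_op_mult)
      also have "homog (Suc k) (gen i * P s)"
        using homog_mult[OF homog_gen, of k "P s" i] by (simp add: P_def)
      then have "pd_op q (gen i * P s) y = 0"
        by (rule pd_op_homog_eq_0) (rule Suc.prems(4))
      finally show ?thesis .
    qed
    have c_homog: "homog (n - k) (c s)" for s
      unfolding c_def using Suc.prems by (intro homog_pd_op) (auto simp: P_def)
    then have c_eps: "eps (c s) = 0" for s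
      using Suc.prems(1) by (auto simp: homog_lookup)
    have c_L: "c s \<in> L" for s
    proof (cases "c s = 0")
      case False
      then show ?thesis
        using c_const c_eps poly_order_homog[OF c_homog[of s]] by (intro L(4)) (auto simp: is_constant_def)
    qed (use L(1) in simp)
    define z where "z = (\<Sum>s | length s = k. single s 1 * c s)"
    have "y - z \<in> L"
    proof (rule Suc.IH)
      show "k \<le> n" using Suc.prems(1) by simp
      have "single s 1 * c s \<in> rad q" for s
        by (rule kernel_subset_rad) (simp add: pd_op_mult pd_op_constant[OF c_const c_eps])
      then show "y - z \<in> rad q"
        using Suc.prems(2) by (auto simp: z_def intro: rad_diff rad_sum)
      have "homog n (single s 1 * c s)" if "length s = k" for s
        using homog_mult[OF _ c_homog, of k "single s 1" s] that Suc.prems(1) by simp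
      then have "homog n z" unfolding z_def by (intro homog_sum) auto
      then show "homog n (y - z)"
        using Suc.prems(3) by (auto simp: homog_lookup lookup_minus)
      fix w :: "'n list" assume w: "length w = k"
      let ?p = "\<lambda>s. pair q (single s 1) (single w 1)"
      have "foldr (pd q) w (single s 1 * c s) = scal (?p s) (c s)" if "length s = k" for s
        using that w pair_commute[of q "single s 1" "single w 1"]
        by (simp add: foldr_pd_mult_constant[OF c_const] foldr_pd_homog_word[of w k] scal_mult_left)
      moreover have "foldr (pd q) w z = (\<Sum>s | length s = k. foldr (pd q) w (single s 1 * c s))"
        unfolding z_def using pd_op_sum_right[of q "single w 1"] by simp
      ultimately have "foldr (pd q) w z = (\<Sum>s | length s = k. scal (?p s) (c s))"
        by simp
      also have "\<dots> = pd_op q (\<Sum>s | length s = k. scal (?p s) (P s)) y"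
        by (simp add: c_def pd_op_sum_left pd_op_scal_left)
      also have "(\<Sum>s | length s = k. scal (?p s) (P s)) = hcomp k (H (gram q (single w 1)))"
      proof -
        have "gram q (single w 1) = (\<Sum>s | length s = k. scal (?p s) (single s 1))"
          by (simp add: gram_def w scal_single)
        then show ?thesis
          by (simp add: P_def pmp.linear_sum[OF H(1)] pmp.linear_scale[OF H(1)]
              pmp.linear_sum[OF lin_map_hcomp] pmp.linear_scale[OF lin_map_hcomp])
      qed
      also have "pd_op q (hcomp k (H (gram q (single w 1)))) y = pd_op q (single w 1) y"
      proof -
        have "hcomp k (single w 1 - H (gram q (single w 1))) \<in> rad q"
          by (rule rad_hcomp) (rule H(2))
        then have "pd_op q (hcomp k (single w 1 - H (gram q (single w 1)))) y = 0"
          using Suc.prems(1) by (intro kernel[of _ k]) auto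
        then show ?thesis
          using w homog_singleI[of w k 1]
          by (simp add: pmp.linear_diff[OF lin_map_hcomp] pd_op_diff_left hcomp_homog)
      qed
      finally show "foldr (pd q) w (y - z) = 0"
        using pd_op_diff_right[of q "single w 1" y z] by simp
    qed
    moreover have "z \<in> L" unfolding z_def by (intro L_sum L(3) c_L)
    ultimately have "(y - z) + z \<in> L" by (rule L(2))
    then show ?case by simp
  qed
  show ?case
    by (rule main[of n]) (use less.prems in \<open>auto simp: foldr_pd_homog_word pair_rad_right\<close>)
qed

lemma ring_type_algebra: "ring (ring_of_type_algebra :: 'a::ring_1 ring)"
proof -
  have "\<exists>y. x + y = 0" for x :: 'a by (rule exI[of _ "- x"]) simp
  moreover have "\<exists>y. y + x = 0" for x :: 'a by (rule exI[of _ "- x"]) simp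
  ultimately show ?thesis
    unfolding ring_of_type_algebra_def
    by unfold_locales (auto simp: algebra_simps Units_def)
qed

lemma ideal_type_algebraI:
  fixes I :: "'a::ring_1 set"
  assumes "0 \<in> I" "\<And>a b. a \<in> I \<Longrightarrow> b \<in> I \<Longrightarrow> a + b \<in> I"
    "\<And>a b. b \<in> I \<Longrightarrow> a * b \<in> I" "\<And>a b. b \<in> I \<Longrightarrow> b * a \<in> I"
  shows "ideal I ring_of_type_algebra"
proof (rule idealI[OF ring_type_algebra])
  interpret R: ring "ring_of_type_algebra :: 'a ring" by (rule ring_type_algebra)
  have minus: "- a \<in> I" if "a \<in> I" for a using assms(3)[OF that, of "- 1"] by simp
  have inv: "a_inv ring_of_type_algebra a = - a" for a :: 'a
    by (rule R.minus_equality) (auto simp: ring_of_type_algebra_def)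
  show "subgroup I (add_monoid ring_of_type_algebra)"
    using assms(1,2) minus
    by (intro R.add.subgroupI) (auto simp: inv simp flip: a_inv_def, auto simp: ring_of_type_algebra_def)
qed (use assms in \<open>auto simp: ring_of_type_algebra_def\<close>)

lemma ideal_type_algebraD:
  fixes I :: "'a::ring_1 set"
  assumes "ideal I ring_of_type_algebra"
  shows "0 \<in> I" "\<And>a b. a \<in> I \<Longrightarrow> b \<in> I \<Longrightarrow> a + b \<in> I"
    "\<And>a b. b \<in> I \<Longrightarrow> a * b \<in> I" "\<And>a b. b \<in> I \<Longrightarrow> b * a \<in> I"
proof -
  interpret ideal I ring_of_type_algebra by fact
  show "0 \<in> I" using additive_subgroup.zero_closed[OF is_additive_subgroup] by (simp add: ring_of_type_algebra_def)
  show "a + b \<in> I" if "a \<in> I" "b \<in> I" for a b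
    using additive_subgroup.a_closed[OF is_additive_subgroup that] by (simp add: ring_of_type_algebra_def)
  show "a * b \<in> I" "b * a \<in> I" if "b \<in> I" for a b
    using I_l_closed[OF that] I_r_closed[OF that] by (auto simp: ring_of_type_algebra_def)
qed

lemma ideal_genideal: "ideal (genideal ring_of_type_algebra S) (ring_of_type_algebra :: 'a::ring_1 ring)"
  by (rule ring.genideal_ideal[OF ring_type_algebra]) (simp add: ring_of_type_algebra_def)

lemma genideal_superset: "S \<subseteq> genideal (ring_of_type_algebra :: 'a::ring_1 ring) S"
  by (rule ring.genideal_self[OF ring_type_algebra]) (simp add: ring_of_type_algebra_def)

lemma const_ideal_subset_kernel: "x \<in> const_ideal q \<Longrightarrow> pd_op q x y = 0"
proof -
  have "ideal {u. \<forall>y. pd_op q u y = 0} ring_of_type_algebra"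
    by (rule ideal_type_algebraI) (auto simp: pd_op_add_left pd_op_mult)
  then have "const_ideal q \<subseteq> {u. \<forall>y. pd_op q u y = 0}"
    unfolding const_ideal_def
    by (rule ring.genideal_minimal[OF ring_type_algebra]) (auto simp: pd_op_constant')
  then show "x \<in> const_ideal q \<Longrightarrow> pd_op q x y = 0" by blast
qed

text \<open>The chain of inclusions is: ideal of constants, kernel of the action, radical, left ideal
  generated by constants.\<close>

theorem const_ideal_eq_rad:
  fixes q :: "'n::finite \<Rightarrow> 'n \<Rightarrow> complex"
  shows "const_ideal q = rad q"
proof
  show "const_ideal q \<subseteq> rad q"
    using const_ideal_subset_kernel kernel_subset_rad by blast
  show "rad q \<subseteq> const_ideal q"
  proof
    fix x assume x: "x \<in> rad q"
    note I = ideal_type_algebraD[OF ideal_genideal[of "{C. is_constant q C}"], folded const_ideal_def]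
    have "hcomp n x \<in> const_ideal q" for n
      by (rule rad_subset_left_ideal[OF rad_hcomp[OF x] homog_hcomp])
        (use I genideal_superset[of "{C. is_constant q C}"] in \<open>auto simp: const_ideal_def\<close>)
    then have "(\<Sum>n\<in>A. hcomp n x) \<in> const_ideal q" for A
      by (induction A rule: infinite_finite_induct) (auto intro: I)
    moreover have "x = (\<Sum>n\<le>Max (length ` keys x). hcomp n x)"
      by (rule sum_hcomp) auto
    ultimately show "x \<in> const_ideal q" by metis
  qed
qed

lemma pd_op_rad_left: "a \<in> rad q \<Longrightarrow> pd_op (q :: 'n::finite \<Rightarrow> 'n \<Rightarrow> complex) a x = 0"
  using const_ideal_subset_kernel[of a q x] by (simp add: const_ideal_eq_rad)



section \<open>The quotient algebra\<close>

lemma ideal_const_ideal: "ideal (const_ideal q) ring_of_type_algebra"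
  unfolding const_ideal_def by (rule ideal_genideal)

lemma ring_quot: "ring (quot q)"
  unfolding quot_def by (rule ideal.quotient_is_ring[OF ideal_const_ideal])

context
  fixes q :: "'n::finite \<Rightarrow> 'n \<Rightarrow> complex"
begin

interpretation I: ideal "const_ideal q" "ring_of_type_algebra :: 'n falg ring"
  by (rule ideal_const_ideal)

interpretation Q: ring "quot q"
  by (rule ring_quot)

lemma mem_cls_iff: "y \<in> cls q x \<longleftrightarrow> y - x \<in> rad q"
proof -
  have "(\<exists>h\<in>rad q. y = h + x) \<longleftrightarrow> y - x \<in> rad q"
    by (metis add_diff_cancel diff_add_cancel)
  then show ?thesis
    by (auto simp: cls_def a_r_coset_def r_coset_def const_ideal_eq_rad ring_of_type_algebra_def)
qed

lemma cls_eq_iff: "cls q x = cls q y \<longleftrightarrow> x - y \<in> rad q"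
proof
  assume "cls q x = cls q y"
  then show "x - y \<in> rad q" using mem_cls_iff[of x x] mem_cls_iff[of x y] by simp
next
  assume "x - y \<in> rad q"
  then have "z - x \<in> rad q \<longleftrightarrow> z - y \<in> rad q" for z
    using rad_add[of "z - x" q "x - y"] rad_diff[of "z - y" q "x - y"] by auto
  then show "cls q x = cls q y" by (auto simp: mem_cls_iff)
qed

lemma carrier_quot: "carrier (quot q) = range (cls q)"
  by (auto simp: quot_def FactRing_def A_RCOSETS_defs cls_def a_r_coset_def ring_of_type_algebra_def)

lemma cls_in_carrier [simp]: "cls q x \<in> carrier (quot q)"
  by (simp add: carrier_quot)

lemma add_cls: "cls q x \<oplus>\<^bsub>quot q\<^esub> cls q y = cls q (x + y)"
  using I.a_rcos_sum[of x y] by (simp add: quot_def FactRing_def cls_def ring_of_type_algebra_def)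

lemma mult_cls: "cls q x \<otimes>\<^bsub>quot q\<^esub> cls q y = cls q (x * y)"
  using I.rcoset_mult_add[of x y] by (simp add: quot_def FactRing_def cls_def ring_of_type_algebra_def)

lemma zero_quot: "\<zero>\<^bsub>quot q\<^esub> = cls q 0"
  by (auto simp: mem_cls_iff const_ideal_eq_rad quot_def FactRing_def)

lemma one_quot: "\<one>\<^bsub>quot q\<^esub> = cls q 1"
  by (simp add: quot_def FactRing_def cls_def ring_of_type_algebra_def)

lemma cls_eq_zero_iff: "cls q x = \<zero>\<^bsub>quot q\<^esub> \<longleftrightarrow> x \<in> rad q"
  by (simp add: zero_quot cls_eq_iff)

lemma qscal_cls: "qscal q c (cls q x) = cls q (scal c x)"
  by (simp add: qscal_def mult_cls scal_conv_mult)

lemma finsum_cls: "(\<Oplus>\<^bsub>quot q\<^esub> k\<in>A. cls q (F k)) = cls q (sum F A)"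
proof (induction A rule: infinite_finite_induct)
  case (infinite A)
  then show ?case by (simp add: Q.finsum_infinite zero_quot)
next
  case empty
  then show ?case by (simp add: zero_quot)
next
  case (insert k A)
  then show ?case by (subst Q.finsum_insert) (auto simp: add_cls)
qed

lemma qlin_ext_cls:
  assumes "\<And>k. k \<in> keys x \<Longrightarrow> f k = cls q (F k)"
  shows "qlin_ext q f x = cls q (\<Sum>k\<in>keys x. scal (lookup x k) (F k))"
proof -
  have "qlin_ext q f x = (\<Oplus>\<^bsub>quot q\<^esub> k\<in>keys x. cls q (scal (lookup x k) (F k)))"
    unfolding qlin_ext_def using assms by (intro Q.finsum_cong') (auto simp: qscal_cls)
  then show ?thesis by (simp add: finsum_cls)
qed

lemma cls_UN:
  assumes "\<And>y. y - x \<in> rad q \<Longrightarrow> f y = f x"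
  shows "(\<Union>y\<in>cls q x. f y) = f x"
proof -
  have "(\<Union>y\<in>cls q x. f y) = (\<Union>y\<in>cls q x. f x)"
    by (intro SUP_cong refl assms) (simp add: mem_cls_iff)
  moreover have "x \<in> cls q x" by (simp add: mem_cls_iff)
  ultimately show ?thesis by auto
qed

lemma qpd_cls: "qpd q i (cls q x) = cls q (pd q i x)"
  unfolding qpd_def
  using rad_pd[of _ q i] by (intro cls_UN) (simp add: cls_eq_iff pmp.linear_diff[OF lin_map_pd, symmetric])

lemma foldr_qpd_cls: "foldr (qpd q) w (cls q x) = cls q (foldr (pd q) w x)"
  by (induction w) (simp_all add: qpd_cls)

lemma qpd_op_cls: "qpd_op q a (cls q x) = cls q (pd_op q a x)"
  unfolding qpd_op_def pd_op_def lin_ext_def by (rule qlin_ext_cls) (rule foldr_qpd_cls)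

lemma act_cls: "act q (cls q a) (cls q x) = cls q (pd_op q a x)"
  unfolding act_def qpd_op_cls
  by (rule cls_UN) (metis eq_iff_diff_eq_0 pd_op_diff_left pd_op_rad_left)

definition rep :: "'n qalg \<Rightarrow> 'n falg" where
  "rep b = (SOME x. cls q x = b)"

lemma cls_rep: "b \<in> carrier (quot q) \<Longrightarrow> cls q (rep b) = b"
  unfolding rep_def by (rule someI_ex) (auto simp: carrier_quot)

lemma rep_cls: "rep (cls q x) - x \<in> rad q"
  using cls_rep[of "cls q x"] by (simp add: cls_eq_iff)

lemma quot_plus_subset: "quot_plus q \<subseteq> carrier (quot q)"
  by (auto simp: quot_plus_def)

lemma cls_in_quot_plus_iff: "cls q x \<in> quot_plus q \<longleftrightarrow> eps x = 0"
proof
  assume "cls q x \<in> quot_plus q"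
  then obtain y where "eps y = 0" "x - y \<in> rad q"
    by (auto simp: quot_plus_def cls_eq_iff)
  then show "eps x = 0" using rad_eps[of "x - y" q] by (simp add: lookup_minus)
qed (auto simp: quot_plus_def)

lemma eps_rep: "b \<in> quot_plus q \<Longrightarrow> eps (rep b) = 0"
  using cls_in_quot_plus_iff cls_rep quot_plus_subset by (metis subsetD)

lemma quot_one_eq: "quot_one q = cls q ` {x. homog 1 x}"
  by (simp add: quot_one_def homog_def)

lemma quot_one_subset: "quot_one q \<subseteq> quot_plus q"
  by (auto simp: quot_one_eq cls_in_quot_plus_iff homog_lookup)

lemma homog_one_expand: "homog (Suc 0) x \<Longrightarrow> x = (\<Sum>i\<in>UNIV. scal (lookup x [i]) (gen i :: 'n falg))"
proof (induction rule: homog_induct)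
  case (single w)
  then obtain j where w: "w = [j]" by (auto simp: length_Suc_conv)
  have "(\<Sum>i\<in>UNIV. scal (lookup (single w 1) [i]) (gen i)) = (\<Sum>i\<in>UNIV. if i = j then gen j else 0)"
    by (intro sum.cong) (auto simp: w lookup_single when_def)
  then show ?case by (simp add: w gen_def)
next
  case (add x y)
  then show ?case by (simp add: lookup_add pm.scale_left_distrib sum.distrib)
next
  case (scal c x)
  then show ?case by (simp add: pm.scale_sum_right[symmetric] flip: pm.scale_scale)
qed simp

subsection \<open>Coordinates of the quotient\<close>

text \<open>The pairing with a word descends to cosets; these functionals separate points and serve as
  coordinates.\<close>

definition qpair :: "'n list \<Rightarrow> 'n qalg \<Rightarrow> complex" where
  "qpair s b = pair q (single s 1) (rep b)"

lemma qpair_cls [simp]: "qpair s (cls q x) = pair q (single s 1) x"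
  using pair_rad_right[OF rep_cls, of "single s 1" x] by (simp add: qpair_def pair_diff_right)

lemma qpair_add: "b \<in> carrier (quot q) \<Longrightarrow> c \<in> carrier (quot q) \<Longrightarrow> 
    qpair s (b \<oplus>\<^bsub>quot q\<^esub> c) = qpair s b + qpair s c"
  and qpair_qscal: "b \<in> carrier (quot q) \<Longrightarrow> qpair s (qscal q d b) = d * qpair s b"
  by (auto simp: carrier_quot add_cls qscal_cls pair_add_right pair_scal_right)

lemma qpair_quot_one_eq_0: "b \<in> quot_one q \<Longrightarrow> length s \<noteq> 1 \<Longrightarrow> qpair s b = 0"
  using pair_homog[of "length s" "single s 1" 1] by (auto simp: quot_one_eq)

lemma qpair_mult_quot_one_eq_0:
  assumes "b \<in> quot_one q" "c \<in> quot_one q" "length s \<noteq> 2"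
  shows "qpair s (b \<otimes>\<^bsub>quot q\<^esub> c) = 0"
proof -
  obtain x y where xy: "b = cls q x" "c = cls q y" "homog 1 x" "homog 1 y"
    using assms(1,2) by (auto simp: quot_one_eq)
  have "pair q (single s 1) (x * y) = 0"
    using pair_homog[OF _ homog_mult[OF xy(3,4)], of "length s" "single s 1" q] assms(3)
    by (simp add: homog_singleI)
  then show ?thesis by (simp add: xy mult_cls)
qed

lemma quot_one_expand:
  assumes "b \<in> quot_one q"
  shows "b = cls q (\<Sum>i\<in>UNIV. scal (qpair [i] b) (gen i))"
proof -
  obtain x where x: "b = cls q x" "homog (Suc 0) x" using assms by (auto simp: quot_one_eq)
  have "qpair [j] b = lookup x [j]" for j
  proof -
    have "qpair [j] b = (\<Sum>i\<in>UNIV. if j = i then lookup x [i] else 0)"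
      by (simp add: x(1), subst homog_one_expand[OF x(2)])
         (auto simp: pair_sum_right pair_scal_right pair_gen_gen if_distrib cong: if_cong)
    then show ?thesis by simp
  qed
  then show ?thesis using x homog_one_expand[OF x(2)] by simp
qed

text \<open>A dual basis without constant terms, so that it lies in the augmentation ideal over which chains
  are formed.\<close>

lemma quot_plus_section:
  obtains h where "\<And>s. eps (h s) = 0"
    "\<And>S x. finite S \<Longrightarrow> keys (gram q x) \<subseteq> S \<Longrightarrow> eps x = 0 \<Longrightarrow>
       x - (\<Sum>s\<in>S. scal (pair q (single s 1) x) (h s)) \<in> rad q"
proof -
  obtain H where H: "lin_map H" "\<And>x. x - H (gram q x) \<in> rad q"
    using gram_section[of q] by blast
  define h where "h s = H (single s 1) - scal (eps (H (single s 1))) 1" for s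
  show ?thesis
  proof (rule that)
    show "eps (h s) = 0" for s by (simp add: h_def lookup_minus)
    fix S and x :: "'n falg"
    assume S: "finite S" "keys (gram q x) \<subseteq> S" and "eps x = 0"
    have "gram q x = (\<Sum>s\<in>keys (gram q x). scal (lookup (gram q x) s) (single s 1))"
      by (rule pm_expand)
    also have "\<dots> = (\<Sum>s\<in>S. scal (pair q (single s 1) x) (single s 1))"
      using S by (intro sum.mono_neutral_cong_left) (auto simp: in_keys_iff lookup_gram)
    finally have H_gram: "H (gram q x) = (\<Sum>s\<in>S. scal (pair q (single s 1) x) (H (single s 1)))"
      by (simp add: pmp.linear_sum[OF H(1)] pmp.linear_scale[OF H(1)])
    have "eps (H (gram q x)) = 0"
      using rad_eps[OF H(2), of x] \<open>eps x = 0\<close> by (simp add: lookup_minus)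
    then have "(\<Sum>s\<in>S. scal (pair q (single s 1) x) (h s)) = H (gram q x)"
      by (simp add: h_def H_gram pm.scale_right_diff_distrib sum_subtractf lookup_sum
          flip: pm.scale_sum_left)
    then show "x - (\<Sum>s\<in>S. scal (pair q (single s 1) x) (h s)) \<in> rad q"
      using H(2) by simp
  qed
qed

end



section \<open>Exactness in coordinates\<close>

text \<open>Coefficients \<open>t\<close> of a closed chain in the \<open>p\<close>-th tensor power of the degree one part: the
  multiplications of two adjacent factors change different slots to degree 2, so a chain is closed
  exactly when each of them annihilates it.\<close>

definition closed_coords :: "('n \<Rightarrow> 'n \<Rightarrow> complex) \<Rightarrow> nat \<Rightarrow> ('n::finite list \<Rightarrow> complex) \<Rightarrow> bool" where
  "closed_coords q p t \<longleftrightarrow> (\<forall>u v. length u + length v + 2 = p \<longrightarrow>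
     (\<Sum>i\<in>UNIV. \<Sum>j\<in>UNIV. scal (t (u @ [i, j] @ v)) (gen i * gen j)) \<in> rad q)"

text \<open>Coefficients of a closed chain with an additional leading factor: \<open>e w\<close> stands in front of
  the word \<open>w\<close>. The first condition collects the terms of the boundary that leave the leading
  factor alone, the second one the term that multiplies it with the next factor.\<close>

definition ext_closed_coords :: "('n \<Rightarrow> 'n \<Rightarrow> complex) \<Rightarrow> nat \<Rightarrow> ('n::finite list \<Rightarrow> 'n falg) \<Rightarrow> bool" where
  "ext_closed_coords q p e \<longleftrightarrow> (\<forall>s. closed_coords q p (\<lambda>w. pair q (single s 1) (e w))) \<and>
     (\<forall>v. length v + 1 = p \<longrightarrow> (\<Sum>i\<in>UNIV. e (i # v) * gen i) \<in> rad q)"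

lemma closed_coords_cong:
  assumes "closed_coords q p t" "\<And>w. length w = p \<Longrightarrow> t w = t' w"
  shows "closed_coords q p t'"
proof -
  have "t (u @ [i, j] @ v) = t' (u @ [i, j] @ v)" if "length u + length v + 2 = p" for u v i j
    using that by (intro assms(2)) simp
  then show ?thesis using assms(1) by (simp add: closed_coords_def)
qed

lemma closed_coords_scale:
  assumes "closed_coords q p t"
  shows "closed_coords q p (\<lambda>w. c * t w)"
  unfolding closed_coords_def
proof (intro allI impI)
  fix u v :: "'a list" assume "length u + length v + 2 = p"
  then have "scal c (\<Sum>i\<in>UNIV. \<Sum>j\<in>UNIV. scal (t (u @ [i, j] @ v)) (gen i * gen j)) \<in> rad q"
    using assms by (intro rad_scal) (auto simp: closed_coords_def)
  then show "(\<Sum>i\<in>UNIV. \<Sum>j\<in>UNIV. scal (c * t (u @ [i, j] @ v)) (gen i * gen j)) \<in> rad q"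
    by (simp add: pm.scale_sum_right)
qed

lemma closed_coords_add:
  assumes "closed_coords q p t" "closed_coords q p t'"
  shows "closed_coords q p (\<lambda>w. t w + t' w)"
  unfolding closed_coords_def
proof (intro allI impI)
  fix u v :: "'a list" assume "length u + length v + 2 = p"
  then have "(\<Sum>i\<in>UNIV. \<Sum>j\<in>UNIV. scal (t (u @ [i, j] @ v)) (gen i * gen j)) +
      (\<Sum>i\<in>UNIV. \<Sum>j\<in>UNIV. scal (t' (u @ [i, j] @ v)) (gen i * gen j)) \<in> rad q"
    using assms by (intro rad_add) (auto simp: closed_coords_def)
  then show "(\<Sum>i\<in>UNIV. \<Sum>j\<in>UNIV. scal (t (u @ [i, j] @ v) + t' (u @ [i, j] @ v)) (gen i * gen j)) \<in> rad q"
    by (simp add: pm.scale_left_distrib sum.distrib)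
qed

text \<open>Expanding \<open>e w\<close> in a dual basis turns \<open>e\<close> into a combination of closed chains with fixed
  leading factors, to which exactness applies. What remains is \<open>\<pi>\<close> of a product of the leading
  factor with the first generator, and the second closedness condition annihilates it.\<close>

lemma exact_imp_strongly_closed_coords:
  fixes q :: "'n::finite \<Rightarrow> 'n \<Rightarrow> complex"
  assumes exact: "\<And>t. closed_coords q (Suc r) t \<Longrightarrow>
      (\<Sum>w | length w = Suc r. scal (t w) (z w - pd q (hd w) (y (tl w)))) \<in> rad q"
    and e: "ext_closed_coords q (Suc r) e"
  shows "(\<Sum>w | length w = Suc r. pd_op q (e w) (z w)) \<in> rad q"
proof -
  obtain H where H: "lin_map H" "\<And>x. x - H (gram q x) \<in> rad q"
    using gram_section[of q] by blast
  define S where "S = (\<Union>w\<in>{w. length w = Suc r}. keys (gram q (e w)))"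
  define h where "h s = H (single s 1)" for s
  define d where "d w = z w - pd q (hd w) (y (tl w))" for w
  have "finite S" by (auto simp: S_def finite_words)
  have pd_op_e: "pd_op q (e w) x = (\<Sum>s\<in>S. scal (pair q (single s 1) (e w)) (pd_op q (h s) x))"
    if "length w = Suc r" for w x
  proof -
    have "gram q (e w) = (\<Sum>s\<in>keys (gram q (e w)). scal (lookup (gram q (e w)) s) (single s 1))"
      by (rule pm_expand)
    also have "\<dots> = (\<Sum>s\<in>S. scal (pair q (single s 1) (e w)) (single s 1))"
      using \<open>finite S\<close> that
      by (intro sum.mono_neutral_cong_left) (auto simp: in_keys_iff lookup_gram S_def)
    finally have "H (gram q (e w)) = (\<Sum>s\<in>S. scal (pair q (single s 1) (e w)) (h s))"
      by (simp add: pmp.linear_sum[OF H(1)] pmp.linear_scale[OF H(1)] h_def)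
    moreover have "pd_op q (e w) x = pd_op q (H (gram q (e w))) x"
      using pd_op_rad_left[OF H(2), of "e w" x] by (simp add: pd_op_diff_left)
    ultimately show ?thesis by (simp add: pd_op_sum_left pd_op_scal_left)
  qed
  have "(\<Sum>w | length w = Suc r. pd_op q (e w) (d w)) =
      (\<Sum>s\<in>S. \<Sum>w | length w = Suc r. scal (pair q (single s 1) (e w)) (pd_op q (h s) (d w)))"
    by (simp add: pd_op_e sum.swap[of _ S])
  also have "\<dots> = (\<Sum>s\<in>S. pd_op q (h s) (\<Sum>w | length w = Suc r. scal (pair q (single s 1) (e w)) (d w)))"
    by (simp add: pd_op_sum_right pd_op_scal_right)
  also have "\<dots> \<in> rad q"
    unfolding d_def using e by (intro rad_sum rad_pd_op exact) (auto simp: ext_closed_coords_def)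
  finally have 1: "(\<Sum>w | length w = Suc r. pd_op q (e w) (d w)) \<in> rad q" .
  have "(\<Sum>w | length w = Suc r. pd_op q (e w) (pd q (hd w) (y (tl w)))) =
      (\<Sum>i\<in>UNIV. \<Sum>v | length v = r. pd_op q (e (i # v) * gen i) (y v))"
    by (simp add: sum_words_Suc pd_op_mult)
  also have "\<dots> = (\<Sum>v | length v = r. pd_op q (\<Sum>i\<in>UNIV. e (i # v) * gen i) (y v))"
    by (subst sum.swap) (simp add: pd_op_sum_left)
  also have "\<dots> = 0"
    using e by (intro sum.neutral) (auto simp: ext_closed_coords_def intro!: pd_op_rad_left)
  finally have 2: "(\<Sum>w | length w = Suc r. pd_op q (e w) (pd q (hd w) (y (tl w)))) = 0" .
  have "(\<Sum>w | length w = Suc r. pd_op q (e w) (z w)) =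
      (\<Sum>w | length w = Suc r. pd_op q (e w) (d w)) +
      (\<Sum>w | length w = Suc r. pd_op q (e w) (pd q (hd w) (y (tl w))))"
    by (simp add: d_def pd_op_diff_right sum_subtractf)
  with 1 2 show ?thesis by simp
qed

text \<open>The pair \<open>(u, v)\<close> represents the tensor \<open>u \<otimes> v\<close>, so this is the coefficient in front of the
  word \<open>w\<close> in the second factor.\<close>

definition slot :: "'n list \<Rightarrow> ('n list \<times> 'n list \<Rightarrow>\<^sub>0 complex) \<Rightarrow> 'n falg" where
  "slot w = lin_ext (\<lambda>(u, v). if v = w then single u 1 else 0)"

lemma lin_map_slot: "lin_map (slot w)"
  unfolding slot_def by (rule lin_map_lin_ext)

text \<open>The map \<open>T\<close> sends \<open>u \<otimes> i v\<close> to \<open>u \<xi>\<^sub>i \<otimes> v\<close>, followed by the Gram map on the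
  first factor, so that it kills a tensor exactly when the product vanishes in the quotient. On the subspace
  \<open>V\<close> of tensors that are closed in the second factor, the functional \<open>f\<close> given by the constant
  term of \<open>\<pi>(u) z(w)\<close> vanishes on the kernel of \<open>T\<close>; this is where strong closedness enters.
  A functional \<open>g\<close> with \<open>g \<circ> T = f\<close> on \<open>V\<close> has the values \<open>g(s \<otimes> v)\<close>, which are the
  coefficients of \<open>y(v)\<close>.\<close>

lemma strongly_closed_imp_exact_coords:
  fixes q :: "'n::finite \<Rightarrow> 'n \<Rightarrow> complex"
  assumes sc: "\<And>e. ext_closed_coords q (Suc r) e \<Longrightarrow> (\<And>w. length w = Suc r \<Longrightarrow> eps (e w) = 0) \<Longrightarrow>
      (\<Sum>w | length w = Suc r. pd_op q (e w) (z w)) \<in> rad q"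
  obtains y where "\<And>t. closed_coords q (Suc r) t \<Longrightarrow>
      (\<Sum>w | length w = Suc r. scal (t w) (z w - pd q (hd w) (y (tl w)))) \<in> rad q"
proof -
  define T where "T = lin_ext (\<lambda>(u :: 'n list, w :: 'n list).
      if length w = Suc r
      then lin_ext (\<lambda>s. single (s, tl w) 1) (gram q (single (u @ [hd w]) 1)) else 0)"
  define f where "f x = (\<Sum>w | length w = Suc r. pair q (slot w x) (z w))" for x
  define V where "V = {x. \<forall>s. closed_coords q (Suc r) (\<lambda>w. pair q (single s 1) (slot w x))}"
  have T: "lin_map T" unfolding T_def by (rule lin_map_lin_ext)
  have f: "lin_form f"
    by (rule lin_formI)
      (simp_all add: f_def pmp.linear_add[OF lin_map_slot] pmp.linear_scale[OF lin_map_slot]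
        pair_add_left pair_scal_left sum.distrib sum_distrib_left)
  have V: "pm.subspace V"
    by (rule pm.subspaceI)
      (auto simp: V_def pmp.linear_add[OF lin_map_slot] pmp.linear_scale[OF lin_map_slot]
        pmp.linear_0[OF lin_map_slot] pair_add_right pair_scal_right
        intro: closed_coords_add closed_coords_scale, simp add: closed_coords_def)
  have lookup_T: "lookup (T x) (s, v) = pair q (single s 1) (\<Sum>i\<in>UNIV. slot (i # v) x * gen i)"
    if "length v = r" for x s v
  proof (induction x rule: pm_induct)
    case (single k)
    obtain u w where k: "k = (u, w)" by (cases k)
    have emb: "lookup (lin_ext (\<lambda>s. single (s, v') 1) x) (s, v) = (if v' = v then lookup x s else 0)"
      for v' and x :: "'n falg"
      by (induction x rule: pm_induct)
        (auto simp: lin_ext_add lin_ext_scal lookup_add lookup_single when_def)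
    show ?case
    proof (cases "length w = Suc r \<and> tl w = v")
      case True
      then obtain j where w: "w = j # v" by (cases w) auto
      have "(\<Sum>i\<in>UNIV. slot (i # v) (single k 1) * gen i) =
          (\<Sum>i\<in>UNIV. if i = j then single u 1 * gen j else 0)"
        by (intro sum.cong) (auto simp: slot_def k w)
      then show ?thesis
        using True by (simp add: T_def k w emb lookup_gram word_mult_gen)
    next
      case False
      then have "w \<noteq> i # v" for i using that by auto
      then show ?thesis
        using False by (auto simp: T_def k emb slot_def)
    qed
  next
    case (add x y)
    then show ?case
      by (simp add: pmp.linear_add[OF T] pmp.linear_add[OF lin_map_slot] lookup_add distrib_right
          sum.distrib pair_add_right)
  next
    case (scal c x)
    then show ?case
      by (simp add: pmp.linear_scale[OF T] pmp.linear_scale[OF lin_map_slot] scal_mult_left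
          pair_scal_right flip: pm.scale_sum_right)
  qed
  have ker: "f x = 0" if "x \<in> V" "T x = 0" for x
  proof -
    have rad: "(\<Sum>i\<in>UNIV. slot (i # v) x * gen i) \<in> rad q" if "length v = r" for v
      unfolding rad_words using lookup_T[OF that, of x] \<open>T x = 0\<close> by simp
    \<comment> \<open>The degree one part of the preceding relation, as the radical contains nothing of degree one.\<close>
    have "eps (slot w x) = 0" if w: "length w = Suc r" for w
    proof -
      obtain j v where jv: "w = j # v" "length v = r" using w by (auto simp: length_Suc_conv)
      have "0 = pair q (\<Sum>i\<in>UNIV. slot (i # v) x * gen i) (gen j)"
        using pair_rad_left[OF rad[OF jv(2)]] by simp
      also have "\<dots> = (\<Sum>i\<in>UNIV. pair q (slot (i # v) x) (if i = j then 1 else 0))"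
        using pd_gen_mult[of q _ j 1] by (simp add: pair_sum_left pair_mult_left pd_one)
      also have "\<dots> = (\<Sum>i\<in>UNIV. if i = j then eps (slot w x) else 0)"
        by (intro sum.cong) (auto simp: jv pair_commute[of q _ 1])
      finally show ?thesis by simp
    qed
    moreover have "ext_closed_coords q (Suc r) (\<lambda>w. slot w x)"
      using \<open>x \<in> V\<close> rad by (auto simp: ext_closed_coords_def V_def)
    ultimately have "(\<Sum>w | length w = Suc r. pd_op q (slot w x) (z w)) \<in> rad q"
      by (intro sc)
    then show ?thesis using rad_eps by (fastforce simp: f_def pair_def lookup_sum)
  qed
  obtain g where g: "lin_form g" "\<And>x. x \<in> V \<Longrightarrow> g (T x) = f x"
    using lin_form_factor[OF T f V ker] by blast
  \<comment> \<open>The coefficients of \<open>y\<close> are cut off above length \<open>Suc N\<close>. On test words \<open>u\<close> longer than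
    \<open>N\<close> both sides of the equation vanish for reasons of degree.\<close>
  define N where "N = Max (\<Union>w\<in>{w. length w = Suc r}. length ` keys (z w))"
  have N: "length s \<le> N" if "length w = Suc r" "s \<in> keys (z w)" for s w
    unfolding N_def using that by (intro Max_ge) (auto simp: finite_words)
  define g' where "g' v x = g (lin_ext (\<lambda>s. single (s, v) 1) x)" for v :: "'n list" and x :: "'n falg"
  have g': "lin_form (g' v)" for v
    unfolding g'_def by (rule lin_form_comp[OF g(1) lin_map_lin_ext])
  define y where "y v = (\<Sum>s | length s \<le> Suc N. single s (g' v (single s 1)))" for v
  have pair_y: "pair q (single u 1) (y v) = g' v (gram q (single u 1))" if "length u \<le> Suc N" for u v
    unfolding y_def by (rule pair_truncated[OF g' that])
  have keys_y: "length s \<le> Suc N" if "s \<in> keys (y v)" for s v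
  proof -
    have "keys (y v) \<subseteq> (\<Union>s\<in>{s. length s \<le> Suc N}. keys (single s (g' v (single s 1))))"
      unfolding y_def by (rule keys_sum)
    with that show ?thesis by (auto split: if_splits)
  qed
  show ?thesis
  proof (rule that)
    fix t assume t: "closed_coords q (Suc r) t"
    show "(\<Sum>w | length w = Suc r. scal (t w) (z w - pd q (hd w) (y (tl w)))) \<in> rad q"
      unfolding rad_words
    proof
      fix u :: "'n list"
      let ?P = "\<lambda>w. pair q (single (u @ [hd w]) 1) (y (tl w))"
      have pair_eq: "pair q (single u 1) (\<Sum>w | length w = Suc r. scal (t w) (z w - pd q (hd w) (y (tl w))))
          = (\<Sum>w | length w = Suc r. t w * pair q (single u 1) (z w)) -
            (\<Sum>w | length w = Suc r. t w * ?P w)"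
        by (simp add: pair_sum_right pair_scal_right pair_diff_right pair_mult_left
            right_diff_distrib sum_subtractf flip: word_mult_gen)
      show "pair q (single u 1) (\<Sum>w | length w = Suc r. scal (t w) (z w - pd q (hd w) (y (tl w)))) = 0"
      proof (cases "length u \<le> N")
        case True
        define x where "x = (\<Sum>w | length w = Suc r. scal (t w) (single (u, w) 1))"
        have slot_x: "slot w x = scal (t w) (single u 1)" if "length w = Suc r" for w
        proof -
          have "slot w x = (\<Sum>v | length v = Suc r. if v = w then scal (t w) (single u 1) else 0)"
            by (simp add: x_def pmp.linear_sum[OF lin_map_slot] pmp.linear_scale[OF lin_map_slot])
              (auto simp: slot_def intro!: sum.cong)
          then show ?thesis using that by (simp add: finite_words)
        qed
        have "x \<in> V"
          unfolding V_def
        proof (intro CollectI allI)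
          fix s
          from closed_coords_scale[OF t, of "pair q (single s 1) (single u 1)"]
          show "closed_coords q (Suc r) (\<lambda>w. pair q (single s 1) (slot w x))"
            by (rule closed_coords_cong) (simp add: slot_x pair_scal_right mult.commute)
        qed
        then have "g (T x) = f x" by (rule g(2))
        moreover have "f x = (\<Sum>w | length w = Suc r. t w * pair q (single u 1) (z w))"
          by (simp add: f_def slot_x pair_scal_left)
        moreover have "g (T x) = (\<Sum>w | length w = Suc r. t w * ?P w)"
        proof -
          have "g (T (single (u, w) 1)) = ?P w" if "length w = Suc r" for w
            using that True by (simp add: pair_y g'_def T_def)
          then show ?thesis
            by (simp add: x_def pmp.linear_sum[OF T] pmp.linear_scale[OF T] pmc.linear_sum[OF g(1)]
                pmc.linear_scale[OF g(1)])
        qed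
        ultimately show ?thesis using pair_eq by simp
      next
        case False
        have "pair q (single u 1) (z w) = 0" if "length w = Suc r" for w
          using N[OF that] False by (intro pair_word_eq_0) force
        moreover have "?P w = 0" for w
          using keys_y[of _ "tl w"] False by (intro pair_word_eq_0) force
        ultimately show ?thesis using pair_eq by simp
      qed
    qed
  qed
qed

subsection \<open>A closed form that is not exact\<close>

lemma functional_separating:
  fixes C :: "'k \<Rightarrow>\<^sub>0 complex"
  assumes "pm.subspace L" "C \<notin> L"
  obtains h where "lin_form h" "\<And>x. x \<in> L \<Longrightarrow> h x = 0" "h C \<noteq> 0"
proof -
  have id: "lin_map (\<lambda>x :: 'k \<Rightarrow>\<^sub>0 complex. x)" by (rule lin_mapI) auto
  obtain g where g: "range g \<subseteq> L" "lin_map g" "\<And>x. x \<in> L \<Longrightarrow> g x = x"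
    using pmp.linear_exists_left_inverse_on[OF id assms(1)] by auto
  have "g C \<noteq> C" using g(1) assms(2) by (metis rangeI subsetD)
  then obtain k where k: "lookup (C - g C) k \<noteq> 0"
    by (metis eq_iff_diff_eq_0 lookup_zero poly_mapping_eqI)
  have "lin_form (\<lambda>x. lookup (x - g x) k)"
    by (rule lin_formI) (simp_all add: pmp.linear_add[OF g(2)] pmp.linear_scale[OF g(2)]
        lookup_minus lookup_add algebra_simps)
  then show ?thesis using k g(3) by (intro that) auto
qed

lemma sum_count_list: "(\<Sum>i\<in>UNIV. count_list w i) = length (w :: 'n::finite list)"
proof (induction w)
  case (Cons a w)
  have "(\<Sum>i\<in>UNIV. count_list (a # w) i) = (\<Sum>i\<in>UNIV. (if i = a then 1 else 0) + count_list w i)"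
    by (intro sum.cong) auto
  then show ?case using Cons by (simp only: sum.distrib) simp
qed simp

lemma multihomogeneous_homog:
  fixes x :: "'n::finite falg"
  assumes "multihomogeneous x" "x \<noteq> 0"
  shows "homog (poly_order x) x"
proof -
  obtain d where "\<And>w i. w \<in> keys x \<Longrightarrow> count_list w i = d i"
    using assms(1) by (auto simp: multihomogeneous_def)
  then have "homog (\<Sum>i\<in>UNIV. d i) x"
    by (auto simp: homog_def simp flip: sum_count_list)
  then show ?thesis using poly_order_homog assms(2) by metis
qed

text \<open>In degree \<open>k - 1\<close> the radical lies in the ideal \<open>L\<close> generated by the constants of order less than
  \<open>k\<close>, so the functional \<open>u \<mapsto> f(u \<xi>\<^sub>j)\<close> vanishes on the radical and is represented by some
  \<open>z j\<close>. Quadratic constants lie in \<open>L\<close> because \<open>k > 2\<close>, which makes \<open>z\<close> closed. If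
  \<open>z\<close> were the differential of \<open>y\<close>, then \<open>f\<close> would be the pairing with \<open>y\<close> up to its constant
  term, and this vanishes at \<open>C\<close>.\<close>

lemma irreducible_constant_gives_closed_nonexact:
  fixes q :: "'n::finite \<Rightarrow> 'n \<Rightarrow> complex"
  assumes C: "irreducible_constant q C" and "poly_order C > 2"
  obtains z where
    "\<And>t. closed_coords q 2 t \<Longrightarrow> (\<Sum>i\<in>UNIV. \<Sum>j\<in>UNIV. scal (t [i, j]) (pd q i (z j))) \<in> rad q"
    "\<not> (\<exists>y. \<forall>i. z i - pd q i y \<in> rad q)"
proof -
  define k where "k = poly_order C"
  define L where "L = genideal ring_of_type_algebra {C'. is_constant q C' \<and> poly_order C' < k}"
  have k: "2 < k" and C_const: "is_constant q C" and C_L: "C \<notin> L"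
    using assms by (auto simp: irreducible_constant_def k_def L_def)
  have C_homog: "homog k C"
    using C by (auto simp: k_def irreducible_constant_def is_constant_def intro: multihomogeneous_homog)
  note L = ideal_type_algebraD[OF ideal_genideal[of "{C'. is_constant q C' \<and> poly_order C' < k}"],
      folded L_def]
  have rad_L: "x \<in> L" if "x \<in> rad q" "homog n x" "n < k" for x n
    by (rule rad_subset_left_ideal[OF that(1,2)])
      (use L genideal_superset[of "{C'. is_constant q C' \<and> poly_order C' < k}"] that(3)
        in \<open>auto simp: L_def\<close>)
  have "pm.subspace L"
    by (rule pm.subspaceI) (auto intro: L simp: scal_conv_mult)
  then obtain h where h: "lin_form h" "\<And>x. x \<in> L \<Longrightarrow> h x = 0" "h C \<noteq> 0"
    using functional_separating C_L by blast
  define f where "f x = h (hcomp k x)" for x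
  have f: "lin_form f" unfolding f_def by (rule lin_form_comp[OF h(1) lin_map_hcomp])
  have "\<exists>z. \<forall>u. pair q u z = f (u * gen j)" for j
  proof -
    have shift: "hcomp k (u * gen j) = hcomp (k - 1) u * gen j" for u
    proof (induction u rule: pm_induct)
      case (single w)
      then show ?case using k by (auto simp: hcomp_def word_mult_gen)
    qed (auto simp: pmp.linear_add[OF lin_map_hcomp] pmp.linear_scale[OF lin_map_hcomp]
        distrib_right scal_mult_left)
    have "lin_form (\<lambda>u. f (u * gen j))"
      by (rule lin_form_comp[OF f lin_map_mult_right])
    moreover have "f (u * gen j) = 0" if "u \<in> rad q" for u
    proof -
      have "hcomp (k - 1) u \<in> L"
        by (rule rad_L[OF rad_hcomp[OF that] homog_hcomp]) (use k in simp)
      then show ?thesis by (simp add: f_def shift h(2) L(4))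
    qed
    moreover have "f (single w 1 * gen j) = 0" if "k < length w" for w
      using that by (simp add: f_def word_mult_gen hcomp_def pmc.linear_0[OF h(1)])
    ultimately obtain z where "\<And>u. pair q u z = f (u * gen j)"
      using form_represented[of "\<lambda>u. f (u * gen j)" q k] by blast
    then show ?thesis by blast
  qed
  then obtain z where z: "\<And>j u. pair q u (z j) = f (u * gen j)" by metis
  show ?thesis
  proof (rule that)
    fix t assume t: "closed_coords q 2 t"
    define c where "c = (\<Sum>i\<in>UNIV. \<Sum>j\<in>UNIV. scal (t [i, j]) (gen i * gen j))"
    have "c \<in> rad q" using t by (simp add: closed_coords_def c_def)
    moreover have "homog 2 c"
      unfolding c_def using homog_mult[OF homog_gen homog_gen]
      by (intro homog_sum homog_scal) (simp add: numeral_2_eq_2)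
    ultimately have "c \<in> L" using k by (intro rad_L)
    show "(\<Sum>i\<in>UNIV. \<Sum>j\<in>UNIV. scal (t [i, j]) (pd q i (z j))) \<in> rad q"
      unfolding rad_words
    proof
      fix u
      have "pair q (single u 1) (\<Sum>i\<in>UNIV. \<Sum>j\<in>UNIV. scal (t [i, j]) (pd q i (z j)))
          = (\<Sum>i\<in>UNIV. \<Sum>j\<in>UNIV. t [i, j] * pair q (single u 1 * gen i) (z j))"
        by (simp add: pair_sum_right pair_scal_right pair_mult_left)
      also have "\<dots> = f (single u 1 * c)"
        by (simp add: z c_def sum_distrib_left scal_mult_right pmc.linear_sum[OF f]
            pmc.linear_scale[OF f] mult.assoc)
      also have "\<dots> = 0"
      proof -
        have "homog (length u + 2) (single u 1 * c)"
          by (rule homog_mult) (simp_all add: \<open>homog 2 c\<close>)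
        then show ?thesis
          using L(3)[OF \<open>c \<in> L\<close>] by (simp add: f_def hcomp_homog h(2) pmc.linear_0[OF h(1)])
      qed
      finally show "pair q (single u 1) (\<Sum>i\<in>UNIV. \<Sum>j\<in>UNIV. scal (t [i, j]) (pd q i (z j))) = 0" .
    qed
  next
    show "\<not> (\<exists>y. \<forall>i. z i - pd q i y \<in> rad q)"
    proof
      assume "\<exists>y. \<forall>i. z i - pd q i y \<in> rad q"
      then obtain y where y: "\<And>i. z i - pd q i y \<in> rad q" by blast
      define y' where "y' = y - scal (eps y) 1"
      have "f (single w 1) = pair q (single w 1) y'" for w
      proof (cases w rule: rev_exhaust)
        case Nil
        have "hcomp k 1 = (0 :: 'n falg)"
          using k by (simp add: hcomp_def flip: single_Nil_one)
        with Nil show ?thesis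
          by (simp add: f_def pmc.linear_0[OF h(1)] single_Nil_one y'_def lookup_minus)
      next
        case (snoc v j)
        then show ?thesis
          using pair_rad_right[OF y, of "single v 1" j] z[of "single v 1" j]
          by (simp add: pair_mult_left pair_diff_right y'_def pair_scal_right pd_one flip: word_mult_gen)
      qed
      then have "f C = pair q C y'"
        by (rule lin_form_eqI[OF f lin_form_pair_left])
      also have "\<dots> = 0" by (simp add: pair_def pd_op_constant'[OF C_const])
      finally show False using h(3) C_homog by (simp add: f_def hcomp_homog)
    qed
  qed
qed



section \<open>Chains and their coordinates\<close>

abbreviation letters :: "'n list \<Rightarrow> 'n list list" where
  "letters \<equiv> map (\<lambda>i. [i])"

abbreviation gens :: "('n \<Rightarrow> 'n \<Rightarrow> complex) \<Rightarrow> 'n list \<Rightarrow> 'n qalg list" where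
  "gens q \<equiv> map (\<lambda>i. cls q (gen i))"

text \<open>Words of length one test the generators of a tensor factor of degree one, longer words the other
  degrees. Lists of different lengths are orthogonal.\<close>

fun tpair :: "('n::finite \<Rightarrow> 'n \<Rightarrow> complex) \<Rightarrow> 'n list list \<Rightarrow> 'n qalg list \<Rightarrow> complex" where
  "tpair q [] [] = 1"
| "tpair q (s # ss) (b # bs) = qpair q s b * tpair q ss bs"
| "tpair q _ _ = 0"

lemma tpair_length: "length ss \<noteq> length bs \<Longrightarrow> tpair q ss bs = 0"
  by (induction q ss bs rule: tpair.induct) auto

lemma quot_plus_carrier: "b \<in> quot_plus q \<Longrightarrow> b \<in> carrier (quot (q :: 'n::finite \<Rightarrow> 'n \<Rightarrow> complex))"
  using quot_plus_subset by blast

lemma quot_one_plus: "b \<in> quot_one q \<Longrightarrow> b \<in> quot_plus (q :: 'n::finite \<Rightarrow> 'n \<Rightarrow> complex)"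
  using quot_one_subset by blast

lemma tpair_add:
  assumes "v \<in> carrier (quot q)" "w \<in> carrier (quot q)"
  shows "tpair q ss (us @ [v \<oplus>\<^bsub>quot q\<^esub> w] @ vs) = tpair q ss (us @ [v] @ vs) + tpair q ss (us @ [w] @ vs)"
proof (induction us arbitrary: ss)
  case Nil
  then show ?case using assms by (cases ss) (auto simp: qpair_add distrib_right)
next
  case (Cons u us)
  then show ?case by (cases ss) (auto simp: distrib_left)
qed

lemma tpair_qscal:
  assumes "v \<in> carrier (quot q)"
  shows "tpair q ss (us @ [qscal q c v] @ vs) = c * tpair q ss (us @ [v] @ vs)"
proof (induction us arbitrary: ss)
  case Nil
  then show ?case using assms by (cases ss) (auto simp: qpair_qscal)
next
  case (Cons u us)
  then show ?case by (cases ss) auto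
qed

lemma tpair_quot_one_eq_0:
  assumes "set bs \<subseteq> quot_one q" "s \<in> set ss" "length s \<noteq> 1"
  shows "tpair q ss bs = 0"
  using assms
  by (induction q ss bs rule: tpair.induct) (auto simp: qpair_quot_one_eq_0)

lemma gens_quot_one: "set (gens q w) \<subseteq> quot_one (q :: 'n::finite \<Rightarrow> 'n \<Rightarrow> complex)"
  by (auto simp: quot_one_eq)

lemma tpair_letters_gens:
  "tpair q (letters v) (gens q w) = (if v = w then 1 else 0)"
proof (induction v arbitrary: w)
  case Nil
  then show ?case by (cases w) auto
next
  case (Cons i v)
  then show ?case by (cases w) (auto simp: pair_gen_gen)
qed

lemma null_tensor_add:
  assumes "set us \<subseteq> quot_plus q" "set vs \<subseteq> quot_plus q" "v \<in> quot_plus q" "w \<in> quot_plus q"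
  shows "single (us @ [v \<oplus>\<^bsub>quot q\<^esub> w] @ vs) 1 - single (us @ [v] @ vs) 1 - single (us @ [w] @ vs) 1
    \<in> null_chains q"
  unfolding null_chains_def using assms
  by (intro pm.span_base) (unfold tensor_relations_def, blast)

lemma null_tensor_qscal:
  assumes "set us \<subseteq> quot_plus q" "set vs \<subseteq> quot_plus q" "v \<in> quot_plus q"
  shows "single (us @ [qscal q c v] @ vs) 1 - single (us @ [v] @ vs) c \<in> null_chains q"
  unfolding null_chains_def using assms
  by (intro pm.span_base) (unfold tensor_relations_def, blast)

lemma subspace_null_chains: "pm.subspace (null_chains q)"
  unfolding null_chains_def by (rule pm.subspace_span)

lemmas null_0 = pm.subspace_0[OF subspace_null_chains]
  and null_add = pm.subspace_add[OF subspace_null_chains]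
  and null_scal = pm.subspace_scale[OF subspace_null_chains]
  and null_sum = pm.subspace_sum[OF subspace_null_chains]

lemma null_chains_minimal:
  assumes "pm.subspace A" "tensor_relations q \<subseteq> A"
  shows "null_chains q \<subseteq> A"
  unfolding null_chains_def by (rule pm.span_minimal[OF assms(2,1)])

lemma form_ext_tpair_null:
  assumes "x \<in> null_chains q"
  shows "form_ext (tpair q ss) x = 0"
proof -
  have "pm.subspace {x. form_ext (tpair q ss) x = 0}"
    by (rule pm.subspaceI) (auto simp: form_ext_0 form_ext_add form_ext_scal)
  moreover have "tensor_relations q \<subseteq> {x. form_ext (tpair q ss) x = 0}"
    using tpair_add[OF quot_plus_carrier quot_plus_carrier, of _ q]
      tpair_qscal[OF quot_plus_carrier, of _ q]
    by (fastforce simp: tensor_relations_def form_ext_diff)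
  ultimately show ?thesis using null_chains_minimal assms by blast
qed

definition prepend :: "'n qalg \<Rightarrow> 'n chain \<Rightarrow> 'n chain" where
  "prepend b = lin_ext (\<lambda>bs. single (b # bs) 1)"

lemma lin_map_prepend: "lin_map (prepend b)"
  unfolding prepend_def by (rule lin_map_lin_ext)

lemma prepend_single: "prepend b (single bs c) = single (b # bs) c"
  by (simp add: prepend_def lin_ext_single scal_single)

lemma prepend_null:
  assumes "b \<in> quot_plus q" "x \<in> null_chains q"
  shows "prepend b x \<in> null_chains q"
proof -
  have "pm.subspace {x. prepend b x \<in> null_chains q}"
    by (rule pm.subspaceI)
      (auto simp: pmp.linear_0[OF lin_map_prepend] pmp.linear_add[OF lin_map_prepend]
        pmp.linear_scale[OF lin_map_prepend] null_0 null_add null_scal)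
  moreover have "prepend b x \<in> null_chains q" if "x \<in> tensor_relations q" for x
    using that unfolding tensor_relations_def
  proof (elim UnE CollectE exE conjE)
    fix us vs v w
    assume "x = single (us @ [v \<oplus>\<^bsub>quot q\<^esub> w] @ vs) 1 - single (us @ [v] @ vs) 1 - single (us @ [w] @ vs) 1"
      "set us \<subseteq> quot_plus q" "set vs \<subseteq> quot_plus q" "v \<in> quot_plus q" "w \<in> quot_plus q"
    then show "prepend b x \<in> null_chains q"
      using assms(1) null_tensor_add[of "b # us" q vs v w]
      by (simp add: pmp.linear_diff[OF lin_map_prepend] prepend_single)
  next
    fix us vs c v
    assume "x = single (us @ [qscal q c v] @ vs) 1 - single (us @ [v] @ vs) c"
      "set us \<subseteq> quot_plus q" "set vs \<subseteq> quot_plus q" "v \<in> quot_plus q"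
    then show "prepend b x \<in> null_chains q"
      using assms(1) null_tensor_qscal[of "b # us" q vs v c]
      by (simp add: pmp.linear_diff[OF lin_map_prepend] prepend_single)
  qed
  ultimately show ?thesis using null_chains_minimal assms(2) by blast
qed

lemma null_head_sum:
  fixes q :: "'n::finite \<Rightarrow> 'n \<Rightarrow> complex"
  assumes "finite F" "\<And>s. eps (h s) = 0" and bs: "set bs \<subseteq> quot_plus q"
  shows "single (cls q (\<Sum>s\<in>F. scal (c s) (h s)) # bs) 1
    - (\<Sum>s\<in>F. scal (c s) (single (cls q (h s) # bs) 1)) \<in> null_chains q"
  using assms(1)
proof induction
  case empty
  have "cls q 0 \<in> quot_plus q" by (simp add: cls_in_quot_plus_iff)
  from null_tensor_qscal[of "[]", OF _ bs this, of 0] show ?case by (simp add: qscal_cls)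
next
  case (insert s F)
  let ?r = "\<Sum>s\<in>F. scal (c s) (h s)"
  have plus: "cls q (h s) \<in> quot_plus q" "cls q (scal (c s) (h s)) \<in> quot_plus q" "cls q ?r \<in> quot_plus q"
    by (simp_all add: cls_in_quot_plus_iff assms(2) lookup_sum)
  let ?x1 = "single (cls q (scal (c s) (h s) + ?r) # bs) 1 - single (cls q (scal (c s) (h s)) # bs) 1
    - single (cls q ?r # bs) 1"
  let ?x2 = "single (cls q (scal (c s) (h s)) # bs) 1 - scal (c s) (single (cls q (h s) # bs) 1)"
  have "?x1 \<in> null_chains q" using null_tensor_add[of "[]", OF _ bs plus(2,3)] by (simp add: add_cls)
  moreover have "?x2 \<in> null_chains q"
    using null_tensor_qscal[of "[]", OF _ bs plus(1), of "c s"] by (simp add: qscal_cls scal_single)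
  ultimately have "?x1 + ?x2 + (single (cls q ?r # bs) 1
      - (\<Sum>s\<in>F. scal (c s) (single (cls q (h s) # bs) 1))) \<in> null_chains q"
    by (intro null_add insert.IH)
  then show ?case using insert.hyps by (simp add: algebra_simps)
qed

text \<open>Each slot of a tuple is expanded in a dual basis, which changes the chain by a null chain. After
  that, the coefficients are precisely the values of the tests.\<close>

lemma null_chains_complete:
  fixes q :: "'n::finite \<Rightarrow> 'n \<Rightarrow> complex"
  assumes keys: "\<And>bs. bs \<in> keys x \<Longrightarrow> set bs \<subseteq> quot_plus q"
    and 0: "\<And>ss. form_ext (tpair q ss) x = 0"
  shows "x \<in> null_chains q"
proof -
  obtain h where h: "\<And>s. eps (h s) = 0"
    "\<And>S x. finite S \<Longrightarrow> keys (gram q x) \<subseteq> S \<Longrightarrow> eps x = 0 \<Longrightarrow>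
       x - (\<Sum>s\<in>S. scal (pair q (single s 1) x) (h s)) \<in> rad q"
    using quot_plus_section[of q] by blast
  define F where "F = (\<Union>bs\<in>keys x. \<Union>b\<in>set bs. keys (gram q (rep q b)))"
  have "finite F" by (auto simp: F_def)
  let ?e = "\<lambda>ss. map (\<lambda>s. cls q (h s)) ss"
  have expand: "single bs 1 - (\<Sum>ss | set ss \<subseteq> F \<and> length ss = length bs. scal (tpair q ss bs) (single (?e ss) 1))
      \<in> null_chains q"
    if "set bs \<subseteq> quot_plus q" "\<And>b. b \<in> set bs \<Longrightarrow> keys (gram q (rep q b)) \<subseteq> F" for bs
    using that
  proof (induction bs)
    case Nil
    have "{ss. set ss \<subseteq> F \<and> ss = []} = {[]}" by auto
    then show ?case by (simp add: null_0)
  next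
    case (Cons b bs)
    have b: "b \<in> quot_plus q" and bs: "set bs \<subseteq> quot_plus q" using Cons.prems(1) by auto
    have "rep q b - (\<Sum>s\<in>F. scal (pair q (single s 1) (rep q b)) (h s)) \<in> rad q"
      using \<open>finite F\<close> Cons.prems(2) eps_rep[OF b] by (intro h(2)) auto
    then have b_eq: "b = cls q (\<Sum>s\<in>F. scal (qpair q s b) (h s))"
      using cls_rep[OF quot_plus_carrier[OF b]] by (simp add: qpair_def flip: cls_eq_iff)
    let ?y = "single bs 1 - (\<Sum>ss | set ss \<subseteq> F \<and> length ss = length bs. scal (tpair q ss bs) (single (?e ss) 1))"
    have "?y \<in> null_chains q" using Cons by auto
    then have "prepend (cls q (h s)) ?y \<in> null_chains q" for s
      by (intro prepend_null) (simp_all add: cls_in_quot_plus_iff h(1))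
    then have "(\<Sum>s\<in>F. scal (qpair q s b) (prepend (cls q (h s)) ?y)) \<in> null_chains q"
      by (intro null_sum null_scal)
    moreover have "single (b # bs) 1 - (\<Sum>s\<in>F. scal (qpair q s b) (single (cls q (h s) # bs) 1)) \<in> null_chains q"
      using null_head_sum[of F h, OF \<open>finite F\<close> h(1) bs, of "\<lambda>s. qpair q s b"]
      by (simp only: b_eq[symmetric])
    ultimately have "(single (b # bs) 1 - (\<Sum>s\<in>F. scal (qpair q s b) (single (cls q (h s) # bs) 1)))
      + (\<Sum>s\<in>F. scal (qpair q s b) (prepend (cls q (h s)) ?y)) \<in> null_chains q"
      by (rule null_add[rotated])
    moreover have "(\<Sum>s\<in>F. scal (qpair q s b) (prepend (cls q (h s)) ?y)) =
      (\<Sum>s\<in>F. scal (qpair q s b) (single (cls q (h s) # bs) 1)) -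
      (\<Sum>ss | set ss \<subseteq> F \<and> length ss = length (b # bs). scal (tpair q ss (b # bs)) (single (?e ss) 1))"
      by (simp add: sum_lists_Suc pmp.linear_diff[OF lin_map_prepend] pmp.linear_sum[OF lin_map_prepend]
          pmp.linear_scale[OF lin_map_prepend] prepend_single pm.scale_right_diff_distrib
          sum_subtractf pm.scale_sum_right)
    ultimately show ?case by simp
  qed
  define M where "M = Max (length ` keys x)"
  let ?A = "{ss. set ss \<subseteq> F \<and> length ss \<le> M}"
  have "finite ?A" using \<open>finite F\<close> by (rule finite_lists_length_le)
  have "single bs 1 - (\<Sum>ss\<in>?A. scal (tpair q ss bs) (single (?e ss) 1)) \<in> null_chains q"
    if "bs \<in> keys x" for bs
  proof -
    have "length bs \<le> M" using that by (auto simp: M_def)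
    then have "(\<Sum>ss\<in>?A. scal (tpair q ss bs) (single (?e ss) 1)) =
      (\<Sum>ss | set ss \<subseteq> F \<and> length ss = length bs. scal (tpair q ss bs) (single (?e ss) 1))"
      using \<open>finite ?A\<close> by (intro sum.mono_neutral_right) (auto simp: tpair_length)
    moreover have "keys (gram q (rep q b)) \<subseteq> F" if "b \<in> set bs" for b
      using that \<open>bs \<in> keys x\<close> by (auto simp: F_def)
    ultimately show ?thesis using expand[of bs] keys[OF that] by simp
  qed
  then have "(\<Sum>bs\<in>keys x. scal (lookup x bs) (single bs 1 -
      (\<Sum>ss\<in>?A. scal (tpair q ss bs) (single (?e ss) 1)))) \<in> null_chains q"
    by (intro null_sum null_scal)
  moreover have "(\<Sum>bs\<in>keys x. scal (lookup x bs) (\<Sum>ss\<in>?A. scal (tpair q ss bs) (single (?e ss) 1))) =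
      (\<Sum>ss\<in>?A. scal (form_ext (tpair q ss) x) (single (?e ss) 1))"
    unfolding pm.scale_sum_right form_ext_def pm.scale_sum_left
    by (subst sum.swap) simp
  ultimately show ?thesis
    using pm_expand[of x] by (simp add: 0 pm.scale_right_diff_distrib sum_subtractf)
qed

subsection \<open>The boundary\<close>

text \<open>The tests of a boundary, computed on single tuples.\<close>

definition bd_coord :: "('n::finite \<Rightarrow> 'n \<Rightarrow> complex) \<Rightarrow> 'n list list \<Rightarrow> 'n qalg list \<Rightarrow> complex" where
  "bd_coord q ss bs = form_ext (tpair q ss) (bd_tuple q bs)"

lemma bd_tuple_Cons_Cons:
  "bd_tuple q (a # b # bs) = single ((a \<otimes>\<^bsub>quot q\<^esub> b) # bs) 1 - prepend a (bd_tuple q (b # bs))"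
proof -
  have "bd_tuple q (a # b # bs) = single ((a \<otimes>\<^bsub>quot q\<^esub> b) # bs) 1 +
    (\<Sum>i<length bs. single (a # take i (b # bs) @ [(b # bs) ! i \<otimes>\<^bsub>quot q\<^esub> bs ! i] @ drop (Suc i) bs) (- ((-1) ^ i)))"
    by (simp add: bd_tuple_def sum.lessThan_Suc_shift del: sum.lessThan_Suc)
  also have "(\<Sum>i<length bs. single (a # take i (b # bs) @ [(b # bs) ! i \<otimes>\<^bsub>quot q\<^esub> bs ! i] @ drop (Suc i) bs) (- ((-1) ^ i)))
    = - prepend a (bd_tuple q (b # bs))"
    by (simp add: bd_tuple_def pmp.linear_sum[OF lin_map_prepend] prepend_single single_uminus sum_negf)
  finally show ?thesis by simp
qed

lemma form_ext_prepend:
  "form_ext (tpair q ss) (prepend b x) = (case ss of [] \<Rightarrow> 0 | s # ss' \<Rightarrow> qpair q s b * form_ext (tpair q ss') x)"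
  by (induction x rule: pm_induct)
    (auto simp: prepend_single pmp.linear_add[OF lin_map_prepend] pmp.linear_scale[OF lin_map_prepend]
      form_ext_add form_ext_scal distrib_left form_ext_0 split: list.splits)

lemma bd_coord_simps [simp]:
  "bd_coord q ss [] = 0" "bd_coord q ss [b] = 0" "bd_coord q [] bs = 0"
  "bd_coord q (s # ss) (a # b # bs) =
     qpair q s (a \<otimes>\<^bsub>quot q\<^esub> b) * tpair q ss bs - qpair q s a * bd_coord q ss (b # bs)"
proof -
  show [simp]: "bd_coord q ss [] = 0" "bd_coord q ss [b] = 0" for ss b
    by (simp_all add: bd_coord_def bd_tuple_def form_ext_0)
  show "bd_coord q [] bs = 0"
  proof (cases bs)
    case (Cons a cs)
    then show ?thesis
      by (cases cs) (simp_all add: bd_coord_def[of _ _ "_ # _ # _"] bd_tuple_Cons_Cons form_ext_diff form_ext_prepend)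
  qed simp
  show "bd_coord q (s # ss) (a # b # bs) =
     qpair q s (a \<otimes>\<^bsub>quot q\<^esub> b) * tpair q ss bs - qpair q s a * bd_coord q ss (b # bs)"
    by (simp add: bd_coord_def bd_tuple_Cons_Cons form_ext_diff form_ext_prepend)
qed

lemma keys_lin_ext: "keys (lin_ext f x) \<subseteq> (\<Union>k\<in>keys x. keys (f k))"
proof -
  have "keys (lin_ext f x) \<subseteq> (\<Union>k\<in>keys x. keys (scal (lookup x k) (f k)))"
    unfolding lin_ext_def by (rule keys_sum)
  also have "\<dots> \<subseteq> (\<Union>k\<in>keys x. keys (f k))"
    by (intro UN_mono) (auto simp: in_keys_iff)
  finally show ?thesis .
qed

lemma keys_bd_tuple:
  fixes q :: "'n::finite \<Rightarrow> 'n \<Rightarrow> complex"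
  assumes "set as \<subseteq> quot_plus q" "bs \<in> keys (bd_tuple q as)"
  shows "set bs \<subseteq> quot_plus q"
proof -
  let ?b = "\<lambda>i. take i as @ [as ! i \<otimes>\<^bsub>quot q\<^esub> as ! Suc i] @ drop (i + 2) as"
  have "bs \<in> (\<Union>i<length as - 1. keys (single (?b i) ((-1) ^ i :: complex)))"
    by (rule subsetD[OF keys_sum assms(2)[unfolded bd_tuple_def]])
  then obtain i where i: "i < length as - 1" "bs = ?b i"
    by (auto simp del: append.simps split: if_splits)
  have "as ! i \<in> quot_plus q" "as ! Suc i \<in> quot_plus q" using i(1) assms(1) by auto
  then obtain x y where "as ! i = cls q x" "as ! Suc i = cls q y" "eps x = 0"
    by (auto simp: quot_plus_def)
  moreover have "eps (x * y) = 0" if "eps x = 0" for x y :: "'n falg"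
  proof (induction y rule: falg_right_induct)
    case one
    then show ?case using that by simp
  next
    case (gen j y)
    then show ?case by (simp flip: mult.assoc)
  qed (auto simp: distrib_left lookup_add scal_mult_right)
  ultimately have "as ! i \<otimes>\<^bsub>quot q\<^esub> as ! Suc i \<in> quot_plus q"
    by (simp add: mult_cls cls_in_quot_plus_iff)
  then show ?thesis
    using assms(1) set_take_subset[of i as] set_drop_subset[of "i + 2" as] by (auto simp: i(2))
qed

lemma closed_chain_iff:
  fixes q :: "'n::finite \<Rightarrow> 'n \<Rightarrow> complex"
  assumes "\<And>as. as \<in> keys a \<Longrightarrow> set as \<subseteq> quot_plus q"
  shows "closed_chain q a \<longleftrightarrow> (\<forall>ss. form_ext (bd_coord q ss) a = 0)"
proof -
  have bd: "form_ext (tpair q ss) (lin_ext (bd_tuple q) a) = form_ext (bd_coord q ss) a" for ss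
    by (induction a rule: pm_induct)
      (auto simp: lin_ext_add lin_ext_scal form_ext_add form_ext_scal bd_coord_def)
  have "set bs \<subseteq> quot_plus q" if "bs \<in> keys (lin_ext (bd_tuple q) a)" for bs
    using that keys_lin_ext[of "bd_tuple q" a] keys_bd_tuple[OF assms] by blast
  then show ?thesis
    unfolding closed_chain_def
    using form_ext_tpair_null[of "lin_ext (bd_tuple q) a" q] null_chains_complete[of "lin_ext (bd_tuple q) a" q]
    by (auto simp: bd)
qed

text \<open>The boundary of a tensor of generators has a factor of degree two, which a letter does not see.\<close>

lemma bd_coord_letters:
  assumes "set as \<subseteq> quot_one q"
  shows "bd_coord q (letters v) as = 0"
  using assms
proof (induction v arbitrary: as)
  case (Cons i v)
  then show ?case
    by (cases as rule: remdups_adj.cases) (auto simp: qpair_mult_quot_one_eq_0)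
qed simp

text \<open>The only summand of the boundary that has degree two in the slot of \<open>s\<close> and degree one elsewhere is the one
  multiplying the factors at the positions \<open>length u\<close> and \<open>length u + 1\<close>.\<close>

lemma bd_coord_quadratic:
  fixes q :: "'n::finite \<Rightarrow> 'n \<Rightarrow> complex"
  assumes "set as \<subseteq> quot_one q" "length as = length u + length v + 2" "length s = 2"
  shows "bd_coord q (letters u @ [s] @ letters v) as = (-1) ^ length u *
    (\<Sum>i\<in>UNIV. \<Sum>j\<in>UNIV. tpair q (letters (u @ [i, j] @ v)) as * pair q (single s 1) (gen i * gen j))"
  using assms(1,2)
proof (induction u arbitrary: as)
  case Nil
  then obtain a b bs where as: "as = a # b # bs"
    by (cases as rule: remdups_adj.cases) auto
  have ab: "a \<in> quot_one q" "b \<in> quot_one q" using Nil as by auto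
  have "qpair q s (a \<otimes>\<^bsub>quot q\<^esub> b) =
      (\<Sum>i\<in>UNIV. \<Sum>j\<in>UNIV. qpair q [i] a * (qpair q [j] b * pair q (single s 1) (gen i * gen j)))"
    by (subst quot_one_expand[OF ab(1)], subst quot_one_expand[OF ab(2)])
      (simp add: mult_cls sum_distrib_left sum_distrib_right scal_mult_left scal_mult_right
        pair_sum_right pair_scal_right, subst sum.swap, simp add: mult.left_commute)
  then show ?case
    using qpair_quot_one_eq_0[OF ab(1), of s] assms(3)
    by (simp add: as sum_distrib_left sum_distrib_right mult_ac)
next
  case (Cons k u)
  then obtain a b bs where as: "as = a # b # bs"
    by (cases as rule: remdups_adj.cases) auto
  have "qpair q [k] (a \<otimes>\<^bsub>quot q\<^esub> b) = 0"
    using Cons.prems as by (intro qpair_mult_quot_one_eq_0) auto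
  then show ?case
    using Cons.IH[of "b # bs"] Cons.prems
    by (simp add: as sum_distrib_left mult_ac sum_negf)
qed



section \<open>Forms in coordinates\<close>

lemma is_form_carrier: "is_form q p z \<Longrightarrow> length as = p \<Longrightarrow> set as \<subseteq> quot_one q \<Longrightarrow> z as \<in> carrier (quot q)"
  and is_form_add: "is_form q p z \<Longrightarrow> length us + 1 + length vs = p \<Longrightarrow> set us \<subseteq> quot_one q \<Longrightarrow>
        set vs \<subseteq> quot_one q \<Longrightarrow> v \<in> quot_one q \<Longrightarrow> w \<in> quot_one q \<Longrightarrow>
        z (us @ [v \<oplus>\<^bsub>quot q\<^esub> w] @ vs) = z (us @ [v] @ vs) \<oplus>\<^bsub>quot q\<^esub> z (us @ [w] @ vs)"
  and is_form_qscal: "is_form q p z \<Longrightarrow> length us + 1 + length vs = p \<Longrightarrow> set us \<subseteq> quot_one q \<Longrightarrow>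
        set vs \<subseteq> quot_one q \<Longrightarrow> v \<in> quot_one q \<Longrightarrow>
        z (us @ [qscal q c v] @ vs) = qscal q c (z (us @ [v] @ vs))"
  unfolding is_form_def by blast+

lemma cls_quot_one: "homog 1 x \<Longrightarrow> cls q x \<in> quot_one (q :: 'n::finite \<Rightarrow> 'n \<Rightarrow> complex)"
  by (auto simp: quot_one_eq)

lemma is_form_slot:
  fixes q :: "'n::finite \<Rightarrow> 'n \<Rightarrow> complex"
  assumes z: "is_form q p z" and len: "length us + 1 + length vs = p"
    and us: "set us \<subseteq> quot_one q" and vs: "set vs \<subseteq> quot_one q"
    and x: "\<And>i. z (us @ [cls q (gen i)] @ vs) = cls q (x i)"
  shows "z (us @ [cls q (\<Sum>i\<in>A. scal (c i) (gen i))] @ vs) = cls q (\<Sum>i\<in>A. scal (c i) (x i))"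
proof (induction A rule: infinite_finite_induct)
  case (infinite A)
  then show ?case using finite by blast
next
  case empty
  have "cls q 0 = qscal q 0 (cls q 0)" by (simp add: qscal_cls)
  then have "z (us @ [cls q 0] @ vs) = qscal q 0 (z (us @ [cls q 0] @ vs))"
    using is_form_qscal[OF z len us vs cls_quot_one, of 0 0] by simp
  also have "\<dots> = cls q 0"
    using is_form_carrier[OF z, of "us @ [cls q 0] @ vs"] len us vs cls_quot_one[of 0 q]
    by (auto simp: carrier_quot qscal_cls)
  finally show ?case by simp
next
  case (insert j A)
  have 1: "homog 1 (\<Sum>i\<in>A. scal (c i) (gen i))" by (intro homog_sum homog_scal) simp
  have 2: "homog 1 (scal (c j) (gen j))" by (intro homog_scal) simp
  have "z (us @ [cls q (scal (c j) (gen j))] @ vs) = cls q (scal (c j) (x j))"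
    using is_form_qscal[OF z len us vs cls_quot_one, of "gen j" "c j"] by (simp add: qscal_cls x[simplified])
  then show ?case
    using insert is_form_add[OF z len us vs cls_quot_one[OF 2] cls_quot_one[OF 1]]
    by (simp add: add_cls)
qed

text \<open>The prefix \<open>us\<close> holds the slots that have been reduced to generators already.\<close>

lemma is_form_expand:
  fixes q :: "'n::finite \<Rightarrow> 'n \<Rightarrow> complex"
  assumes z: "is_form q p z" and "set bs \<subseteq> quot_one q" "set us \<subseteq> quot_one q"
    and "length us + length bs = p"
    and "\<And>w. length w = length bs \<Longrightarrow> z (us @ gens q w) = cls q (x w)"
  shows "z (us @ bs) = cls q (\<Sum>w | length w = length bs. scal (tpair q (letters w) bs) (x w))"
  using assms(2-)
proof (induction bs arbitrary: us x)
  case Nil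
  then show ?case by simp
next
  case (Cons b bs)
  have b: "b \<in> quot_one q" using Cons.prems by simp
  have "z ((us @ [cls q (gen i)]) @ bs) = cls q (\<Sum>w | length w = length bs. scal (tpair q (letters w) bs) (x (i # w)))" for i
  proof (rule Cons.IH)
    show "z ((us @ [cls q (gen i)]) @ gens q w) = cls q (x (i # w))" if "length w = length bs" for w
      using Cons.prems(4)[of "i # w"] that by simp
  qed (use Cons.prems in \<open>auto intro: cls_quot_one[simplified]\<close>)
  then have "z (us @ [cls q (\<Sum>i\<in>UNIV. scal (qpair q [i] b) (gen i))] @ bs) =
      cls q (\<Sum>i\<in>UNIV. scal (qpair q [i] b) (\<Sum>w | length w = length bs. scal (tpair q (letters w) bs) (x (i # w))))"
    using Cons.prems by (intro is_form_slot[OF z]) auto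
  then show ?case
    by (simp add: sum_words_Suc pm.scale_sum_right flip: quot_one_expand[OF b])
qed

lemma qlin_ext_form:
  fixes q :: "'n::finite \<Rightarrow> 'n \<Rightarrow> complex"
  assumes z: "is_form q p z"
    and a: "\<And>as. as \<in> keys a \<Longrightarrow> length as = p \<and> set as \<subseteq> quot_one q"
    and x: "\<And>w. length w = p \<Longrightarrow> z (gens q w) = cls q (x w)"
  shows "qlin_ext q z a = cls q (\<Sum>w | length w = p. scal (form_ext (tpair q (letters w)) a) (x w))"
proof -
  have "qlin_ext q z a = cls q (\<Sum>as\<in>keys a. scal (lookup a as)
      (\<Sum>w | length w = p. scal (tpair q (letters w) as) (x w)))"
    using is_form_expand[OF z, of _ "[]" x] a x by (intro qlin_ext_cls) auto
  also have "(\<Sum>as\<in>keys a. scal (lookup a as) (\<Sum>w | length w = p. scal (tpair q (letters w) as) (x w))) =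
      (\<Sum>w | length w = p. scal (form_ext (tpair q (letters w)) a) (x w))"
    unfolding pm.scale_sum_right form_ext_def pm.scale_sum_left by (subst sum.swap) simp
  finally show ?thesis .
qed

text \<open>The family in front of the words that describes a chain with leading factors. It depends on
  representatives of the leading factors, hence it is meaningful modulo the radical only.\<close>

definition ext_coords :: "('n::finite \<Rightarrow> 'n \<Rightarrow> complex) \<Rightarrow> 'n chain \<Rightarrow> 'n list \<Rightarrow> 'n falg" where
  "ext_coords q a w = lin_ext (\<lambda>as. scal (tpair q (letters w) (tl as)) (rep q (hd as))) a"

lemma pair_ext_coords:
  "pair q (single s 1) (ext_coords q a w) = form_ext (\<lambda>as. tpair q (letters w) (tl as) * qpair q s (hd as)) a"
  unfolding ext_coords_def
  by (induction a rule: pm_induct)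
    (auto simp: lin_ext_add lin_ext_scal pair_add_right pair_scal_right form_ext_add form_ext_scal qpair_def)

lemma qlin_ext_form_diff:
  fixes q :: "'n::finite \<Rightarrow> 'n \<Rightarrow> complex"
  assumes z: "is_form q p z"
    and a: "\<And>as. as \<in> keys a \<Longrightarrow> length as = Suc p \<and> hd as \<in> quot_plus q \<and> set (tl as) \<subseteq> quot_one q"
    and x: "\<And>w. length w = p \<Longrightarrow> z (gens q w) = cls q (x w)"
  shows "qlin_ext q (form_diff q z) a = cls q (\<Sum>w | length w = p. pd_op q (ext_coords q a w) (x w))"
proof -
  have "form_diff q z as = cls q (pd_op q (rep q (hd as)) (\<Sum>w | length w = p. scal (tpair q (letters w) (tl as)) (x w)))"
    if "as \<in> keys a" for as
  proof -
    have "z (tl as) = cls q (\<Sum>w | length w = p. scal (tpair q (letters w) (tl as)) (x w))"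
      using is_form_expand[OF z, of "tl as" "[]" x] a[OF that] x by auto
    moreover have "cls q (rep q (hd as)) = hd as"
      using a[OF that] by (simp add: cls_rep quot_plus_carrier)
    ultimately show ?thesis
      using act_cls[of q "rep q (hd as)"] by (simp add: form_diff_def)
  qed
  then have "qlin_ext q (form_diff q z) a = cls q (\<Sum>as\<in>keys a. scal (lookup a as)
      (pd_op q (rep q (hd as)) (\<Sum>w | length w = p. scal (tpair q (letters w) (tl as)) (x w))))"
    by (rule qlin_ext_cls)
  also have "(\<Sum>as\<in>keys a. scal (lookup a as)
      (pd_op q (rep q (hd as)) (\<Sum>w | length w = p. scal (tpair q (letters w) (tl as)) (x w)))) =
      (\<Sum>w | length w = p. pd_op q (ext_coords q a w) (x w))"
    unfolding ext_coords_def lin_ext_def pd_op_sum_left pd_op_sum_right pm.scale_sum_right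
    by (subst sum.swap) (simp add: pd_op_scal_left pd_op_scal_right)
  finally show ?thesis .
qed

definition form_of :: "('n::finite \<Rightarrow> 'n \<Rightarrow> complex) \<Rightarrow> nat \<Rightarrow> ('n list \<Rightarrow> 'n falg) \<Rightarrow> 'n qalg list \<Rightarrow> 'n qalg" where
  "form_of q p x bs = cls q (\<Sum>w | length w = p. scal (tpair q (letters w) bs) (x w))"

lemma is_form_form_of: "is_form q p (form_of q p x)"
proof -
  have "v \<in> carrier (quot q)" if "v \<in> quot_one q" for v
    using that by (intro quot_plus_carrier quot_one_plus)
  then show ?thesis
    by (simp add: is_form_def form_of_def add_cls qscal_cls tpair_add[simplified] tpair_qscal[simplified]
        pm.scale_left_distrib sum.distrib pm.scale_sum_right)
qed

lemma form_of_gens: "length w = p \<Longrightarrow> form_of q p x (gens q w) = cls q (x w)"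
proof -
  assume "length w = p"
  moreover have "(\<Sum>v | length v = p. scal (tpair q (letters v) (gens q w)) (x v)) =
      (\<Sum>v | length v = p. if v = w then x w else 0)"
    by (intro sum.cong) (auto simp: tpair_letters_gens)
  ultimately show ?thesis by (simp add: form_of_def finite_words)
qed

lemma act_add:
  "a \<in> carrier (quot q) \<Longrightarrow> b \<in> carrier (quot q) \<Longrightarrow> y \<in> carrier (quot q) \<Longrightarrow>
    act q (a \<oplus>\<^bsub>quot q\<^esub> b) y = act q a y \<oplus>\<^bsub>quot q\<^esub> act q b (y :: 'n::finite qalg)"
  "a \<in> carrier (quot q) \<Longrightarrow> y \<in> carrier (quot q) \<Longrightarrow> z \<in> carrier (quot q) \<Longrightarrow>
    act q a (y \<oplus>\<^bsub>quot q\<^esub> z) = act q a y \<oplus>\<^bsub>quot q\<^esub> act q a z"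
  by (auto simp: carrier_quot add_cls act_cls pd_op_add_left pd_op_add_right)

lemma act_qscal:
  "a \<in> carrier (quot q) \<Longrightarrow> y \<in> carrier (quot q) \<Longrightarrow>
    act q (qscal q c a) y = qscal q c (act q a (y :: 'n::finite qalg))"
  "a \<in> carrier (quot q) \<Longrightarrow> y \<in> carrier (quot q) \<Longrightarrow> act q a (qscal q c y) = qscal q c (act q a y)"
  by (auto simp: carrier_quot qscal_cls act_cls pd_op_scal_left pd_op_scal_right)

lemma act_carrier: "a \<in> carrier (quot q) \<Longrightarrow> y \<in> carrier (quot q) \<Longrightarrow>
    act q a y \<in> carrier (quot (q :: 'n::finite \<Rightarrow> 'n \<Rightarrow> complex))"
  by (auto simp: carrier_quot act_cls)

lemma is_form_form_diff:
  fixes q :: "'n::finite \<Rightarrow> 'n \<Rightarrow> complex"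
  assumes y: "is_form q r y"
  shows "is_form q (Suc r) (form_diff q y)"
proof -
  have one: "v \<in> carrier (quot q)" if "v \<in> quot_one q" for v
    using that by (intro quot_plus_carrier quot_one_plus)
  note yc = is_form_carrier[OF y]
  have 1: "form_diff q y as \<in> carrier (quot q)" if "length as = Suc r" "set as \<subseteq> quot_one q" for as
    using that by (cases as) (auto simp: form_diff_def act_carrier one yc)
  have 2: "form_diff q y (us @ [v \<oplus>\<^bsub>quot q\<^esub> w] @ vs) =
      form_diff q y (us @ [v] @ vs) \<oplus>\<^bsub>quot q\<^esub> form_diff q y (us @ [w] @ vs)"
    if "length us + 1 + length vs = Suc r" "set us \<subseteq> quot_one q" "set vs \<subseteq> quot_one q"
      "v \<in> quot_one q" "w \<in> quot_one q" for us vs v w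
  proof (cases us)
    case Nil
    then show ?thesis using that by (simp add: form_diff_def act_add one yc)
  next
    case (Cons u us')
    then show ?thesis
      using that is_form_add[OF y, of us' vs v w] by (simp add: form_diff_def act_add one yc)
  qed
  have 3: "form_diff q y (us @ [qscal q c v] @ vs) = qscal q c (form_diff q y (us @ [v] @ vs))"
    if "length us + 1 + length vs = Suc r" "set us \<subseteq> quot_one q" "set vs \<subseteq> quot_one q"
      "v \<in> quot_one q" for us vs c v
  proof (cases us)
    case Nil
    then show ?thesis using that by (simp add: form_diff_def act_qscal one yc)
  next
    case (Cons u us')
    then show ?thesis
      using that is_form_qscal[OF y, of us' vs v c] by (simp add: form_diff_def act_qscal one yc)
  qed
  show ?thesis unfolding is_form_def using 1 2 3 by blast
qed

lemma form_diff_gens: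
  fixes q :: "'n::finite \<Rightarrow> 'n \<Rightarrow> complex"
  assumes "length w = Suc r" "\<And>v. length v = r \<Longrightarrow> y (gens q v) = cls q (x v)"
  shows "form_diff q y (gens q w) = cls q (pd q (hd w) (x (tl w)))"
  using assms by (cases w) (auto simp: form_diff_def act_cls)

subsection \<open>Closed chains in coordinates\<close>

lemma closed_coords_iff:
  fixes q :: "'n::finite \<Rightarrow> 'n \<Rightarrow> complex"
  shows "closed_coords q p t \<longleftrightarrow> (\<forall>u v s. length u + length v + 2 = p \<longrightarrow> length s = 2 \<longrightarrow>
     (\<Sum>i\<in>UNIV. \<Sum>j\<in>UNIV. t (u @ [i, j] @ v) * pair q (single s 1) (gen i * gen j)) = 0)"
proof -
  have 0: "pair q (single s 1) (gen i * gen j) = 0" if "length s \<noteq> 2" for s and i j :: 'n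
    using pair_homog[OF _ homog_mult[OF homog_gen homog_gen], of "length s" "single s 1"] that
    by (simp add: homog_singleI)
  have "(\<Sum>i\<in>UNIV. \<Sum>j\<in>UNIV. scal (t (u @ [i, j] @ v)) (gen i * gen j)) \<in> rad q \<longleftrightarrow>
    (\<forall>s. length s = 2 \<longrightarrow> (\<Sum>i\<in>UNIV. \<Sum>j\<in>UNIV. t (u @ [i, j] @ v) * pair q (single s 1) (gen i * gen j)) = 0)"
    for u v
    unfolding rad_words by (auto simp: pair_sum_right pair_scal_right 0) (metis (mono_tags, lifting) 0 mult_zero_right sum.neutral)
  then show ?thesis unfolding closed_coords_def by (simp only:) blast
qed

lemma closed_chains_coords:
  fixes q :: "'n::finite \<Rightarrow> 'n \<Rightarrow> complex"
  assumes "a \<in> closed_chains q p"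
  shows "closed_coords q p (\<lambda>w. form_ext (tpair q (letters w)) a)"
  unfolding closed_coords_iff
proof (intro allI impI)
  fix u v s :: "'n list" assume len: "length u + length v + 2 = p" "length s = 2"
  let ?P = "\<lambda>i j. pair q (single s 1) (gen i * gen j)"
  have as: "length as = p" "set as \<subseteq> quot_one q" if "as \<in> keys a" for as
    using assms that by (auto simp: closed_chains_def)
  have "form_ext (bd_coord q (letters u @ [s] @ letters v)) a = 0"
    using assms closed_chain_iff[of a q] as quot_one_subset[of q] by (auto simp: closed_chains_def)
  also have "form_ext (bd_coord q (letters u @ [s] @ letters v)) a =
      (\<Sum>as\<in>keys a. lookup a as * ((-1) ^ length u *
        (\<Sum>i\<in>UNIV. \<Sum>j\<in>UNIV. tpair q (letters (u @ [i, j] @ v)) as * ?P i j)))"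
    unfolding form_ext_def using as len by (intro sum.cong refl arg_cong2[of _ _ _ _ "(*)"] bd_coord_quadratic) auto
  also have "\<dots> = (-1) ^ length u * (\<Sum>as\<in>keys a. \<Sum>i\<in>UNIV. \<Sum>j\<in>UNIV.
      lookup a as * tpair q (letters (u @ [i, j] @ v)) as * ?P i j)"
    by (simp add: sum_distrib_left mult_ac)
  also have "(\<Sum>as\<in>keys a. \<Sum>i\<in>UNIV. \<Sum>j\<in>UNIV. lookup a as * tpair q (letters (u @ [i, j] @ v)) as * ?P i j)
     = (\<Sum>i\<in>UNIV. \<Sum>j\<in>UNIV. form_ext (tpair q (letters (u @ [i, j] @ v))) a * ?P i j)"
    unfolding form_ext_def sum_distrib_right
    by (subst sum.swap, rule sum.cong, simp, subst sum.swap, simp)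
  finally show "(\<Sum>i\<in>UNIV. \<Sum>j\<in>UNIV. form_ext (tpair q (letters (u @ [i, j] @ v))) a * ?P i j) = 0"
    by simp
qed

lemma ext_closed_chains_coords:
  fixes q :: "'n::finite \<Rightarrow> 'n \<Rightarrow> complex"
  assumes a: "a \<in> ext_closed_chains q p"
  shows "ext_closed_coords q p (ext_coords q a)" "eps (ext_coords q a w) = 0"
proof -
  have as: "length as = Suc p" "hd as \<in> quot_plus q" "set (tl as) \<subseteq> quot_one q" if "as \<in> keys a" for as
    using a that by (auto simp: ext_closed_chains_def)
  have "set as \<subseteq> quot_plus q" if "as \<in> keys a" for as
    using as[OF that] quot_one_subset[of q] by (cases as) auto
  then have bd: "form_ext (bd_coord q ss) a = 0" for ss
    using closed_chain_iff[of a q] a by (auto simp: ext_closed_chains_def)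
  have "closed_coords q p (\<lambda>w. pair q (single s0 1) (ext_coords q a w))" for s0
    unfolding closed_coords_iff
  proof (intro allI impI)
    fix u v s :: "'n list" assume len: "length u + length v + 2 = p" "length s = 2"
    let ?P = "\<lambda>i j. pair q (single s 1) (gen i * gen j)"
    let ?S = "letters u @ [s] @ letters v"
    have "bd_coord q (s0 # ?S) as = - ((-1) ^ length u * (\<Sum>i\<in>UNIV. \<Sum>j\<in>UNIV.
        tpair q (letters (u @ [i, j] @ v)) (tl as) * qpair q s0 (hd as) * ?P i j))"
      if "as \<in> keys a" for as
    proof -
      note mem = that
      obtain b c cs where bc: "as = b # c # cs"
        using as(1)[OF mem] len(1) by (cases as rule: remdups_adj.cases) auto
      have "tpair q ?S cs = 0"
        using as(3)[OF mem] bc len(2) by (intro tpair_quot_one_eq_0[of _ _ s]) auto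
      moreover have "bd_coord q ?S (c # cs) = (-1) ^ length u *
        (\<Sum>i\<in>UNIV. \<Sum>j\<in>UNIV. tpair q (letters (u @ [i, j] @ v)) (c # cs) * ?P i j)"
        using as[OF mem] bc len by (intro bd_coord_quadratic) auto
      ultimately show ?thesis by (simp add: bc sum_distrib_left mult_ac)
    qed
    then have "form_ext (bd_coord q (s0 # ?S)) a = (\<Sum>as\<in>keys a. lookup a as * (- ((-1) ^ length u *
       (\<Sum>i\<in>UNIV. \<Sum>j\<in>UNIV. tpair q (letters (u @ [i, j] @ v)) (tl as) * qpair q s0 (hd as) * ?P i j))))"
      by (simp add: form_ext_def)
    also have "\<dots> = - ((-1) ^ length u * (\<Sum>as\<in>keys a. \<Sum>i\<in>UNIV. \<Sum>j\<in>UNIV.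
        lookup a as * (tpair q (letters (u @ [i, j] @ v)) (tl as) * qpair q s0 (hd as)) * ?P i j))"
      by (simp add: sum_distrib_left mult_ac sum_negf)
    also have "(\<Sum>as\<in>keys a. \<Sum>i\<in>UNIV. \<Sum>j\<in>UNIV.
        lookup a as * (tpair q (letters (u @ [i, j] @ v)) (tl as) * qpair q s0 (hd as)) * ?P i j)
      = (\<Sum>i\<in>UNIV. \<Sum>j\<in>UNIV. pair q (single s0 1) (ext_coords q a (u @ [i, j] @ v)) * ?P i j)"
      unfolding pair_ext_coords form_ext_def sum_distrib_right
      by (subst sum.swap, rule sum.cong, simp, subst sum.swap, simp)
    finally show "(\<Sum>i\<in>UNIV. \<Sum>j\<in>UNIV. pair q (single s0 1) (ext_coords q a (u @ [i, j] @ v)) * ?P i j) = 0"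
      using bd[of "s0 # ?S"] by simp
  qed
  moreover have "(\<Sum>i\<in>UNIV. ext_coords q a (i # v) * gen i) \<in> rad q" if len: "length v + 1 = p" for v
    unfolding rad_words
  proof
    fix s
    have "(\<Sum>i\<in>UNIV. tpair q (letters (i # v)) (tl as) * pair q (single s 1) (rep q (hd as) * gen i))
      = bd_coord q (s # letters v) as"
      if "as \<in> keys a" for as
    proof -
      note mem = that
      obtain b c cs where bc: "as = b # c # cs"
        using as(1)[OF mem] len(1) by (cases as rule: remdups_adj.cases) auto
      have c: "c \<in> quot_one q" "set (c # cs) \<subseteq> quot_one q" and b: "b \<in> quot_plus q"
        using as[OF mem] bc by auto
      have "b \<otimes>\<^bsub>quot q\<^esub> c = cls q (rep q b * (\<Sum>i\<in>UNIV. scal (qpair q [i] c) (gen i)))"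
        by (simp add: cls_rep[OF quot_plus_carrier[OF b]] flip: mult_cls quot_one_expand[OF c(1)])
      then have "qpair q s (b \<otimes>\<^bsub>quot q\<^esub> c) = (\<Sum>i\<in>UNIV. qpair q [i] c * pair q (single s 1) (rep q b * gen i))"
        by (simp add: sum_distrib_left scal_mult_right pair_sum_right pair_scal_right)
      then show ?thesis
        using bd_coord_letters[OF c(2), of v] by (simp add: bc sum_distrib_left sum_distrib_right mult_ac)
    qed
    then have *: "form_ext (bd_coord q (s # letters v)) a = (\<Sum>as\<in>keys a. \<Sum>i\<in>UNIV. lookup a as *
        (tpair q (letters (i # v)) (tl as) * pair q (single s 1) (rep q (hd as) * gen i)))"
      by (simp add: form_ext_def flip: sum_distrib_left)
    have "pair q (single s 1) (ext_coords q a (i # v) * gen i) = (\<Sum>as\<in>keys a. lookup a as *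
        (tpair q (letters (i # v)) (tl as) * pair q (single s 1) (rep q (hd as) * gen i)))" for i
      by (simp add: ext_coords_def lin_ext_def sum_distrib_right scal_mult_left pair_sum_right pair_scal_right
          mult.assoc del: list.map)
    then show "pair q (single s 1) (\<Sum>i\<in>UNIV. ext_coords q a (i # v) * gen i) = 0"
      using * bd[of "s # letters v"] by (simp only: pair_sum_right) (subst sum.swap, simp)
  qed
  ultimately show "ext_closed_coords q p (ext_coords q a)"
    by (simp add: ext_closed_coords_def)
  have "eps (ext_coords q a w) = form_ext (\<lambda>as. tpair q (letters w) (tl as) * qpair q [] (hd as)) a"
    using pair_ext_coords[of q "[]" a w] by (simp add: single_Nil_one)
  also have "\<dots> = 0"
    unfolding form_ext_def using as(2) by (intro sum.neutral) (auto simp: qpair_def single_Nil_one eps_rep)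
  finally show "eps (ext_coords q a w) = 0" .
qed

text \<open>Splitting off the first letter separates the product of the first two factors, which is annihilated
  by assumption, from the boundary of the remaining tensor.\<close>

lemma closed_coords_bd_coord:
  fixes q :: "'n::finite \<Rightarrow> 'n \<Rightarrow> complex"
  assumes "closed_coords q p t"
  shows "(\<Sum>w | length w = p. t w * bd_coord q ss (gens q w)) = 0"
  using assms
proof (induction p arbitrary: t ss)
  case 0
  then show ?case by simp
next
  case (Suc p)
  show ?case
  proof (cases "p = 0 \<or> ss = []")
    case True
    then show ?thesis by (auto simp: length_Suc_conv intro!: sum.neutral)
  next
    case False
    then obtain p' s ss' where eqs: "p = Suc p'" "ss = s # ss'" by (metis not0_implies_Suc neq_Nil_conv)
    have "(\<Sum>i\<in>UNIV. \<Sum>j\<in>UNIV. t (i # j # v) * pair q (single s 1) (gen i * gen j)) = 0"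
      if "length v = p'" for v
    proof -
      have "(\<Sum>i\<in>UNIV. \<Sum>j\<in>UNIV. scal (t (i # j # v)) (gen i * gen j)) \<in> rad q"
        using Suc.prems that unfolding closed_coords_def eqs by (elim allE[of _ "[]"] allE[of _ v]) simp
      from pair_rad_right[OF this, of "single s 1"] show ?thesis
        by (simp add: pair_sum_right pair_scal_right)
    qed
    then have "(\<Sum>v | length v = p'. tpair q ss' (gens q v) *
        (\<Sum>i\<in>UNIV. \<Sum>j\<in>UNIV. t (i # j # v) * pair q (single s 1) (gen i * gen j))) = 0"
      by simp
    moreover have "(\<Sum>v | length v = p'. tpair q ss' (gens q v) *
        (\<Sum>i\<in>UNIV. \<Sum>j\<in>UNIV. t (i # j # v) * pair q (single s 1) (gen i * gen j))) =
      (\<Sum>i\<in>UNIV. \<Sum>j\<in>UNIV. \<Sum>v | length v = p'. t (i # j # v) *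
        (pair q (single s 1) (gen i * gen j) * tpair q ss' (gens q v)))"
      unfolding sum_distrib_left
      by (subst sum.swap, rule sum.cong, simp, subst sum.swap, simp add: mult_ac)
    moreover have "(\<Sum>w | length w = p. t (i # w) * bd_coord q ss' (gens q w)) = 0" for i
    proof (rule Suc.IH)
      show "closed_coords q p (\<lambda>w. t (i # w))"
        unfolding closed_coords_def
      proof (intro allI impI)
        fix u v :: "'n list" assume "length u + length v + 2 = p"
        then show "(\<Sum>j\<in>UNIV. \<Sum>k\<in>UNIV. scal (t (i # u @ [j, k] @ v)) (gen j * gen k)) \<in> rad q"
          using Suc.prems unfolding closed_coords_def by (elim allE[of _ "i # u"] allE[of _ v]) simp
      qed
    qed
    then have "(\<Sum>i\<in>UNIV. pair q (single s 1) (gen i) *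
        (\<Sum>w | length w = p. t (i # w) * bd_coord q ss' (gens q w))) = 0"
      by simp
    ultimately show ?thesis
      by (simp add: eqs sum_words_Suc mult_cls right_diff_distrib sum_subtractf sum_distrib_left mult_ac)
  qed
qed

lemma closed_coords_chain:
  fixes q :: "'n::finite \<Rightarrow> 'n \<Rightarrow> complex"
  assumes "closed_coords q p t"
  obtains a where "a \<in> closed_chains q p" "\<And>w. length w = p \<Longrightarrow> form_ext (tpair q (letters w)) a = t w"
proof -
  define a where "a = (\<Sum>w | length w = p. single (gens q w) (t w))"
  have keys: "length as = p \<and> set as \<subseteq> quot_one q" if "as \<in> keys a" for as
  proof -
    have "as \<in> (\<Union>w\<in>{w. length w = p}. keys (single (gens q w) (t w)))"
      by (rule subsetD[OF keys_sum that[unfolded a_def]])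
    then obtain w where "length w = p" "as = gens q w" by (auto split: if_splits)
    then show ?thesis using gens_quot_one[of q w] by simp
  qed
  have val: "form_ext f a = (\<Sum>w | length w = p. t w * f (gens q w))" for f
    by (simp add: a_def form_ext_sum)
  have plus: "set as \<subseteq> quot_plus q" if "as \<in> keys a" for as
    using keys[OF that] quot_one_subset[of q] by blast
  have "closed_chain q a"
    using closed_coords_bd_coord[OF assms] by (simp add: closed_chain_iff[OF plus] val)
  then have "a \<in> closed_chains q p" using keys by (auto simp: closed_chains_def)
  moreover have "form_ext (tpair q (letters w)) a = t w" if "length w = p" for w
  proof -
    have "form_ext (tpair q (letters w)) a = (\<Sum>v | length v = p. if v = w then t w else 0)"
      unfolding val by (intro sum.cong) (auto simp: tpair_letters_gens)
    then show ?thesis using that by (simp add: finite_words)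
  qed
  ultimately show ?thesis by (rule that)
qed

lemma ext_closed_coords_chain:
  fixes q :: "'n::finite \<Rightarrow> 'n \<Rightarrow> complex"
  assumes e: "ext_closed_coords q (Suc r) e" and eps: "\<And>w. length w = Suc r \<Longrightarrow> eps (e w) = 0"
  obtains a where "a \<in> ext_closed_chains q (Suc r)"
    "\<And>w. length w = Suc r \<Longrightarrow> ext_coords q a w - e w \<in> rad q"
proof -
  define a :: "'n chain" where "a = (\<Sum>w | length w = Suc r. single (cls q (e w) # gens q w) 1)"
  have keys: "length as = Suc (Suc r) \<and> hd as \<in> quot_plus q \<and> set (tl as) \<subseteq> quot_one q"
    if "as \<in> keys a" for as
  proof -
    have "as \<in> (\<Union>w\<in>{w. length w = Suc r}. keys (single (cls q (e w) # gens q w) (1 :: complex)))"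
      by (rule subsetD[OF keys_sum that[unfolded a_def]])
    then obtain w where "length w = Suc r" "as = cls q (e w) # gens q w" by (auto split: if_splits)
    then show ?thesis using gens_quot_one[of q w] eps by (simp add: cls_in_quot_plus_iff)
  qed
  have keys': "set as \<subseteq> quot_plus q" if "as \<in> keys a" for as
    using keys[OF that] quot_one_subset[of q] by (cases as) auto
  have "form_ext (bd_coord q ss) a = 0" for ss
  proof (cases ss)
    case Nil
    then show ?thesis by (simp add: a_def form_ext_sum)
  next
    case (Cons s ss')
    have "(\<Sum>w | length w = Suc r. pair q (single s 1) (e w) * bd_coord q ss' (gens q w)) = 0"
      using e by (intro closed_coords_bd_coord) (auto simp: ext_closed_coords_def)
    moreover have "(\<Sum>v | length v = r. tpair q ss' (gens q v) *
        pair q (single s 1) (\<Sum>i\<in>UNIV. e (i # v) * gen i)) = 0"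
      using e by (intro sum.neutral) (auto simp: ext_closed_coords_def intro!: pair_rad_right)
    then have "(\<Sum>i\<in>UNIV. \<Sum>v | length v = r. pair q (single s 1) (e (i # v) * gen i) * tpair q ss' (gens q v)) = 0"
      by (subst sum.swap) (simp add: pair_sum_right sum_distrib_left mult.commute)
    ultimately show ?thesis
      by (simp add: a_def form_ext_sum Cons sum_words_Suc mult_cls sum_subtractf)
  qed
  then have "a \<in> ext_closed_chains q (Suc r)"
    using keys by (simp add: ext_closed_chains_def closed_chain_iff[OF keys'])
  moreover have "ext_coords q a w - e w \<in> rad q" if "length w = Suc r" for w
  proof -
    have "ext_coords q a w = (\<Sum>v | length v = Suc r. if v = w then rep q (cls q (e w)) else 0)"
      unfolding ext_coords_def a_def pmp.linear_sum[OF lin_map_lin_ext]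
      by (intro sum.cong) (auto simp: tpair_letters_gens)
    then show ?thesis using that rep_cls by (simp add: finite_words)
  qed
  ultimately show ?thesis by (rule that)
qed

lemma strongly_closed_iff:
  fixes q :: "'n::finite \<Rightarrow> 'n \<Rightarrow> complex"
  assumes z: "is_form q (Suc r) z" and x: "\<And>w. length w = Suc r \<Longrightarrow> z (gens q w) = cls q (x w)"
  shows "strongly_closed q (Suc r) z \<longleftrightarrow>
    (\<forall>e. ext_closed_coords q (Suc r) e \<longrightarrow> (\<forall>w. length w = Suc r \<longrightarrow> eps (e w) = 0) \<longrightarrow>
      (\<Sum>w | length w = Suc r. pd_op q (e w) (x w)) \<in> rad q)"
    (is "_ \<longleftrightarrow> ?R")
proof
  assume sc: "strongly_closed q (Suc r) z"
  show ?R
  proof (intro allI impI)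
    fix e assume "ext_closed_coords q (Suc r) e" "\<forall>w. length w = Suc r \<longrightarrow> eps (e w) = 0"
    then obtain a where a: "a \<in> ext_closed_chains q (Suc r)"
      "\<And>w. length w = Suc r \<Longrightarrow> ext_coords q a w - e w \<in> rad q"
      using ext_closed_coords_chain[of q r e] by blast
    have "qlin_ext q (form_diff q z) a = cls q (\<Sum>w | length w = Suc r. pd_op q (ext_coords q a w) (x w))"
      using a(1) by (intro qlin_ext_form_diff[OF z _ x]) (auto simp: ext_closed_chains_def)
    moreover have "pd_op q (ext_coords q a w) (x w) = pd_op q (e w) (x w)" if "length w = Suc r" for w
      using pd_op_rad_left[OF a(2)[OF that], of "x w"] by (simp add: pd_op_diff_left)
    ultimately show "(\<Sum>w | length w = Suc r. pd_op q (e w) (x w)) \<in> rad q"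
      using sc a(1) by (simp add: strongly_closed_def flip: cls_eq_zero_iff)
  qed
next
  assume R: ?R
  show "strongly_closed q (Suc r) z"
    unfolding strongly_closed_def
  proof
    fix a assume a: "a \<in> ext_closed_chains q (Suc r)"
    have "qlin_ext q (form_diff q z) a = cls q (\<Sum>w | length w = Suc r. pd_op q (ext_coords q a w) (x w))"
      using a by (intro qlin_ext_form_diff[OF z _ x]) (auto simp: ext_closed_chains_def)
    then show "qlin_ext q (form_diff q z) a = \<zero>\<^bsub>quot q\<^esub>"
      using R ext_closed_chains_coords[OF a] by (simp add: cls_eq_zero_iff)
  qed
qed

text \<open>Equality of cochains is a linear condition on the values on generators, to be tested on the
  coefficients of closed chains.\<close>

lemma forms_agree_iff:
  fixes q :: "'n::finite \<Rightarrow> 'n \<Rightarrow> complex"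
  assumes z: "is_form q p z" "\<And>w. length w = p \<Longrightarrow> z (gens q w) = cls q (x w)"
    and z': "is_form q p z'" "\<And>w. length w = p \<Longrightarrow> z' (gens q w) = cls q (x' w)"
  shows "(\<forall>a\<in>closed_chains q p. qlin_ext q z a = qlin_ext q z' a) \<longleftrightarrow>
    (\<forall>t. closed_coords q p t \<longrightarrow> (\<Sum>w | length w = p. scal (t w) (x w - x' w)) \<in> rad q)"
proof -
  have *: "qlin_ext q z a = qlin_ext q z' a \<longleftrightarrow>
      (\<Sum>w | length w = p. scal (form_ext (tpair q (letters w)) a) (x w - x' w)) \<in> rad q"
    if "a \<in> closed_chains q p" for a
  proof -
    have keys: "length as = p \<and> set as \<subseteq> quot_one q" if "as \<in> keys a" for as
      using \<open>a \<in> closed_chains q p\<close> that by (auto simp: closed_chains_def)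
    show ?thesis
      using qlin_ext_form[OF z(1) keys z(2)] qlin_ext_form[OF z'(1) keys z'(2)]
      by (simp add: cls_eq_iff pm.scale_right_diff_distrib sum_subtractf)
  qed
  show ?thesis
  proof
    assume agree: "\<forall>a\<in>closed_chains q p. qlin_ext q z a = qlin_ext q z' a"
    show "\<forall>t. closed_coords q p t \<longrightarrow> (\<Sum>w | length w = p. scal (t w) (x w - x' w)) \<in> rad q"
    proof (intro allI impI)
      fix t assume "closed_coords q p t"
      then obtain a where a: "a \<in> closed_chains q p"
        "\<And>w. length w = p \<Longrightarrow> form_ext (tpair q (letters w)) a = t w"
        using closed_coords_chain[of q p t] by blast
      then show "(\<Sum>w | length w = p. scal (t w) (x w - x' w)) \<in> rad q"
        using agree *[OF a(1)] by simp
    qed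
  next
    assume "\<forall>t. closed_coords q p t \<longrightarrow> (\<Sum>w | length w = p. scal (t w) (x w - x' w)) \<in> rad q"
    then show "\<forall>a\<in>closed_chains q p. qlin_ext q z a = qlin_ext q z' a"
      using closed_chains_coords[of _ q p] * by blast
  qed
qed

lemma exact_form_iff:
  fixes q :: "'n::finite \<Rightarrow> 'n \<Rightarrow> complex"
  assumes z: "is_form q (Suc r) z" and x: "\<And>w. length w = Suc r \<Longrightarrow> z (gens q w) = cls q (x w)"
  shows "exact_form q (Suc r) z \<longleftrightarrow> (\<exists>y. \<forall>t. closed_coords q (Suc r) t \<longrightarrow>
      (\<Sum>w | length w = Suc r. scal (t w) (x w - pd q (hd w) (y (tl w)))) \<in> rad q)"
proof
  assume "exact_form q (Suc r) z"
  then obtain y where y: "is_form q r y"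
    "\<forall>a\<in>closed_chains q (Suc r). qlin_ext q z a = qlin_ext q (form_diff q y) a"
    by (auto simp: exact_form_def)
  have "y (gens q v) = cls q (rep q (y (gens q v)))" if "length v = r" for v
    using is_form_carrier[OF y(1), of "gens q v"] that gens_quot_one[of q v] by (simp add: cls_rep)
  then have gens: "form_diff q y (gens q w) = cls q (pd q (hd w) (rep q (y (gens q (tl w)))))"
    if "length w = Suc r" for w
    using form_diff_gens[OF that, of y q "\<lambda>v. rep q (y (gens q v))"] by simp
  show "\<exists>y. \<forall>t. closed_coords q (Suc r) t \<longrightarrow>
      (\<Sum>w | length w = Suc r. scal (t w) (x w - pd q (hd w) (y (tl w)))) \<in> rad q"
    using y(2) forms_agree_iff[OF z x is_form_form_diff[OF y(1)] gens]
    by (intro exI[of _ "\<lambda>v. rep q (y (gens q v))"]) simp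
next
  assume "\<exists>y. \<forall>t. closed_coords q (Suc r) t \<longrightarrow>
      (\<Sum>w | length w = Suc r. scal (t w) (x w - pd q (hd w) (y (tl w)))) \<in> rad q"
  then obtain y where y: "\<forall>t. closed_coords q (Suc r) t \<longrightarrow>
      (\<Sum>w | length w = Suc r. scal (t w) (x w - pd q (hd w) (y (tl w)))) \<in> rad q" by blast
  have gens: "form_diff q (form_of q r y) (gens q w) = cls q (pd q (hd w) (y (tl w)))"
    if "length w = Suc r" for w
    using that by (intro form_diff_gens form_of_gens)
  show "exact_form q (Suc r) z"
    unfolding exact_form_def
    using y forms_agree_iff[OF z x is_form_form_diff[OF is_form_form_of] gens] is_form_form_of
    by (intro exI[of _ "form_of q r y"]) auto
qed

theorem exact_iff_strongly_closed:
  fixes q :: "'n::finite \<Rightarrow> 'n \<Rightarrow> complex"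
  assumes "p \<ge> 1" and z: "is_form q p z"
  shows "exact_form q p z \<longleftrightarrow> strongly_closed q p z"
proof -
  obtain r where p: "p = Suc r" using assms(1) by (cases p) auto
  define x where "x w = rep q (z (gens q w))" for w
  have x: "z (gens q w) = cls q (x w)" if "length w = Suc r" for w
    using is_form_carrier[OF z, of "gens q w"] that gens_quot_one[of q w] by (simp add: cls_rep x_def p)
  note exact_iff = exact_form_iff[OF z[unfolded p] x] and sc_iff = strongly_closed_iff[OF z[unfolded p] x]
  show ?thesis
    unfolding p
  proof
    assume "exact_form q (Suc r) z"
    then obtain y where y: "\<And>t. closed_coords q (Suc r) t \<Longrightarrow>
        (\<Sum>w | length w = Suc r. scal (t w) (x w - pd q (hd w) (y (tl w)))) \<in> rad q"
      using exact_iff by auto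
    show "strongly_closed q (Suc r) z"
      using exact_imp_strongly_closed_coords[of q r x y, OF y] sc_iff by simp
  next
    assume "strongly_closed q (Suc r) z"
    then have "(\<Sum>w | length w = Suc r. pd_op q (e w) (x w)) \<in> rad q"
      if "ext_closed_coords q (Suc r) e" "\<And>w. length w = Suc r \<Longrightarrow> eps (e w) = 0" for e
      using that sc_iff by simp
    then obtain y where "\<And>t. closed_coords q (Suc r) t \<Longrightarrow>
        (\<Sum>w | length w = Suc r. scal (t w) (x w - pd q (hd w) (y (tl w)))) \<in> rad q"
      using strongly_closed_imp_exact_coords[of q r x] by blast
    then show "exact_form q (Suc r) z"
      using exact_iff by auto
  qed
qed



section \<open>Cohomology\<close>

lemma cochain_of_eq_iff:
  fixes q :: "'n::finite \<Rightarrow> 'n \<Rightarrow> complex"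
  assumes "is_form q p z" "\<And>w. length w = p \<Longrightarrow> z (gens q w) = cls q (x w)"
    and "is_form q p z'" "\<And>w. length w = p \<Longrightarrow> z' (gens q w) = cls q (x' w)"
  shows "cochain_of q p z = cochain_of q p z' \<longleftrightarrow>
    (\<forall>t. closed_coords q p t \<longrightarrow> (\<Sum>w | length w = p. scal (t w) (x w - x' w)) \<in> rad q)"
proof -
  have "cochain_of q p z = cochain_of q p z' \<longleftrightarrow> (\<forall>a\<in>closed_chains q p. qlin_ext q z a = qlin_ext q z' a)"
    unfolding cochain_of_def restrict_def fun_eq_iff by auto
  then show ?thesis using forms_agree_iff[OF assms] by simp
qed

lemma is_form_0_iff: "is_form q 0 z \<longleftrightarrow> z [] \<in> carrier (quot q)"
  by (auto simp: is_form_def)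

lemma cochain_of_0_eq_iff:
  fixes q :: "'n::finite \<Rightarrow> 'n \<Rightarrow> complex"
  assumes "z [] = cls q x" "z' [] = cls q x'"
  shows "cochain_of q 0 z = cochain_of q 0 z' \<longleftrightarrow> x - x' \<in> rad q"
proof -
  have "cochain_of q 0 z = cochain_of q 0 z' \<longleftrightarrow> 
      (\<forall>t :: 'n list \<Rightarrow> complex. scal (t []) (x - x') \<in> rad q)"
    using assms cochain_of_eq_iff[of q 0 z "\<lambda>_. x" z' "\<lambda>_. x'"]
    by (simp add: is_form_0_iff closed_coords_def)
  also have "\<dots> \<longleftrightarrow> x - x' \<in> rad q"
  proof
    assume "\<forall>t :: 'n list \<Rightarrow> complex. scal (t []) (x - x') \<in> rad q"
    from spec[OF this, of "\<lambda>_. 1"] show "x - x' \<in> rad q" by simp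
  qed (simp add: rad_scal)
  finally show ?thesis .
qed

lemma cochain_of_1_eq_iff:
  fixes q :: "'n::finite \<Rightarrow> 'n \<Rightarrow> complex"
  assumes "is_form q 1 z" "\<And>i. z [cls q (gen i)] = cls q (x i)"
    and "is_form q 1 z'" "\<And>i. z' [cls q (gen i)] = cls q (x' i)"
  shows "cochain_of q 1 z = cochain_of q 1 z' \<longleftrightarrow> (\<forall>i. x i - x' i \<in> rad q)"
proof -
  have "z (gens q w) = cls q (x (hd w))" "z' (gens q w) = cls q (x' (hd w))" if "length w = 1" for w
    using that assms(2,4) by (auto simp: length_Suc_conv)
  from cochain_of_eq_iff[OF assms(1) this(1) assms(3) this(2)]
  have "cochain_of q 1 z = cochain_of q 1 z' \<longleftrightarrow>
      (\<forall>t :: 'n list \<Rightarrow> complex. (\<Sum>i\<in>UNIV. scal (t [i]) (x i - x' i)) \<in> rad q)"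
    by (simp add: sum_words_Suc closed_coords_def)
  also have "\<dots> \<longleftrightarrow> (\<forall>i. x i - x' i \<in> rad q)"
  proof
    assume *: "\<forall>t :: 'n list \<Rightarrow> complex. (\<Sum>i\<in>UNIV. scal (t [i]) (x i - x' i)) \<in> rad q"
    show "\<forall>i. x i - x' i \<in> rad q"
    proof
      fix j
      have "(\<Sum>i\<in>UNIV. scal (if [i] = [j] then 1 else 0) (x i - x' i)) =
          (\<Sum>i\<in>UNIV. if i = j then x j - x' j else 0)"
        by (intro sum.cong) auto
      then show "x j - x' j \<in> rad q"
        using spec[OF *, of "\<lambda>w. if w = [j] then 1 else 0"] by simp
    qed
  qed (auto intro: rad_sum rad_scal)
  finally show ?thesis .
qed

lemma is_form_zero: "is_form q p (\<lambda>_. cls q (0 :: 'n::finite falg))"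
  by (simp add: is_form_def add_cls qscal_cls)

lemma qlin_ext_const: "qlin_ext q (\<lambda>_. cls q (x :: 'n::finite falg)) a = cls q (\<Sum>as\<in>keys a. scal (lookup a as) x)"
  by (rule qlin_ext_cls) simp

lemma one_cochains: "\<one>\<^bsub>cochains q p\<^esub> = cochain_of q p (\<lambda>_. cls q (0 :: 'n::finite falg))"
  by (auto simp: cochains_def cochain_of_def qlin_ext_const zero_quot intro!: restrict_ext)

text \<open>The differential picks some form restricting to the given cochain; below it turns out that in
  degrees 0 and 1 the values on tuples of generators do not depend on it.\<close>

lemma differential_cochain_of:
  assumes "is_form q p z"
  obtains z' where "is_form q p z'" "cochain_of q p z' = cochain_of q p z"
    "differential q p (cochain_of q p z) = cochain_of q (Suc p) (form_diff q z')"
  using someI_ex[of "\<lambda>z'. is_form q p z' \<and> cochain_of q p z' = cochain_of q p z"] assms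
  unfolding differential_def by blast

lemma differential_0_eq_iff:
  fixes q :: "'n::finite \<Rightarrow> 'n \<Rightarrow> complex"
  assumes "y [] = cls q x" and z: "is_form q 1 z" "\<And>i. z [cls q (gen i)] = cls q (x' i)"
  shows "differential q 0 (cochain_of q 0 y) = cochain_of q 1 z \<longleftrightarrow> (\<forall>i. pd q i x - x' i \<in> rad q)"
proof -
  have "is_form q 0 y" using assms(1) by (simp add: is_form_0_iff)
  then obtain y' where y': "is_form q 0 y'" "cochain_of q 0 y' = cochain_of q 0 y"
    "differential q 0 (cochain_of q 0 y) = cochain_of q 1 (form_diff q y')"
    using differential_cochain_of[of q 0 y] by auto
  obtain x0 where "y' [] = cls q x0" using y'(1) by (auto simp: is_form_0_iff carrier_quot)
  then have "y' [] = cls q x"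
    using y'(2) cochain_of_0_eq_iff[of y' q x0 y x] assms(1) by (simp add: cls_eq_iff)
  then have "form_diff q y' [cls q (gen i)] = cls q (pd q i x)" for i
    by (simp add: form_diff_def act_cls)
  moreover have "is_form q 1 (form_diff q y')"
    using is_form_form_diff[OF y'(1)] by simp
  ultimately show ?thesis
    unfolding y'(3) by (intro cochain_of_1_eq_iff z)
qed

lemma differential_0_eq_one_iff:
  fixes q :: "'n::finite \<Rightarrow> 'n \<Rightarrow> complex"
  assumes "y [] = cls q x"
  shows "differential q 0 (cochain_of q 0 y) = \<one>\<^bsub>cochains q 1\<^esub> \<longleftrightarrow> (\<forall>i. pd q i x \<in> rad q)"
  using differential_0_eq_iff[of y q x "\<lambda>_. cls q 0" "\<lambda>_. 0"] assms is_form_zero[of q 1]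
  by (simp add: one_cochains)

lemma carrier_cochains: "carrier (cochains q p) = cochain_of q p ` Collect (is_form q p)"
  by (auto simp: cochains_def)

text \<open>Closed 0-cochains are elements all of whose derivatives lie in the radical, that is, scalars modulo
  the radical. No nonzero scalar lies in the radical.\<close>

lemma unit_class_iso:
  fixes q :: "'n::finite \<Rightarrow> 'n \<Rightarrow> complex"
  shows "unit_class q \<in> iso \<lparr>carrier = UNIV, monoid.mult = (+), one = 0\<rparr> (cohomology q 0)"
proof -
  define U where "U c = cochain_of q 0 (\<lambda>_. cls q (scal c 1))" for c
  have one: "\<one>\<^bsub>cochains q 0\<^esub> = U 0" by (simp add: one_cochains U_def)
  have mult: "U c \<otimes>\<^bsub>cochains q 0\<^esub> U d = U (c + d)" for c d
    by (auto simp: U_def cochain_of_def cochains_def qlin_ext_const add_cls pm.scale_left_distrib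
        pm.scale_right_distrib distrib_left sum.distrib intro!: restrict_ext)
  have U_eq: "U c = U d \<longleftrightarrow> c = d" for c d
  proof
    assume "U c = U d"
    then have "scal c 1 - scal d 1 \<in> rad q"
      unfolding U_def by (subst (asm) cochain_of_0_eq_iff[OF refl refl]) auto
    from rad_eps[OF this] show "c = d" by (simp add: lookup_minus)
  qed simp
  have cob: "coboundaries q 0 = {U 0}" by (simp add: coboundaries_def one)
  have unit: "unit_class q c = {U c}" for c
    by (simp add: unit_class_def cob r_coset_def one_quot qscal_cls mult flip: U_def)
  have "cocycles q 0 = range U"
  proof (intro equalityI subsetI)
    fix f assume "f \<in> cocycles q 0"
    then obtain z where z: "is_form q 0 z" "f = cochain_of q 0 z" "differential q 0 f = \<one>\<^bsub>cochains q 1\<^esub>"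
      by (auto simp: cocycles_def kernel_def carrier_cochains)
    obtain x where x: "z [] = cls q x" using z(1) by (auto simp: is_form_0_iff carrier_quot)
    have "pd q i x \<in> rad q" for i
      using z(3) differential_0_eq_one_iff[of z q x, OF x] by (simp add: z(2))
    then have "x - scal (eps x) 1 \<in> rad q" by (rule rad_if_pd_rad)
    then have "f = U (eps x)"
      unfolding U_def z(2) by (subst cochain_of_0_eq_iff[of z q x, OF x refl]) auto
    then show "f \<in> range U" by simp
  next
    fix f assume "f \<in> range U"
    then obtain c where f: "f = U c" by blast
    have "differential q 0 (U c) = \<one>\<^bsub>cochains q 1\<^esub>"
      unfolding U_def by (subst differential_0_eq_one_iff[OF refl]) (simp add: pd_scal pd_one)
    moreover have "U c \<in> carrier (cochains q 0)"
      by (auto simp: U_def carrier_cochains is_form_0_iff)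
    ultimately show "f \<in> cocycles q 0" by (simp add: f cocycles_def kernel_def)
  qed
  then have "cohomology q 0 = \<lparr>carrier = range (\<lambda>c. {U c}),
      monoid.mult = set_mult ((cochains q 0)\<lparr>carrier := cocycles q 0\<rparr>), one = {U 0}\<rparr>"
    by (auto simp: cohomology_def FactGroup_def RCOSETS_def r_coset_def cob mult)
  then show ?thesis
    by (auto simp: iso_def hom_def bij_betw_def inj_on_def unit set_mult_def mult U_eq)
qed

lemma irreducible_constant_imp_cohomology_nontrivial:
  fixes q :: "'n::finite \<Rightarrow> 'n \<Rightarrow> complex"
  assumes "irreducible_constant q C" "poly_order C > 2"
  shows "carrier (cohomology q 1) \<noteq> {\<one>\<^bsub>cohomology q 1\<^esub>}"
proof -
  obtain x where x: "\<And>t. closed_coords q 2 t \<Longrightarrow>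
      (\<Sum>i\<in>UNIV. \<Sum>j\<in>UNIV. scal (t [i, j]) (pd q i (x j))) \<in> rad q"
    "\<not> (\<exists>y. \<forall>i. x i - pd q i y \<in> rad q)"
    using irreducible_constant_gives_closed_nonexact[OF assms] by blast
  define z where "z = form_of q 1 (\<lambda>w. x (hd w))"
  define f where "f = cochain_of q 1 z"
  have z: "is_form q 1 z" "z [cls q (gen i)] = cls q (x i)" for i
    using is_form_form_of[of q 1] form_of_gens[of "[i]" 1 q "\<lambda>w. x (hd w)"] by (auto simp: z_def)
  have cocycle: "f \<in> cocycles q 1"
  proof -
    obtain z' where z': "is_form q 1 z'" "cochain_of q 1 z' = f"
      "differential q 1 f = cochain_of q (Suc 1) (form_diff q z')"
      unfolding f_def by (rule differential_cochain_of[OF z(1)])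
    have "\<exists>y. z' [cls q (gen i)] = cls q y" for i
      using is_form_carrier[OF z'(1), of "[cls q (gen i)]"] cls_quot_one[of "gen i" q]
      by (auto simp: carrier_quot)
    then obtain x' where x': "\<And>i. z' [cls q (gen i)] = cls q (x' i)" by metis
    have z'_gen: "z' [cls q (gen i)] = cls q (x i)" for i
      using z'(2) cochain_of_1_eq_iff[OF z'(1) x' z] by (simp add: f_def x' cls_eq_iff)
    have gens: "form_diff q z' (gens q w) = cls q (pd q (hd w) (x (hd (tl w))))" if "length w = Suc 1" for w
      using that z'_gen by (intro form_diff_gens) (auto simp: length_Suc_conv)
    have "cochain_of q (Suc 1) (form_diff q z') = \<one>\<^bsub>cochains q (Suc 1)\<^esub>"
      unfolding one_cochains
      by (subst cochain_of_eq_iff[OF is_form_form_diff[OF z'(1)] gens is_form_zero refl])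
        (use x(1) in \<open>auto simp: sum_words_Suc numeral_2_eq_2\<close>)
    moreover have "f \<in> carrier (cochains q 1)"
      using z(1) by (auto simp: carrier_cochains f_def)
    ultimately show ?thesis using z'(3) by (simp add: cocycles_def kernel_def)
  qed
  have coboundary: "coboundaries q 1 = differential q 0 ` carrier (cochains q 0)"
    by (simp add: coboundaries_def)
  have not_coboundary: "f \<notin> coboundaries q 1"
  proof
    assume "f \<in> coboundaries q 1"
    then obtain y where y: "is_form q 0 y" "differential q 0 (cochain_of q 0 y) = f"
      unfolding coboundary carrier_cochains by blast
    obtain y0 where y0: "y [] = cls q y0" using y(1) by (auto simp: is_form_0_iff carrier_quot)
    have "\<forall>i. pd q i y0 - x i \<in> rad q"
      using differential_0_eq_iff[of y q y0, OF y0 z] y(2) by (simp add: f_def)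
    then have "\<forall>i. x i - pd q i y0 \<in> rad q"
      by (metis cls_eq_iff)
    with x(2) show False by blast
  qed
  let ?G = "(cochains q 1)\<lparr>carrier := cocycles q 1\<rparr>"
  have "\<one>\<^bsub>cochains q 1\<^esub> \<in> coboundaries q 1"
  proof -
    have "differential q 0 (cochain_of q 0 (\<lambda>_. cls q 0)) = \<one>\<^bsub>cochains q 1\<^esub>"
      by (subst differential_0_eq_one_iff[OF refl]) simp
    moreover have "cochain_of q 0 (\<lambda>_. cls q 0) \<in> carrier (cochains q 0)"
      by (auto simp: carrier_cochains is_form_0_iff)
    ultimately show ?thesis unfolding coboundary by (metis imageI)
  qed
  moreover have "\<one>\<^bsub>cochains q 1\<^esub> \<otimes>\<^bsub>cochains q 1\<^esub> f = f"
  proof -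
    have gens: "z (gens q w) = cls q (x (hd w))" if "length w = 1" for w
      using that z(2) by (auto simp: length_Suc_conv)
    have "\<zero>\<^bsub>quot q\<^esub> \<oplus>\<^bsub>quot q\<^esub> qlin_ext q z a = qlin_ext q z a" if "a \<in> closed_chains q 1" for a
    proof -
      have "length as = 1 \<and> set as \<subseteq> quot_one q" if "as \<in> keys a" for as
        using \<open>a \<in> closed_chains q 1\<close> that by (auto simp: closed_chains_def)
      from qlin_ext_form[OF z(1) this gens] show ?thesis by (simp add: zero_quot add_cls)
    qed
    then show ?thesis
      unfolding f_def cochains_def cochain_of_def by (auto intro!: restrict_ext)
  qed
  ultimately have "f \<in> coboundaries q 1 #>\<^bsub>?G\<^esub> f"
    by (force simp: r_coset_def)
  moreover have "coboundaries q 1 #>\<^bsub>?G\<^esub> f \<in> carrier (cohomology q 1)"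
    using cocycle by (auto simp: cohomology_def FactGroup_def RCOSETS_def)
  moreover have "\<one>\<^bsub>cohomology q 1\<^esub> = coboundaries q 1"
    by (simp add: cohomology_def FactGroup_def)
  ultimately show ?thesis using not_coboundary by auto
qed

theorem theorem3p5p7:
  fixes q :: "'n::finite \<Rightarrow> 'n \<Rightarrow> complex"
  shows
    "unit_class q \<in> iso \<lparr>carrier = UNIV, monoid.mult = (+), one = 0\<rparr> (cohomology q 0) \<and>
     ((\<exists>C. irreducible_constant q C \<and> poly_order C > 2) \<longrightarrow>
        (\<exists>p\<ge>1. carrier (cohomology q p) \<noteq> {\<one>\<^bsub>cohomology q p\<^esub>})) \<and>
     (\<forall>C. is_constant q C \<longrightarrow>
        (\<forall>x. pd_op q C x = 0) \<and>
        (\<forall>Y\<in>carrier (quot q). qpd_op q C Y = \<zero>\<^bsub>quot q\<^esub>)) \<and>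
     (\<forall>p\<ge>1. \<forall>z. is_form q p z \<longrightarrow> (exact_form q p z \<longleftrightarrow> strongly_closed q p z))"
proof (intro conjI allI impI ballI)
  show "unit_class q \<in> iso \<lparr>carrier = UNIV, monoid.mult = (+), one = 0\<rparr> (cohomology q 0)"
    by (rule unit_class_iso)
next
  assume "\<exists>C. irreducible_constant q C \<and> poly_order C > 2"
  then have "carrier (cohomology q 1) \<noteq> {\<one>\<^bsub>cohomology q 1\<^esub>}"
    using irreducible_constant_imp_cohomology_nontrivial by blast
  then show "\<exists>p\<ge>1. carrier (cohomology q p) \<noteq> {\<one>\<^bsub>cohomology q p\<^esub>}"
    by (intro exI[of _ "1 :: nat"] conjI order_refl)
next
  fix C x assume "is_constant q C"
  then show "pd_op q C x = 0" by (rule pd_op_constant')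
next
  fix C Y assume "is_constant q C" "Y \<in> carrier (quot q)"
  then show "qpd_op q C Y = \<zero>\<^bsub>quot q\<^esub>"
    by (auto simp: carrier_quot qpd_op_cls pd_op_constant' zero_quot)
next
  fix p :: nat and z assume "p \<ge> 1" "is_form q p z"
  then show "exact_form q p z \<longleftrightarrow> strongly_closed q p z"
    by (rule exact_iff_strongly_closed)
qed

end
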